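(* Suppose strong duality and strict complementarity hold for the pair of semidefinite programs (P) and (D). Let $r_p\ge0$, $\beta\in(0,\tfrac12]$, $\alpha\ge2D_{\mathcal X_\star}$, $V_0\in\mathbb R^{n\times\bar r}$ (with orthonormal columns), $z_0=y_0\in\mathbb R^m$, $r_c\ge r_d$, and let $\rho$ be properly selected, namely $$\rho\ \ge\ 4\alpha\|\mathcal A^*\|_{\mathrm{op}}^2\max\left\{\frac{72\sup_{y_\star\in\mathcal Y_\star}\|2Z(y_\star)\|_{\mathrm{op}}}{\delta^2},\ \frac{9(8\sqrt2+16)}{\delta}\right\}.$$ Then after at most $T_0$ steps ($T_0$ finite and independent of $\epsilon$; see context), $(r_p,r_c)$-SpecBM subsequently takes only descent steps and $y_t$ converges linearly to an optimal solution, i.e. there are $y_\star\in\mathcal Y_\star$, $c>0$ and $q\in(0,1)$ with $\|y_t-y_\star\|\le c\,q^{\,t-T_0}$ for all $t\ge T_0$. Consequently, there is a constant $K$ independent of $\epsilon$ such that for any $\epsilon\in(0,\tfrac12)$, by some iteration $t\le T_0+K\log(1/\epsilon)$ (that is, $t\le T_0+\mathcal O(\log(1/\epsilon))$), the method produces a pair $(X_t,y_t)$ with $F(y_t)-F(y_\star)\le\epsilon$ and 1. approximate primal feasibility: $\|b-\mathcal A X_t\|^2\le\epsilon$ and $X_t\succeq 0$; 2. approximate dual feasibility: $\lambda_{\min}(C-\mathcal A^*y_t)\ge-\epsilon$; 3. approximate primal-dual optimality: $|\langle b,y_t\rangle-\langle C,X_t\rangle|\le\sqrt{\epsilon}$.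
   Context: **SDP pair.** $\mathbb S^n$ is the space of real symmetric $n\times n$ matrices with the trace inner product, $\mathbb S^n_+$ its positive semidefinite cone, and $\mathbb R^m$ carries the dot product; $\|\cdot\|$ denotes the induced norms, $\|\cdot\|_{\mathrm{op}}$ on matrices is the spectral norm, and $\lambda_1\ge\dots\ge\lambda_n$ denote eigenvalues. Given $C\in\mathbb S^n$, a linear map $\mathcal A:\mathbb S^n\to\mathbb R^m$ with adjoint $\mathcal A^*$, and $b\in\mathbb R^m$, consider (P): maximize $\langle -C,X\rangle$ subject to $\mathcal AX=b$, $X\succeq0$, $X\in\mathbb S^n$; (D): minimize $\langle -b,y\rangle$ subject to $\mathcal A^*y\preceq C$, $y\in\mathbb R^m$. Their solution sets are $\mathcal X_\star$ and $\mathcal Y_\star$. *Strong duality* means: $\mathcal X_\star,\mathcal Y_\star$ are nonempty and compact and $\langle -C,X_\star\rangle=\langle -b,y_\star\rangle$ for all $X_\star\in\mathcal X_\star$, $y_\star\in\mathcal Y_\star$. *Strict complementarity* means: there is $(X_\star,y_\star)\in\mathcal X_\star\times\mathcal Y_\star$ with $\operatorname{rank}(X_\star)+\operatorname{rank}(C-\mathcal A^*y_\star)=n$. Let $D_{\mathcal X_\star}=\sup_{X_\star\in\mathcal X_\star}\|X_\star\|_*$ (nuclear norm), $\|\mathcal A^*\|_{\mathrm{op}}=\max_{\|y\|\le1}\|\mathcal A^*y\|_{F}$, and $Z(y)=C-\mathcal A^*y$. **Penalized dual.** $F(y)=\langle -b,y\rangle+\alpha\max\{\lambda_{\max}(\mathcal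 A^*y-C),0\}$, where the penalty parameter $\alpha$ is larger than $\sup_{X_\star\in\mathcal X_\star}\operatorname{tr}(X_\star)$ (so that minimizing $F$ has the same optimal value and solution set as (D)). **The method $(r_p,r_c)$-SpecBM.** Parameters: integers $r_p\ge0$, $r_c\ge1$, $\bar r=r_p+r_c$; $\rho>0$, $\beta$, $\alpha$. Initialize $\bar X_0=0\in\mathbb S^n$, $z_0=y_0\in\mathbb R^m$, and $V_0\in\mathbb R^{n\times\bar r}$ with orthonormal columns. The spectral model at iteration $t$ is $$\bar F_t(y)=\max_{\eta\ge0,\ S\in\mathbb S^{\bar r}_+,\ \eta\operatorname{tr}(\bar X_t)+\operatorname{tr}(S)\le\alpha}\ \langle -b,y\rangle+\langle \eta\bar X_t+V_tSV_t^\top,\mathcal A^*y-C\rangle .$$ Iteration $t=0,1,2,\dots$: (1) Compute a solution $z_{t+1}=z_t^\star$, $(\eta_t^\star,S_t^\star)$ of the minimax (saddle-point) problem $$\min_z\ \max_{\eta\ge0,\ S\in\mathbb S^{\bar r}_+,\ \eta\operatorname{tr}(\bar X_t)+\operatorname{tr}(S)\le\alpha}\ \langle -b,z\rangle+\langle \eta\bar X_t+V_tSV_t^\top,\mathcal A^*z-C\rangle+\tfrac{\rho}{2}\|z-y_t\|^2,$$ and define the primal iterate $X_t=\eta_t^\star\bar X_t+V_tS_t^\star V_t^\top$. (2) If $\beta\,(F(y_t)-\bar F_t(z_{t+1}))\le F(y_t)-F(z_{t+1})$, set $y_{t+1}=z_{t+1}$ (descent step); otherwise set $y_{t+1}=y_t$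 (null step). (3) Write the eigenvalue decomposition $S_t^\star=Q_1\Lambda_1Q_1^\top+Q_2\Lambda_2Q_2^\top$, where $\Lambda_1$ contains the $r_p$ largest eigenvalues and $\Lambda_2$ the rest, and set $\bar X_{t+1}=\eta_t^\star\bar X_t+V_tQ_2\Lambda_2Q_2^\top V_t^\top$. (4) Compute $r_c$ orthonormal top eigenvectors $v_1,\dots,v_{r_c}$ of $\mathcal A^*z_{t+1}-C$, and let $V_{t+1}\in\mathbb R^{n\times\bar r}$ have orthonormal columns whose span contains $v_1,\dots,v_{r_c}$ and the columns of $V_tQ_1$. **Constants.** $r_d=\max_{y_\star\in\mathcal Y_\star}\dim\operatorname{nullspace}(Z(y_\star))$. The gap parameter is $\delta=\inf_{y_\star\in\mathcal Y_\star}\max_{1\le r\le r_d}\big(\lambda_r(-Z(y_\star))-\lambda_{r+1}(-Z(y_\star))\big)$, understood to be well defined and positive. $T_0$ is the index of the first descent step such that for all $t\ge T_0$ the matrix $Z(y_t)$ is within distance $\delta/3$ (Frobenius norm) of the set $Z(\mathcal Y_\star)=\{Z(y_\star):y_\star\in\mathcal Y_\star\}$.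
   Formalization: Finiteness of T_0 is claimed only when y_0 is not itself a dual solution: from an optimal y_0 the method may take null steps forever, so T_0 need not exist; all other conclusions are stated for every run in which T_0 exists. *)

theory Defs
  imports "HOL-Analysis.Analysis" "HOL-Library.Multiset"
begin

text \<open>
  A real matrix with p rows and q columns has type \<open>real^'q^'p\<close>.  On matrices, the library's
  \<open>inner\<close> (\<open>\<bullet>\<close>) is the trace inner product and \<open>norm\<close> is the Frobenius norm; the spectral
  norm of \<open>M\<close> is \<open>onorm ((*v) M)\<close>.
\<close>

definition sym_mats :: "(real^'n^'n) set" where
  "sym_mats = {X. transpose X = X}"

definition psd :: "real^'n^'n \<Rightarrow> bool" where
  "psd X \<longleftrightarrow> X \<in> sym_mats \<and> (\<forall>v. 0 \<le> v \<bullet> (X *v v))"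

definition outer :: "real^'n \<Rightarrow> real^'n \<Rightarrow> real^'n^'n" where
  "outer u v = (\<chi> i j. u $ i * v $ j)"

definition orthonormal_columns :: "real^'q^'p \<Rightarrow> bool" where
  "orthonormal_columns V \<longleftrightarrow> transpose V ** V = mat 1"

definition eigenspace :: "real^'n^'n \<Rightarrow> real \<Rightarrow> (real^'n) set" where
  "eigenspace M x = {v. M *v v = x *\<^sub>R v}"

text \<open>
  The eigenvalues in decreasing order, each repeated according to the dimension of its eigenspace.
  For a symmetric matrix of order n the list has length n, and \<open>eigval k M\<close>, with
  \<open>1 \<le> k \<le> n\<close>, is the k-th largest eigenvalue.
\<close>

definition eigvals :: "real^'n^'n \<Rightarrow> real list" where
  "eigvals M = rev (sorted_list_of_multiset
     (\<Sum>x | eigenspace M x \<noteq> {0}. replicate_mset (dim (eigenspace M x)) x))"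

definition eigval :: "nat \<Rightarrow> real^'n^'n \<Rightarrow> real" where
  "eigval k M = eigvals M ! (k - 1)"

definition eigval_max :: "real^'n^'n \<Rightarrow> real" where
  "eigval_max M = eigval 1 M"

definition eigval_min :: "real^'n^'n \<Rightarrow> real" where
  "eigval_min M = eigval CARD('n) M"

text \<open>The sum of the singular values, i.e. of the square roots of the eigenvalues of \<open>M\<^sup>T M\<close>.\<close>

definition nuclear_norm :: "real^'n^'n \<Rightarrow> real" where
  "nuclear_norm M = sum_list (map sqrt (eigvals (transpose M ** M)))"


text \<open>
  The space of symmetric matrices is a subspace of \<open>real^'n^'n\<close>, so a map defined on it is a
  function on \<open>real^'n^'n\<close> whose values off \<open>sym_mats\<close> are irrelevant.  Its adjoint takes values in
  \<open>sym_mats\<close>; the library's \<open>adjoint\<close> is the adjoint on all of \<open>real^'n^'n\<close> and in general is not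
  symmetric-valued.
\<close>

definition linear_on_sym :: "(real^'n^'n \<Rightarrow> real^'m) \<Rightarrow> bool" where
  "linear_on_sym A \<longleftrightarrow>
     (\<forall>X\<in>sym_mats. \<forall>Y\<in>sym_mats. A (X + Y) = A X + A Y) \<and>
     (\<forall>X\<in>sym_mats. \<forall>c. A (c *\<^sub>R X) = c *\<^sub>R A X)"

definition adj :: "(real^'n^'n \<Rightarrow> real^'m) \<Rightarrow> real^'m \<Rightarrow> real^'n^'n" where
  "adj A y = (THE W. W \<in> sym_mats \<and> (\<forall>X\<in>sym_mats. W \<bullet> X = y \<bullet> A X))"

definition slack :: "real^'n^'n \<Rightarrow> (real^'n^'n \<Rightarrow> real^'m) \<Rightarrow> real^'m \<Rightarrow> real^'n^'n" where
  "slack C A y = C - adj A y"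

definition primal_feasible :: "(real^'n^'n \<Rightarrow> real^'m) \<Rightarrow> real^'m \<Rightarrow> (real^'n^'n) set" where
  "primal_feasible A b = {X. A X = b \<and> psd X}"

definition dual_feasible :: "real^'n^'n \<Rightarrow> (real^'n^'n \<Rightarrow> real^'m) \<Rightarrow> (real^'m) set" where
  "dual_feasible C A = {y. psd (slack C A y)}"

definition primal_sols ::
  "real^'n^'n \<Rightarrow> (real^'n^'n \<Rightarrow> real^'m) \<Rightarrow> real^'m \<Rightarrow> (real^'n^'n) set" where
  "primal_sols C A b =
     {X \<in> primal_feasible A b. \<forall>X'\<in>primal_feasible A b. (- C) \<bullet> X' \<le> (- C) \<bullet> X}"

definition dual_sols ::
  "real^'n^'n \<Rightarrow> (real^'n^'n \<Rightarrow> real^'m) \<Rightarrow> real^'m \<Rightarrow> (real^'m) set" where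
  "dual_sols C A b =
     {y \<in> dual_feasible C A. \<forall>y'\<in>dual_feasible C A. (- b) \<bullet> y \<le> (- b) \<bullet> y'}"

definition strong_duality ::
  "real^'n^'n \<Rightarrow> (real^'n^'n \<Rightarrow> real^'m) \<Rightarrow> real^'m \<Rightarrow> bool" where
  "strong_duality C A b \<longleftrightarrow>
     primal_sols C A b \<noteq> {} \<and> compact (primal_sols C A b) \<and>
     dual_sols C A b \<noteq> {} \<and> compact (dual_sols C A b) \<and>
     (\<forall>X\<in>primal_sols C A b. \<forall>y\<in>dual_sols C A b. (- C) \<bullet> X = (- b) \<bullet> y)"

definition strict_complementarity ::
  "real^'n^'n \<Rightarrow> (real^'n^'n \<Rightarrow> real^'m) \<Rightarrow> real^'m \<Rightarrow> bool" where
  "strict_complementarity C A b \<longleftrightarrow>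
     (\<exists>X\<in>primal_sols C A b. \<exists>y\<in>dual_sols C A b. rank X + rank (slack C A y) = CARD('n))"
  for C :: "real^'n^'n"

definition primal_size ::
  "real^'n^'n \<Rightarrow> (real^'n^'n \<Rightarrow> real^'m) \<Rightarrow> real^'m \<Rightarrow> real" where
  "primal_size C A b = (SUP X\<in>primal_sols C A b. nuclear_norm X)"

definition dual_nullity ::
  "real^'n^'n \<Rightarrow> (real^'n^'n \<Rightarrow> real^'m) \<Rightarrow> real^'m \<Rightarrow> nat" where
  "dual_nullity C A b = Max ((\<lambda>y. dim {v. slack C A y *v v = 0}) ` dual_sols C A b)"

text \<open>
  Meaningful only if \<open>1 \<le> dual_nullity C A b < n\<close>: otherwise the maximum ranges over the empty set or
  refers to an (n+1)-st eigenvalue.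
\<close>

definition gap ::
  "real^'n^'n \<Rightarrow> (real^'n^'n \<Rightarrow> real^'m) \<Rightarrow> real^'m \<Rightarrow> real" where
  "gap C A b =
     (INF y\<in>dual_sols C A b.
        Max ((\<lambda>r. eigval r (- slack C A y) - eigval (r + 1) (- slack C A y))
             ` {1..dual_nullity C A b}))"

definition penalized_dual ::
  "real^'n^'n \<Rightarrow> (real^'n^'n \<Rightarrow> real^'m) \<Rightarrow> real^'m \<Rightarrow> real \<Rightarrow> real^'m \<Rightarrow> real" where
  "penalized_dual C A b \<alpha> y = (- b) \<bullet> y + \<alpha> * max (eigval_max (adj A y - C)) 0"

text \<open>In the model below, \<open>Xb\<close> and \<open>V\<close> are the current aggregate matrix and orthonormal basis.\<close>

definition model_set :: "real \<Rightarrow> real^'n^'n \<Rightarrow> (real \<times> (real^'r^'r)) set" where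
  "model_set \<alpha> Xb = {(\<eta>, S). 0 \<le> \<eta> \<and> psd S \<and> \<eta> * trace Xb + trace S \<le> \<alpha>}"

definition model_mat :: "real^'n^'n \<Rightarrow> real^'r^'n \<Rightarrow> real \<times> (real^'r^'r) \<Rightarrow> real^'n^'n" where
  "model_mat Xb V w = fst w *\<^sub>R Xb + V ** snd w ** transpose V"

definition model_term ::
  "real^'n^'n \<Rightarrow> (real^'n^'n \<Rightarrow> real^'m) \<Rightarrow> real^'m \<Rightarrow> real^'n^'n \<Rightarrow> real^'r^'n
     \<Rightarrow> real^'m \<Rightarrow> real \<times> (real^'r^'r) \<Rightarrow> real" where
  "model_term C A b Xb V y w = (- b) \<bullet> y + model_mat Xb V w \<bullet> (adj A y - C)"

definition spectral_model ::
  "real^'n^'n \<Rightarrow> (real^'n^'n \<Rightarrow> real^'m) \<Rightarrow> real^'m \<Rightarrow> real \<Rightarrow> real^'n^'n \<Rightarrow> real^'r^'n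
     \<Rightarrow> real^'m \<Rightarrow> real" where
  "spectral_model C A b \<alpha> Xb V y = (SUP w\<in>model_set \<alpha> Xb. model_term C A b Xb V y w)"

definition saddle_point ::
  "('a \<Rightarrow> 'w \<Rightarrow> real) \<Rightarrow> 'w set \<Rightarrow> 'a \<Rightarrow> 'w \<Rightarrow> bool" where
  "saddle_point L W z w \<longleftrightarrow> w \<in> W \<and> (\<forall>w'\<in>W. L z w' \<le> L z w) \<and> (\<forall>z'. L z w \<le> L z' w)"

definition subproblem_solution ::
  "real^'n^'n \<Rightarrow> (real^'n^'n \<Rightarrow> real^'m) \<Rightarrow> real^'m \<Rightarrow> real \<Rightarrow> real \<Rightarrow> real^'n^'n \<Rightarrow> real^'r^'n
     \<Rightarrow> real^'m \<Rightarrow> real^'m \<Rightarrow> real \<times> (real^'r^'r) \<Rightarrow> bool" where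
  "subproblem_solution C A b \<rho> \<alpha> Xb V y =
     saddle_point (\<lambda>z w. model_term C A b Xb V z w + \<rho> / 2 * (norm (z - y))\<^sup>2) (model_set \<alpha> Xb)"

definition descent_test ::
  "real^'n^'n \<Rightarrow> (real^'n^'n \<Rightarrow> real^'m) \<Rightarrow> real^'m \<Rightarrow> real \<Rightarrow> real \<Rightarrow> real^'n^'n \<Rightarrow> real^'r^'n
     \<Rightarrow> real^'m \<Rightarrow> real^'m \<Rightarrow> bool" where
  "descent_test C A b \<beta> \<alpha> Xb V y z \<longleftrightarrow>
     \<beta> * (penalized_dual C A b \<alpha> y - spectral_model C A b \<alpha> Xb V z)
       \<le> penalized_dual C A b \<alpha> y - penalized_dual C A b \<alpha> z"

text \<open>
  \<open>Q\<close> and \<open>l\<close> are a full orthogonal eigendecomposition of \<open>S\<close>; \<open>I\<close> selects the columns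
  of \<open>Q\<close> that form \<open>Q\<^sub>1\<close> (with \<open>rp\<close> largest eigenvalues), the others form \<open>Q\<^sub>2\<close>.
\<close>

definition eigen_split :: "nat \<Rightarrow> real^'r^'r \<Rightarrow> real^'r^'r \<Rightarrow> real^'r \<Rightarrow> 'r set \<Rightarrow> bool" where
  "eigen_split rp S Q l I \<longleftrightarrow>
     orthogonal_matrix Q \<and>
     S = (\<Sum>i\<in>UNIV. l $ i *\<^sub>R outer (column i Q) (column i Q)) \<and>
     card I = rp \<and> (\<forall>i\<in>I. \<forall>j\<in>-I. l $ j \<le> l $ i)"

definition top_eigenvectors :: "nat \<Rightarrow> real^'n^'n \<Rightarrow> (nat \<Rightarrow> real^'n) \<Rightarrow> bool" where
  "top_eigenvectors rc M v \<longleftrightarrow>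
     (\<forall>i\<in>{1..rc}. M *v v i = eigval i M *\<^sub>R v i) \<and>
     (\<forall>i\<in>{1..rc}. \<forall>j\<in>{1..rc}. v i \<bullet> v j = (if i = j then 1 else 0))"

definition bundle_update ::
  "nat \<Rightarrow> nat \<Rightarrow> real^'n^'n \<Rightarrow> real^'n^'n \<Rightarrow> real^'r^'n \<Rightarrow> real \<times> (real^'r^'r)
     \<Rightarrow> real^'n^'n \<Rightarrow> real^'r^'n \<Rightarrow> bool" where
  "bundle_update rp rc M Xb V w Xb' V' \<longleftrightarrow>
     (\<exists>Q l I v. eigen_split rp (snd w) Q l I \<and> top_eigenvectors rc M v \<and>
        Xb' = fst w *\<^sub>R Xb
              + V ** (\<Sum>i\<in>-I. l $ i *\<^sub>R outer (column i Q) (column i Q)) ** transpose V \<and>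
        orthonormal_columns V' \<and>
        v ` {1..rc} \<union> (\<lambda>i. column i (V ** Q)) ` I \<subseteq> span (columns V'))"

text \<open>
  A run of the method: \<open>w t\<close> is the pair \<open>(\<eta>\<^sub>t, S\<^sub>t)\<close>.  The choices the method leaves open
  (subproblem solution, eigenvectors, orthonormal basis) are arbitrary.
\<close>

definition specbm_run ::
  "real^'n^'n \<Rightarrow> (real^'n^'n \<Rightarrow> real^'m) \<Rightarrow> real^'m \<Rightarrow> nat \<Rightarrow> nat \<Rightarrow> real \<Rightarrow> real \<Rightarrow> real
     \<Rightarrow> real^'m \<Rightarrow> real^'r^'n
     \<Rightarrow> (nat \<Rightarrow> real^'n^'n) \<Rightarrow> (nat \<Rightarrow> real^'r^'n) \<Rightarrow> (nat \<Rightarrow> real^'m) \<Rightarrow> (nat \<Rightarrow> real^'m)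
     \<Rightarrow> (nat \<Rightarrow> real \<times> (real^'r^'r)) \<Rightarrow> (nat \<Rightarrow> real^'n^'n) \<Rightarrow> bool" where
  "specbm_run C A b rp rc \<rho> \<beta> \<alpha> y0 V0 Xb V z y w X \<longleftrightarrow>
     Xb 0 = 0 \<and> z 0 = y0 \<and> y 0 = y0 \<and> V 0 = V0 \<and>
     (\<forall>t. subproblem_solution C A b \<rho> \<alpha> (Xb t) (V t) (y t) (z (Suc t)) (w t) \<and>
          X t = model_mat (Xb t) (V t) (w t) \<and>
          y (Suc t) = (if descent_test C A b \<beta> \<alpha> (Xb t) (V t) (y t) (z (Suc t))
                       then z (Suc t) else y t) \<and>
          bundle_update rp rc (adj A (z (Suc t)) - C) (Xb t) (V t) (w t) (Xb (Suc t)) (V (Suc t)))"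

definition descent_step ::
  "real^'n^'n \<Rightarrow> (real^'n^'n \<Rightarrow> real^'m) \<Rightarrow> real^'m \<Rightarrow> real \<Rightarrow> real
     \<Rightarrow> (nat \<Rightarrow> real^'n^'n) \<Rightarrow> (nat \<Rightarrow> real^'r^'n) \<Rightarrow> (nat \<Rightarrow> real^'m) \<Rightarrow> (nat \<Rightarrow> real^'m)
     \<Rightarrow> nat \<Rightarrow> bool" where
  "descent_step C A b \<beta> \<alpha> Xb V z y t \<longleftrightarrow>
     descent_test C A b \<beta> \<alpha> (Xb t) (V t) (y t) (z (Suc t))"

text \<open>
  \<open>T\<close> is the least index of an iteration that is itself a descent step and from which on all
  \<open>y t\<close> stay within the stated Frobenius distance.  Such an index need not exist if the initial
  point is already an optimal dual solution: since the initial basis is arbitrary, the method may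
  then take null steps forever.
\<close>

definition is_T0 ::
  "real^'n^'n \<Rightarrow> (real^'n^'n \<Rightarrow> real^'m) \<Rightarrow> real^'m \<Rightarrow> real \<Rightarrow> real
     \<Rightarrow> (nat \<Rightarrow> real^'n^'n) \<Rightarrow> (nat \<Rightarrow> real^'r^'n) \<Rightarrow> (nat \<Rightarrow> real^'m) \<Rightarrow> (nat \<Rightarrow> real^'m)
     \<Rightarrow> nat \<Rightarrow> bool" where
  "is_T0 C A b \<beta> \<alpha> Xb V z y T \<longleftrightarrow>
     (let P = (\<lambda>s. descent_step C A b \<beta> \<alpha> Xb V z y s \<and>
                   (\<forall>t\<ge>s. infdist (slack C A (y t)) (slack C A ` dual_sols C A b) \<le> gap C A b / 3))
      in P T \<and> (\<forall>s<T. \<not> P s))"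

end

theory Submission
  imports Defs
begin

text \<open>
  Write \<open>W y = \<A>\<^sup>* y - C\<close>, let \<open>F\<close> be the penalized dual and let \<open>opt\<close> be the common optimal
  value.  For every primal solution \<open>X\<close> the identity \<open>\<langle>-b, y\<rangle> = opt - \<langle>X, W y\<rangle>\<close> holds, so
  \<open>F y - opt\<close> is the complementarity defect \<open>-\<langle>X, W y\<rangle>\<close> plus \<open>\<alpha>\<close> times the positive part of
  \<open>\<lambda>\<^sub>m\<^sub>a\<^sub>x (W y)\<close>.  Because \<open>\<alpha>\<close> exceeds the trace of \<open>X\<close>, both parts are controlled by
  \<open>F y - opt\<close>.  Three facts carry the proof.

  \<^bold>\<open>Quadratic growth\<close> (\<open>quadratic_growth\<close>).  On bounded sets
  \<open>dist(y, Y\<^sub>\<star>) \<le> \<kappa> \<surd>(F y - opt)\<close>.  Take a strictly complementary pair \<open>(X, y\<^sub>0)\<close> and let \<open>U\<close> be the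
  range of \<open>X\<close>.  A positive semidefinite matrix with a small diagonal block on \<open>U\<close> has off-diagonal
  blocks of the order of the square root; hence \<open>y\<close> almost solves the linear system \<open>W y|\<^sub>U = 0\<close>, with an
  error of order \<open>\<surd>(F y - opt)\<close>.  Move \<open>y\<close> to a solution of this system.  On the complement of
  \<open>U\<close> the slack of \<open>y\<^sub>0\<close> is positive definite, so a small step towards \<open>y\<^sub>0\<close> restores
  feasibility.  Feasible points with \<open>W y|\<^sub>U = 0\<close> are optimal.

  \<^bold>\<open>Quadratic accuracy of the model\<close> (\<open>quadratic_model_accuracy\<close>).  Near the solution set,
  Weyl's inequality leaves some eigenvalue gap \<open>\<lambda>\<^sub>r - \<lambda>\<^sub>r\<^sub>+\<^sub>1 \<ge> \<delta>/3\<close> with \<open>r \<le> r\<^sub>d \<le> r\<^sub>c\<close>.  After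
  a descent step the model contains the top \<open>r\<close> eigenvectors at its own centre \<open>y\<^sub>t\<close>.  A perturbation
  of size \<open>e\<close> couples them to the remaining eigenvectors by at most \<open>e\<close>, which
  the gap turns into an error of order \<open>e\<^sup>2/\<delta>\<close> in the largest eigenvalue.  So
  \<open>F \<le> model + (\<rho>/2) \<parallel>\<sqdot> - y\<^sub>t\<parallel>\<^sup>2\<close> when \<open>\<rho>\<close> is large, and then the descent test
  succeeds again (\<open>descent_persists\<close>).

  \<^bold>\<open>Convergence of the bundle method\<close>.  If only null steps follow, the values of the proximal
  subproblems increase and are bounded, so consecutive trial points approach each other; each model
  supports \<open>F\<close> at the preceding trial point, so the descent test can fail forever only at an
  optimal centre (\<open>null_steps_optimal\<close>).  If there are infinitely many descent steps, the
  predicted decrease tends to zero and \<open>F (y\<^sub>t)\<close> tends to \<open>opt\<close> (\<open>values_converge\<close>).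
  Termination by null steps would happen at a solution that was reached by a descent step, where
  the second fact forces one more descent step; this yields \<open>T\<^sub>0\<close> for a non-optimal start.

  From \<open>T\<^sub>0\<close> on, the inequality of the proximal step reads
  \<open>F (y\<^sub>t\<^sub>+\<^sub>1) + (\<rho>/2) \<parallel>u - y\<^sub>t\<^sub>+\<^sub>1\<parallel>\<^sup>2 \<le> F u + (\<rho>/2) \<parallel>u - y\<^sub>t\<parallel>\<^sup>2\<close>.  With \<open>u\<close> the solution closest
  to \<open>y\<^sub>t\<close>, quadratic growth makes the distance to \<open>Y\<^sub>\<star>\<close> contract by a fixed factor.  The steps are
  then geometrically small, and every error in the claim is bounded by a constant times the
  distances of the iterates to their limit.
\<close>


section \<open>Symmetric matrices and quadratic forms\<close>

text \<open>
  Rank-one matrices turn bilinear forms into inner products of matrices, so that bounds on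
  bilinear forms follow from the Cauchy-Schwarz inequality for the Frobenius norm.
\<close>

lemma inner_outer: "M \<bullet> outer u v = u \<bullet> (M *v v)"
  by (simp add: inner_vec_def outer_def matrix_vector_mult_def sum_distrib_left algebra_simps)

lemma outer_mult_vec: "outer u v *v w = (v \<bullet> w) *\<^sub>R u"
  by (simp add: vec_eq_iff outer_def matrix_vector_mult_def inner_vec_def sum_distrib_left
      sum_distrib_right algebra_simps)

lemma sum_matrix_vector_mult:
  fixes f :: "'i \<Rightarrow> real^'n^'m"
  shows "(\<Sum>i\<in>I. f i) *v x = (\<Sum>i\<in>I. f i *v x)"
  by (induction I rule: infinite_finite_induct) (auto simp: matrix_vector_mult_add_rdistrib)

lemma norm_outer: "norm (outer u v) = norm u * norm v"
proof -
  have "(norm (outer u v))\<^sup>2 = (norm u * norm v)\<^sup>2"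
    by (simp add: power2_norm_eq_inner inner_outer outer_mult_vec power_mult_distrib)
  then show ?thesis by simp
qed

lemma abs_bilinear_le:
  fixes M :: "real^'n^'n"
  shows "\<bar>u \<bullet> (M *v v)\<bar> \<le> norm M * norm u * norm (v :: real^'n)"
  using Cauchy_Schwarz_ineq2[of M "outer u v"] by (simp add: inner_outer norm_outer mult.assoc)

lemma sym_mats_commute:
  assumes "M \<in> sym_mats" shows "u \<bullet> (M *v v) = v \<bullet> (M *v u)"
proof -
  have "v \<bullet> (M *v u) = (v v* M) \<bullet> u" by (simp add: dot_lmul_matrix)
  also have "v v* M = M *v v"
    using assms transpose_matrix_vector[of M v] by (simp add: sym_mats_def)
  finally show ?thesis by (simp add: inner_commute)
qed

lemma subspace_sym_mats: "subspace sym_mats"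
  by (auto simp: subspace_def sym_mats_def transpose_def vec_eq_iff)

lemma outer_self_sym: "outer u u \<in> sym_mats"
  by (simp add: sym_mats_def transpose_def outer_def vec_eq_iff mult.commute)

lemma mat1_sym: "mat 1 \<in> sym_mats"
  by (simp add: sym_mats_def)

text \<open>
  The Cauchy-Schwarz inequality for a form that is only semidefinite, and only on a subspace:
  the form is nonnegative on the plane spanned by \<open>u\<close> and \<open>v\<close>, so its discriminant there is at most zero.
\<close>

lemma psd_form_Cauchy_Schwarz:
  assumes M: "M \<in> sym_mats" and S: "subspace S"
    and pos: "\<And>x. x \<in> S \<Longrightarrow> 0 \<le> x \<bullet> (M *v x)" and "u \<in> S" "v \<in> S"
  shows "(u \<bullet> (M *v v))\<^sup>2 \<le> (u \<bullet> (M *v u)) * (v \<bullet> (M *v v))"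
proof -
  define p q r where "p = u \<bullet> (M *v u)" and "q = u \<bullet> (M *v v)" and "r = v \<bullet> (M *v v)"
  have pq: "0 \<le> s\<^sup>2 * p + 2 * s * t * q + t\<^sup>2 * r" for s t
  proof -
    have "s *\<^sub>R u + t *\<^sub>R v \<in> S"
      using assms by (simp add: subspace_add subspace_scale)
    from pos[OF this] show ?thesis
      using sym_mats_commute[OF M, of u v]
      by (simp add: matrix_vector_right_distrib inner_add_left inner_add_right p_def q_def r_def
          matrix_vector_mult_scaleR power2_eq_square algebra_simps)
  qed
  have "0 \<le> p" using pq[of 1 0] by simp
  have "q\<^sup>2 \<le> p * r"
  proof (cases "p = 0")
    case True
    have "0 \<le> 2 * s * q + r" for s using pq[of s 1] True by simp
    from this[of "- (r + 1) / (2 * q)"] True show ?thesis by (cases "q = 0") (auto simp: field_simps)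
  next
    case False
    with \<open>0 \<le> p\<close> have "0 < p" by simp
    have "0 \<le> p * (p * r - q\<^sup>2)"
      using pq[of q "-p"] by (simp add: power2_eq_square algebra_simps)
    with \<open>0 < p\<close> show ?thesis by (simp add: zero_le_mult_iff)
  qed
  then show ?thesis by (simp add: p_def q_def r_def)
qed

section \<open>The spectral theorem\<close>

text \<open>
  A maximizer \<open>u\<close> of the Rayleigh quotient on \<open>S\<close>, with value \<open>c\<close>, annihilates the semidefinite form
  \<open>c I - M\<close> on \<open>S\<close>.  By Cauchy-Schwarz the vector \<open>(c I - M) u\<close> is then orthogonal to \<open>S\<close>, to which it belongs.
\<close>

lemma Rayleigh_max_eigenvector:
  fixes M :: "real^'n^'n"
  assumes M: "M \<in> sym_mats" and S: "subspace S" and "S \<noteq> {0}"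
    and inv: "\<And>x. x \<in> S \<Longrightarrow> M *v x \<in> S"
  shows "\<exists>u\<in>S. \<exists>c. u \<noteq> 0 \<and> M *v u = c *\<^sub>R u"
proof -
  obtain x where x: "x \<in> S" "x \<noteq> 0" using assms(3) subspace_0[OF S] by auto
  then have ne: "sphere 0 1 \<inter> S \<noteq> {}"
  proof -
    have "(1 / norm x) *\<^sub>R x \<in> sphere 0 1 \<inter> S" using x by (simp add: subspace_scale[OF S])
    then show ?thesis by blast
  qed
  have comp: "compact (sphere (0::real^'n) 1 \<inter> S)"
    by (intro compact_Int_closed compact_sphere closed_subspace S)
  have cont: "continuous_on (sphere (0::real^'n) 1 \<inter> S) (\<lambda>x. x \<bullet> (M *v x))"
    by (intro continuous_intros linear_continuous_on linear_conv_bounded_linear[THEN iffD1] matrix_vector_mul_linear)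
  obtain u where u: "u \<in> sphere 0 1 \<inter> S"
    and umax: "\<And>x. x \<in> sphere 0 1 \<inter> S \<Longrightarrow> x \<bullet> (M *v x) \<le> u \<bullet> (M *v u)"
    using continuous_attains_sup[OF comp ne cont] by auto
  define c where "c = u \<bullet> (M *v u)"
  define N where "N = c *\<^sub>R mat 1 - M"
  have N: "N \<in> sym_mats"
    unfolding N_def by (intro subspace_diff[OF subspace_sym_mats] subspace_scale[OF subspace_sym_mats] mat1_sym M)
  have Nv: "N *v v = c *\<^sub>R v - M *v v" for v
    by (simp add: N_def matrix_vector_mult_diff_rdistrib scaleR_matrix_vector_assoc[symmetric])
  have pos: "0 \<le> x \<bullet> (N *v x)" if "x \<in> S" for x
  proof (cases "x = 0")
    case False
    have "(1 / norm x) *\<^sub>R x \<in> sphere 0 1 \<inter> S"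
      using that False by (simp add: subspace_scale[OF S])
    from umax[OF this] have "x \<bullet> (M *v x) / (norm x)\<^sup>2 \<le> c"
      by (simp add: c_def matrix_vector_mult_scaleR power2_eq_square)
    then show ?thesis using False
      by (simp add: Nv inner_diff_right power2_norm_eq_inner[symmetric] divide_le_eq)
  qed simp
  have uN: "u \<bullet> (N *v u) = 0"
    using u by (simp add: Nv inner_diff_right c_def power2_norm_eq_inner[symmetric])
  have NuS: "N *v u \<in> S"
    using u inv by (simp add: Nv subspace_diff[OF S] subspace_scale[OF S])
  have "((N *v u) \<bullet> (N *v u))\<^sup>2 \<le> 0"
    using psd_form_Cauchy_Schwarz[OF N S pos NuS, of u] u uN by simp
  then have "N *v u = 0" by simp
  then show ?thesis using u Nv[of u] by (intro bexI[of _ u] exI[of _ c]) auto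
qed

lemma subspace_eigenspace: "subspace (eigenspace M x)"
  by (auto simp: subspace_def eigenspace_def matrix_vector_right_distrib matrix_vector_mult_scaleR
      scaleR_right_distrib)

lemma eigenspaces_orthogonal:
  assumes "M \<in> sym_mats" "u \<in> eigenspace M x" "v \<in> eigenspace M y" "x \<noteq> y"
  shows "u \<bullet> v = 0"
proof -
  have "y * (u \<bullet> v) = x * (u \<bullet> v)"
    using sym_mats_commute[OF assms(1), of u v] assms(2,3) by (simp add: eigenspace_def inner_commute)
  then show ?thesis using assms(4) by simp
qed

text \<open>
  Eigenspaces of different eigenvalues are orthogonal, so orthonormal bases of all of them
  form an orthonormal set.  It spans the whole space: otherwise its orthogonal complement, which is
  invariant, would contain another eigenvector.
\<close>

lemma orthonormal_eigenbasis:
  fixes M :: "real^'n^'n"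
  assumes M: "M \<in> sym_mats"
  obtains B where "finite B" "card B = CARD('n)" "pairwise orthogonal B" "\<And>u. u \<in> B \<Longrightarrow> norm u = 1"
    "\<And>u. u \<in> B \<Longrightarrow> M *v u = (u \<bullet> (M *v u)) *\<^sub>R u"
    "\<And>x. card {u \<in> B. u \<bullet> (M *v u) = x} = dim (eigenspace M x)"
proof -
  have "\<forall>x. \<exists>Bx. Bx \<subseteq> eigenspace M x \<and> pairwise orthogonal Bx \<and> (\<forall>u\<in>Bx. norm u = 1) \<and>
     independent Bx \<and> card Bx = dim (eigenspace M x) \<and> span Bx = eigenspace M x"
    using orthonormal_basis_subspace[OF subspace_eigenspace] by metis
  then obtain E where E: "\<And>x. E x \<subseteq> eigenspace M x" "\<And>x. pairwise orthogonal (E x)"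
    "\<And>x u. u \<in> E x \<Longrightarrow> norm u = 1" "\<And>x. card (E x) = dim (eigenspace M x)"
    "\<And>x. span (E x) = eigenspace M x" by metis
  define B where "B = (\<Union>x. E x)"
  have Ev: "M *v u = x *\<^sub>R u \<and> u \<bullet> (M *v u) = x" if "u \<in> E x" for u x
    using that E(1)[of x] E(3)[OF that]
    by (auto simp: eigenspace_def power2_norm_eq_inner[symmetric])
  have nB: "norm u = 1" if "u \<in> B" for u using that E(3) by (auto simp: B_def)
  have orth: "pairwise orthogonal B"
  proof (rule pairwiseI)
    fix u v assume uv: "u \<in> B" "v \<in> B" "u \<noteq> v"
    then obtain x y where xy: "u \<in> E x" "v \<in> E y" by (auto simp: B_def)
    show "orthogonal u v"
    proof (cases "x = y")
      case True
      then show ?thesis using E(2)[of x] xy uv by (auto simp: pairwise_def)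
    next
      case False
      then show ?thesis
        using eigenspaces_orthogonal[OF M _ _ False, of u v] xy E(1) by (auto simp: orthogonal_def)
    qed
  qed
  have indep: "independent B"
    using pairwise_orthogonal_independent[OF orth] nB by force
  have fin: "finite B" using indep by (rule independent_imp_finite)
  define S where "S = {x. \<forall>u\<in>B. orthogonal u x}"
  have S: "subspace S"
    unfolding S_def using subspace_orthogonal_to_vectors[of B] by (simp add: orthogonal_commute)
  have "S = {0}"
  proof (rule ccontr)
    assume "S \<noteq> {0}"
    have "M *v x \<in> S" if "x \<in> S" for x
      unfolding S_def
    proof safe
      fix u assume u: "u \<in> B"
      then obtain c where "u \<in> E c" by (auto simp: B_def)
      then have "u \<bullet> (M *v x) = c * (u \<bullet> x)"
        using Ev sym_mats_commute[OF M, of u x] by (simp add: inner_commute)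
      also have "\<dots> = 0" using u that by (simp add: S_def orthogonal_def)
      finally show "orthogonal u (M *v x)" by (simp add: orthogonal_def)
    qed
    from Rayleigh_max_eigenvector[OF M S \<open>S \<noteq> {0}\<close> this]
    obtain u c where u: "u \<in> S" "u \<noteq> 0" "M *v u = c *\<^sub>R u" by auto
    then have "u \<in> span (E c)" by (simp add: E(5) eigenspace_def)
    moreover have "orthogonal u v" if "v \<in> E c" for v
    proof -
      have "v \<in> B" using that by (auto simp: B_def)
      then show ?thesis using u(1) orthogonal_commute[of u v] by (simp add: S_def)
    qed
    ultimately have "orthogonal u u" using orthogonal_to_span by blast
    then show False using u by (simp add: orthogonal_self)
  qed
  have "span B = UNIV"
  proof (rule ccontr)
    assume "span B \<noteq> UNIV"
    then have "span B \<subset> span UNIV" by auto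
    from orthogonal_to_subspace_exists_gen[OF this]
    obtain x where "x \<noteq> 0" "\<And>y. y \<in> span B \<Longrightarrow> orthogonal x y" by blast
    then have "x \<in> S" by (auto simp: S_def orthogonal_commute span_base)
    with \<open>S = {0}\<close> \<open>x \<noteq> 0\<close> show False by simp
  qed
  then have "card B = CARD('n)"
    using indep by (metis dim_UNIV dim_eq_card_independent dim_span DIM_cart DIM_real mult.right_neutral)
  moreover have "{u \<in> B. u \<bullet> (M *v u) = x} = E x" for x
    using Ev by (auto simp: B_def)
  moreover have "M *v u = (u \<bullet> (M *v u)) *\<^sub>R u" if "u \<in> B" for u
    using that Ev by (auto simp: B_def)
  ultimately show thesis
    using that[OF fin _ orth nB] E(4) by simp
qed

text \<open>
  Sorting an orthonormal eigenbasis by decreasing eigenvalue lists the eigenvalues exactly as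
  \<open>eigvals\<close> does, because both count an eigenvalue as often as the dimension of its eigenspace.
\<close>

lemma eigvals_eigenbasis:
  fixes M :: "real^'n^'n"
  assumes M: "M \<in> sym_mats"
  obtains us where "length us = CARD('n)" "distinct us" "pairwise orthogonal (set us)"
    "\<And>u. u \<in> set us \<Longrightarrow> norm u = 1"
    "\<And>u. u \<in> set us \<Longrightarrow> M *v u = (u \<bullet> (M *v u)) *\<^sub>R u"
    "eigvals M = map (\<lambda>u. u \<bullet> (M *v u)) us"
proof -
  define ev where "ev = (\<lambda>u. u \<bullet> (M *v u))"
  obtain B where B: "finite B" "card B = CARD('n)" "pairwise orthogonal B"
    "\<And>u. u \<in> B \<Longrightarrow> norm u = 1" "\<And>u. u \<in> B \<Longrightarrow> M *v u = ev u *\<^sub>R u"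
    "\<And>x. card {u \<in> B. ev u = x} = dim (eigenspace M x)"
    using orthonormal_eigenbasis[OF M] by (auto simp: ev_def)
  have sub: "{x. eigenspace M x \<noteq> {0}} \<subseteq> ev ` B"
  proof
    fix x assume "x \<in> {x. eigenspace M x \<noteq> {0}}"
    then have "dim (eigenspace M x) \<noteq> 0"
      using subspace_0[OF subspace_eigenspace[of M x]] by (auto simp: dim_eq_0)
    then have "{u \<in> B. ev u = x} \<noteq> {}" using B(6)[of x] by (metis card.empty)
    then show "x \<in> ev ` B" by auto
  qed
  then have finE: "finite {x. eigenspace M x \<noteq> {0}}" using B(1) finite_surj by blast
  have ms: "(\<Sum>x | eigenspace M x \<noteq> {0}. replicate_mset (dim (eigenspace M x)) x)
     = image_mset ev (mset_set B)"
  proof (rule multiset_eqI)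
    fix a
    have "count (\<Sum>x | eigenspace M x \<noteq> {0}. replicate_mset (dim (eigenspace M x)) x) a
       = (\<Sum>x | eigenspace M x \<noteq> {0}. if x = a then dim (eigenspace M a) else 0)"
      by (simp add: count_sum) (rule sum.cong, auto)
    also have "\<dots> = dim (eigenspace M a)" using finE by (auto simp: dim_eq_0)
    also have "\<dots> = card {u \<in> B. ev u = a}" by (simp add: B(6))
    also have "\<dots> = (\<Sum>x | x \<in> B \<and> a = ev x. 1)"
      by (simp add: eq_commute)
    also have "\<dots> = count (image_mset ev (mset_set B)) a"
      using B(1) by (simp add: count_image_mset')
    finally show "count (\<Sum>x | eigenspace M x \<noteq> {0}. replicate_mset (dim (eigenspace M x)) x) a
       = count (image_mset ev (mset_set B)) a" .
  qed
  obtain xs where xs: "set xs = B" "distinct xs" using finite_distinct_list[OF B(1)] by auto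
  define ys where "ys = sort_key ev xs"
  have msb: "mset_set B = mset xs" using xs mset_set_set by metis
  have "image_mset ev (mset_set B) = mset (map ev ys)"
    by (simp add: ys_def msb)
  then have "sorted_list_of_multiset (image_mset ev (mset_set B)) = map ev ys"
    by (metis sorted_list_of_multiset_mset sorted_sort_id sorted_sort_key ys_def)
  then have "eigvals M = map ev (rev ys)"
    by (simp add: eigvals_def ms rev_map)
  moreover have "set (rev ys) = B" "distinct (rev ys)" "length (rev ys) = CARD('n)"
    using xs B(2) distinct_card[OF xs(2)] by (simp_all add: ys_def)
  ultimately show thesis
    using B(3-5) unfolding ev_def by (intro that[of "rev ys"]) (assumption | metis)+
qed

theorem symmetric_spectral_theorem:
  fixes M :: "real^'n^'n"
  assumes "M \<in> sym_mats"
  obtains u where "top_eigenvectors CARD('n) M u"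
proof -
  obtain us where us: "length us = CARD('n)" "distinct us" "pairwise orthogonal (set us)"
    "\<And>u. u \<in> set us \<Longrightarrow> norm u = 1"
    "\<And>u. u \<in> set us \<Longrightarrow> M *v u = (u \<bullet> (M *v u)) *\<^sub>R u"
    "eigvals M = map (\<lambda>u. u \<bullet> (M *v u)) us"
    using eigvals_eigenbasis[OF assms] by blast
  have "top_eigenvectors CARD('n) M (\<lambda>i. us ! (i - 1))"
    unfolding top_eigenvectors_def
  proof safe
    fix i assume i: "i \<in> {1..CARD('n)}"
    then have iu: "us ! (i - 1) \<in> set us" "i - 1 < length us" using us(1) by auto
    show "M *v us ! (i - 1) = eigval i M *\<^sub>R us ! (i - 1)"
      using iu us(5)[OF iu(1)] by (simp add: eigval_def us(6))
    fix j assume j: "j \<in> {1..CARD('n)}"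
    then have ju: "us ! (j - 1) \<in> set us" "j - 1 < length us" using us(1) by auto
    show "us ! (i - 1) \<bullet> us ! (j - 1) = (if i = j then 1 else 0)"
    proof (cases "i = j")
      case True
      then show ?thesis using us(4)[OF iu(1)] by (simp add: power2_norm_eq_inner[symmetric])
    next
      case False
      then have "us ! (i - 1) \<noteq> us ! (j - 1)"
        using i j iu ju us(2) by (auto simp: nth_eq_iff_index_eq)
      then show ?thesis using us(3) iu ju False by (auto simp: pairwise_def orthogonal_def)
    qed
  qed
  then show thesis by (rule that)
qed

lemma eigval_antimono:
  fixes M :: "real^'n^'n"
  assumes "M \<in> sym_mats" "1 \<le> i" "i \<le> j" "j \<le> CARD('n)"
  shows "eigval j M \<le> eigval i M"
proof -
  have len: "length (eigvals M) = CARD('n)"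
    using eigvals_eigenbasis[OF assms(1)] by (metis length_map)
  have "sorted (rev (eigvals M))" by (simp add: eigvals_def)
  then show ?thesis
    using sorted_rev_nth_mono[of "eigvals M" "i - 1" "j - 1"] assms len
    by (simp add: eigval_def)
qed

section \<open>Rayleigh quotients and perturbation of eigenvalues\<close>

lemma orthonormal_family:
  fixes u :: "nat \<Rightarrow> real^'n"
  assumes "\<And>i j. i \<in> I \<Longrightarrow> j \<in> I \<Longrightarrow> u i \<bullet> u j = (if i = j then 1 else 0)"
  shows "independent (u ` I)" "dim (span (u ` I)) = card I"
proof -
  have inj: "inj_on u I"
    by (rule inj_onI) (metis assms zero_neq_one)
  have "pairwise orthogonal (u ` I)"
    using assms by (auto simp: pairwise_def orthogonal_def)
  moreover have "0 \<notin> u ` I" using assms by fastforce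
  ultimately show ind: "independent (u ` I)" by (rule pairwise_orthogonal_independent)
  then show "dim (span (u ` I)) = card I"
    by (simp add: dim_eq_card_independent card_image[OF inj])
qed

lemma orthonormal_expansion:
  fixes u :: "nat \<Rightarrow> real^'n"
  assumes on: "\<And>i j. i \<in> {1..CARD('n)} \<Longrightarrow> j \<in> {1..CARD('n)} \<Longrightarrow> u i \<bullet> u j = (if i = j then 1 else 0)"
  shows "x = (\<Sum>i=1..CARD('n). (u i \<bullet> x) *\<^sub>R u i)"
proof -
  let ?I = "{1..CARD('n)}"
  define d where "d = x - (\<Sum>i\<in>?I. (u i \<bullet> x) *\<^sub>R u i)"
  have "dim (span (u ` ?I)) = card ?I" by (rule orthonormal_family(2)) (rule on)
  then have "dim (span (u ` ?I)) = DIM(real^'n)" by simp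
  then have UN: "span (u ` ?I) = UNIV" by (simp only: dim_span dim_eq_full)
  have "orthogonal d v" if "v \<in> u ` ?I" for v
  proof -
    from that obtain j where j: "j \<in> ?I" "v = u j" by auto
    have "(\<Sum>i\<in>?I. (u i \<bullet> x) *\<^sub>R u i) \<bullet> u j = (\<Sum>i\<in>?I. if i = j then u j \<bullet> x else 0)"
      unfolding inner_sum_left using on j by (intro sum.cong) auto
    also have "\<dots> = u j \<bullet> x" using j by simp
    finally show ?thesis by (simp only: d_def orthogonal_def j inner_diff_left) (simp add: inner_commute)
  qed
  then have "orthogonal d d" using orthogonal_to_span[of d "u ` ?I" d] UN by auto
  then show ?thesis by (simp add: orthogonal_self d_def)
qed

lemma eigenbasis_expansion:
  fixes M :: "real^'n^'n"
  assumes "top_eigenvectors CARD('n) M u"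
  shows "x = (\<Sum>i=1..CARD('n). (u i \<bullet> x) *\<^sub>R u i)"
    and "M *v x = (\<Sum>i=1..CARD('n). (eigval i M * (u i \<bullet> x)) *\<^sub>R u i)"
    and "x \<bullet> (M *v x) = (\<Sum>i=1..CARD('n). eigval i M * (u i \<bullet> x)\<^sup>2)"
    and "x \<bullet> x = (\<Sum>i=1..CARD('n). (u i \<bullet> x)\<^sup>2)"
proof -
  have on: "u i \<bullet> u j = (if i = j then 1 else 0)" if "i \<in> {1..CARD('n)}" "j \<in> {1..CARD('n)}" for i j
    using assms that by (auto simp: top_eigenvectors_def)
  have ev: "M *v u i = eigval i M *\<^sub>R u i" if "i \<in> {1..CARD('n)}" for i
    using assms that by (auto simp: top_eigenvectors_def)
  show x: "x = (\<Sum>i=1..CARD('n). (u i \<bullet> x) *\<^sub>R u i)" for x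
    using orthonormal_expansion[OF on] .
  have "M *v (\<Sum>i=1..CARD('n). (u i \<bullet> x) *\<^sub>R u i) = (\<Sum>i=1..CARD('n). (eigval i M * (u i \<bullet> x)) *\<^sub>R u i)"
    unfolding linear_sum[OF matrix_vector_mul_linear]
    by (intro sum.cong) (auto simp: matrix_vector_mult_scaleR ev)
  then show M: "M *v x = (\<Sum>i=1..CARD('n). (eigval i M * (u i \<bullet> x)) *\<^sub>R u i)"
    using x[of x] by simp
  show "x \<bullet> (M *v x) = (\<Sum>i=1..CARD('n). eigval i M * (u i \<bullet> x)\<^sup>2)"
    unfolding M by (simp add: inner_sum_right power2_eq_square inner_commute mult.assoc)
  have "x \<bullet> x = x \<bullet> (\<Sum>i=1..CARD('n). (u i \<bullet> x) *\<^sub>R u i)" using x[of x] by simp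
  then show "x \<bullet> x = (\<Sum>i=1..CARD('n). (u i \<bullet> x)\<^sup>2)"
    by (simp add: inner_sum_right power2_eq_square inner_commute)
qed

lemma Rayleigh_upper:
  fixes M :: "real^'n^'n"
  assumes M: "M \<in> sym_mats" and u: "top_eigenvectors CARD('n) M u" and k: "1 \<le> k" "k \<le> CARD('n)"
    and perp: "\<And>i. 1 \<le> i \<Longrightarrow> i < k \<Longrightarrow> u i \<bullet> x = 0"
  shows "x \<bullet> (M *v x) \<le> eigval k M * (x \<bullet> x)"
proof -
  have "eigval i M * (u i \<bullet> x)\<^sup>2 \<le> eigval k M * (u i \<bullet> x)\<^sup>2" if i: "i \<in> {1..CARD('n)}" for i
  proof (cases "i < k")
    case True then show ?thesis using perp i by simp
  next
    case False
    then show ?thesis using eigval_antimono[OF M k(1), of i] i by (simp add: mult_right_mono)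
  qed
  then show ?thesis
    unfolding eigenbasis_expansion(3,4)[OF u, of x] sum_distrib_left by (rule sum_mono)
qed

lemma Rayleigh_lower:
  fixes M :: "real^'n^'n"
  assumes M: "M \<in> sym_mats" and u: "top_eigenvectors CARD('n) M u" and k: "1 \<le> k" "k \<le> CARD('n)"
    and perp: "\<And>i. k < i \<Longrightarrow> i \<le> CARD('n) \<Longrightarrow> u i \<bullet> x = 0"
  shows "eigval k M * (x \<bullet> x) \<le> x \<bullet> (M *v x)"
proof -
  have "eigval k M * (u i \<bullet> x)\<^sup>2 \<le> eigval i M * (u i \<bullet> x)\<^sup>2" if i: "i \<in> {1..CARD('n)}" for i
  proof (cases "k < i")
    case True then show ?thesis using perp i by simp
  next
    case False
    then show ?thesis using eigval_antimono[OF M _ _ k(2), of i] i by (simp add: mult_right_mono)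
  qed
  then show ?thesis
    unfolding eigenbasis_expansion(3,4)[OF u, of x] sum_distrib_left by (rule sum_mono)
qed

lemma eigval_max_Rayleigh:
  fixes M :: "real^'n^'n"
  assumes "M \<in> sym_mats"
  shows "x \<bullet> (M *v x) \<le> eigval_max M * (x \<bullet> x)"
proof -
  obtain u where "top_eigenvectors CARD('n) M u" using symmetric_spectral_theorem[OF assms] .
  from Rayleigh_upper[OF assms this, of 1 x] show ?thesis by (simp add: eigval_max_def Suc_leI)
qed

lemma eigval_max_attained:
  fixes M :: "real^'n^'n"
  assumes "M \<in> sym_mats"
  obtains u where "norm u = 1" "M *v u = eigval_max M *\<^sub>R u"
proof -
  obtain u where u: "top_eigenvectors CARD('n) M u" using symmetric_spectral_theorem[OF assms] .
  have "1 \<in> {1..CARD('n)}" by (simp add: Suc_leI)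
  with u have "u 1 \<bullet> u 1 = 1" "M *v u 1 = eigval_max M *\<^sub>R u 1"
    unfolding top_eigenvectors_def eigval_max_def by metis+
  then show thesis using that[of "u 1"] by (simp add: norm_eq_1)
qed

lemma eigval_max_le:
  fixes M :: "real^'n^'n"
  assumes "M \<in> sym_mats" "\<And>x. x \<bullet> (M *v x) \<le> c * (x \<bullet> x)"
  shows "eigval_max M \<le> c"
proof -
  obtain u where "norm u = 1" "M *v u = eigval_max M *\<^sub>R u" using eigval_max_attained[OF assms(1)] .
  then show ?thesis using assms(2)[of u] by (simp add: norm_eq_1)
qed

lemma eigval_min_ge:
  fixes M :: "real^'n^'n"
  assumes "M \<in> sym_mats" "\<And>x. c * (x \<bullet> x) \<le> x \<bullet> (M *v x)"
  shows "c \<le> eigval_min M"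
proof -
  obtain u where u: "top_eigenvectors CARD('n) M u" using symmetric_spectral_theorem[OF assms(1)] .
  have "CARD('n) \<in> {1..CARD('n)}" by (simp add: Suc_leI)
  with u have "u CARD('n) \<bullet> u CARD('n) = 1" "M *v u CARD('n) = eigval_min M *\<^sub>R u CARD('n)"
    unfolding top_eigenvectors_def eigval_min_def by metis+
  then show ?thesis using assms(2)[of "u CARD('n)"] by simp
qed

text \<open>
  Weyl's inequality, by counting dimensions: the span of the first \<open>k\<close> eigenvectors of \<open>M\<close> and the
  span of the eigenvectors of \<open>N\<close> from the \<open>k\<close>-th on have dimensions that add up to more than the order of the
  matrices, so they share a nonzero vector; compare the two forms there.
\<close>

lemma eigval_perturbation:
  fixes M N :: "real^'n^'n"
  assumes M: "M \<in> sym_mats" and N: "N \<in> sym_mats" and k: "1 \<le> k" "k \<le> CARD('n)"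
    and le: "\<And>x. x \<bullet> (M *v x) \<le> x \<bullet> (N *v x) + e * (x \<bullet> x)"
  shows "eigval k M \<le> eigval k N + e"
proof -
  obtain u where u: "top_eigenvectors CARD('n) M u" using symmetric_spectral_theorem[OF M] .
  obtain v where v: "top_eigenvectors CARD('n) N v" using symmetric_spectral_theorem[OF N] .
  have onu: "u i \<bullet> u j = (if i = j then 1 else 0)" if "i \<in> {1..CARD('n)}" "j \<in> {1..CARD('n)}" for i j
    using u that by (auto simp: top_eigenvectors_def)
  have onv: "v i \<bullet> v j = (if i = j then 1 else 0)" if "i \<in> {1..CARD('n)}" "j \<in> {1..CARD('n)}" for i j
    using v that by (auto simp: top_eigenvectors_def)
  define S where "S = span (u ` {1..k})"
  define T where "T = span (v ` {k..CARD('n)})"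
  have "dim S = k"
    unfolding S_def by (subst orthonormal_family(2)) (use onu k in auto)
  moreover have "dim T = CARD('n) - k + 1"
    unfolding T_def by (subst orthonormal_family(2)) (use onv k in auto)
  moreover have "dim {x + y |x y. x \<in> S \<and> y \<in> T} + dim (S \<inter> T) = dim S + dim T"
    by (rule dim_sums_Int) (auto simp: S_def T_def)
  moreover have "dim {x + y |x y. x \<in> S \<and> y \<in> T} \<le> CARD('n)"
    using dim_subset_UNIV[of "{x + y |x y. x \<in> S \<and> y \<in> T}"] by simp
  ultimately have "dim (S \<inter> T) \<noteq> 0" using k by linarith
  then obtain x where x: "x \<in> S" "x \<in> T" "x \<noteq> 0" by (auto simp: dim_eq_0)
  have "u i \<bullet> x = 0" if "k < i" "i \<le> CARD('n)" for i
  proof -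
    have "orthogonal (u i) y" if "y \<in> u ` {1..k}" for y
      using that \<open>k < i\<close> \<open>i \<le> CARD('n)\<close> onu k by (auto simp: orthogonal_def)
    then show ?thesis using orthogonal_to_span[of x "u ` {1..k}" "u i"] x(1) by (simp add: S_def orthogonal_def)
  qed
  then have 1: "eigval k M * (x \<bullet> x) \<le> x \<bullet> (M *v x)" using Rayleigh_lower[OF M u k] by simp
  have "v i \<bullet> x = 0" if "1 \<le> i" "i < k" for i
  proof -
    have "orthogonal (v i) y" if "y \<in> v ` {k..CARD('n)}" for y
      using that \<open>1 \<le> i\<close> \<open>i < k\<close> onv k by (auto simp: orthogonal_def)
    then show ?thesis using orthogonal_to_span[of x "v ` {k..CARD('n)}" "v i"] x(2) by (simp add: T_def orthogonal_def)
  qed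
  then have 2: "x \<bullet> (N *v x) \<le> eigval k N * (x \<bullet> x)" using Rayleigh_upper[OF N v k] by simp
  have "eigval k M * (x \<bullet> x) \<le> (eigval k N + e) * (x \<bullet> x)"
    using 1 2 le[of x] by (simp add: algebra_simps)
  moreover have "0 < x \<bullet> x" using x(3) by simp
  ultimately show ?thesis by simp
qed

text \<open>
  The eigenvectors are not determined by the matrix, but because of the gap the first \<open>r\<close> of them
  span the same subspace for every choice: they are orthogonal to all eigenvectors of smaller eigenvalues.
\<close>

lemma top_eigenvectors_complement:
  fixes M :: "real^'n^'n"
  assumes M: "M \<in> sym_mats" and v: "top_eigenvectors rc M v" and r: "1 \<le> r" "r \<le> rc" "r < CARD('n)"
    and gap: "eigval (r + 1) M < eigval r M"
    and perp: "\<And>i. 1 \<le> i \<Longrightarrow> i \<le> r \<Longrightarrow> v i \<bullet> x = 0"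
  shows "x \<bullet> (M *v x) \<le> eigval (r + 1) M * (x \<bullet> x)"
proof -
  obtain u where u: "top_eigenvectors CARD('n) M u" using symmetric_spectral_theorem[OF M] .
  have onu: "u i \<bullet> u j = (if i = j then 1 else 0)" if "i \<in> {1..CARD('n)}" "j \<in> {1..CARD('n)}" for i j
    using u that by (auto simp: top_eigenvectors_def)
  have onv: "v i \<bullet> v j = (if i = j then 1 else 0)" if "i \<in> {1..rc}" "j \<in> {1..rc}" for i j
    using v that by (auto simp: top_eigenvectors_def)
  have "v i \<in> span (u ` {1..r})" if i: "i \<in> {1..r}" for i
  proof -
    have "u j \<bullet> v i = 0" if j: "r < j" "j \<le> CARD('n)" for j
    proof -
      have "eigval j M \<le> eigval (r + 1) M" using eigval_antimono[OF M, of "r + 1" j] j by simp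
      moreover have "eigval r M \<le> eigval i M" using eigval_antimono[OF M, of i r] i r by simp
      ultimately have "eigval j M \<noteq> eigval i M" using gap by simp
      moreover have "u j \<in> eigenspace M (eigval j M)" "v i \<in> eigenspace M (eigval i M)"
        using u v i j r by (auto simp: top_eigenvectors_def eigenspace_def)
      ultimately show ?thesis using eigenspaces_orthogonal[OF M] by blast
    qed
    then have z: "(u j \<bullet> v i) *\<^sub>R u j \<in> span (u ` {1..r})" if "j \<in> {1..CARD('n)}" for j
    proof (cases "j \<le> r")
      case True
      then show ?thesis using that by (intro span_scale span_base) auto
    qed (use that in \<open>simp add: span_zero\<close>)
    show ?thesis
      by (subst eigenbasis_expansion(1)[OF u, of "v i"]) (rule span_sum[OF z])
  qed
  then have sub: "span (v ` {1..r}) \<subseteq> span (u ` {1..r})"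
    by (intro span_minimal) auto
  have "dim (span (v ` {1..r})) = r"
    by (subst orthonormal_family(2)) (use onv r in auto)
  moreover have "dim (span (u ` {1..r})) = r"
    by (subst orthonormal_family(2)) (use onu r in auto)
  ultimately have eq: "span (v ` {1..r}) = span (u ` {1..r})"
    using subspace_dim_equal[OF subspace_span subspace_span sub] by simp
  have "u i \<bullet> x = 0" if "1 \<le> i" "i < r + 1" for i
  proof -
    have "u i \<in> span (v ` {1..r})" unfolding eq using that by (auto intro!: span_base)
    moreover have "orthogonal x y" if "y \<in> v ` {1..r}" for y
      using that perp by (auto simp: orthogonal_def inner_commute)
    ultimately show ?thesis using orthogonal_to_span[of "u i" "v ` {1..r}" x]
      by (simp add: orthogonal_def inner_commute)
  qed
  then show ?thesis using Rayleigh_upper[OF M u, of "r + 1"] r by simp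
qed

section \<open>Positive semidefinite matrices\<close>

lemma matrix_vector_mult_minus: "(- M) *v x = - (M *v (x :: real^'n))"
  using matrix_vector_mult_diff_rdistrib[of 0 M x] by simp

lemma psd_sym: "psd X \<Longrightarrow> X \<in> sym_mats" and psd_nonneg: "psd X \<Longrightarrow> 0 \<le> x \<bullet> (X *v x)"
  by (simp_all add: psd_def)

lemma psd_zero: "psd 0" using subspace_0[OF subspace_sym_mats] by (simp add: psd_def)

lemma psd_add: "psd X \<Longrightarrow> psd Y \<Longrightarrow> psd (X + Y)"
  by (simp add: psd_def subspace_add[OF subspace_sym_mats] matrix_vector_mult_add_rdistrib inner_add_right)

lemma psd_scale: "psd X \<Longrightarrow> 0 \<le> c \<Longrightarrow> psd (c *\<^sub>R X)"
  by (simp add: psd_def subspace_scale[OF subspace_sym_mats] scaleR_matrix_vector_assoc[symmetric])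

lemma psd_sum: "(\<And>i. i \<in> I \<Longrightarrow> psd (f i)) \<Longrightarrow> psd (\<Sum>i\<in>I. f i)"
  by (induction I rule: infinite_finite_induct) (auto simp: psd_zero psd_add)

lemma psd_outer: "psd (outer u u)"
  by (simp add: psd_def outer_self_sym outer_mult_vec inner_commute)

lemma trace_conv_inner: "trace X = X \<bullet> mat 1"
  by (simp add: trace_def inner_vec_def mat_def if_distrib[of "\<lambda>x. _ * x"] cong: if_cong)

lemma trace_scale: "trace (c *\<^sub>R X) = c * trace (X :: real^'n^'n)"
  by (simp add: trace_conv_inner)

lemma trace_sum: "trace (\<Sum>i\<in>I. f i) = (\<Sum>i\<in>I. trace (f i :: real^'n^'n))"
  by (simp add: trace_conv_inner inner_sum_left)

lemma trace_outer: "trace (outer u v) = u \<bullet> v"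
  by (simp add: trace_conv_inner inner_commute[of "outer u v"] inner_outer)

text \<open>
  Scale an orthonormal eigenbasis by the square roots of the eigenvalues.  The factors are indexed
  by the index type of the matrix, so that they also form the rows of a square matrix.
\<close>

lemma psd_decomposition:
  fixes X :: "real^'n^'n"
  assumes "psd X"
  obtains R :: "'n \<Rightarrow> real^'n" where "X = (\<Sum>i\<in>UNIV. outer (R i) (R i))"
proof -
  obtain u where u: "top_eigenvectors CARD('n) X u" using symmetric_spectral_theorem[OF psd_sym[OF assms]] .
  have pos: "0 \<le> eigval i X" if "i \<in> {1..CARD('n)}" for i
  proof -
    have "u i \<bullet> (X *v u i) = eigval i X" using u that by (simp add: top_eigenvectors_def)
    then show ?thesis using psd_nonneg[OF assms, of "u i"] by simp
  qed
  have "X *v x = (\<Sum>i=1..CARD('n). outer (sqrt (eigval i X) *\<^sub>R u i) (sqrt (eigval i X) *\<^sub>R u i)) *v x" for x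
  proof -
    show ?thesis
      unfolding sum_matrix_vector_mult eigenbasis_expansion(2)[OF u, of x]
      by (intro sum.cong refl) (simp add: outer_mult_vec pos)
  qed
  then have X: "X = (\<Sum>i=1..CARD('n). outer (sqrt (eigval i X) *\<^sub>R u i) (sqrt (eigval i X) *\<^sub>R u i))"
    by (simp add: matrix_eq)
  have "card (UNIV :: 'n set) = card {1..CARD('n)}" by simp
  then obtain h where h: "bij_betw h (UNIV :: 'n set) {1..CARD('n)}"
    using finite_same_card_bij[of "UNIV :: 'n set" "{1..CARD('n)}"] by auto
  show thesis
    using X
    by (intro that[of "\<lambda>j. sqrt (eigval (h j) X) *\<^sub>R u (h j)"])
       (subst sum.reindex_bij_betw[OF h, of "\<lambda>i. outer (sqrt (eigval i X) *\<^sub>R u i) (sqrt (eigval i X) *\<^sub>R u i)"], assumption)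
qed

lemma psd_inner_le_trace:
  assumes "psd X" and "\<And>x. x \<bullet> (W *v x) \<le> c * (x \<bullet> x)"
  shows "X \<bullet> W \<le> c * trace X"
proof -
  obtain R :: "'a \<Rightarrow> real^'a" where R: "X = (\<Sum>i\<in>UNIV. outer (R i) (R i))" using psd_decomposition[OF assms(1)] by blast
  show ?thesis
    by (simp add: R trace_sum trace_outer inner_sum_left inner_commute[of "outer _ _"] inner_outer
        sum_distrib_left sum_mono assms(2))
qed

lemma psd_trace_nonneg:
  assumes "psd X" shows "0 \<le> trace X"
proof -
  obtain R :: "'a \<Rightarrow> real^'a" where "X = (\<Sum>i\<in>UNIV. outer (R i) (R i))" using psd_decomposition[OF assms] by blast
  then show ?thesis by (simp add: trace_sum trace_outer sum_nonneg)
qed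

text \<open>
  A small value of the quadratic form at \<open>v\<close> forces \<open>M v\<close> to be small, but only like its
  square root.  This is where the square root in the growth bound comes from.
\<close>

lemma psd_norm_mult_le:
  fixes M :: "real^'n^'n"
  assumes "psd M"
  shows "(norm (M *v v))\<^sup>2 \<le> norm M * (v \<bullet> (M *v v))"
proof (cases "M *v v = 0")
  case False
  let ?w = "M *v v"
  have "(?w \<bullet> ?w)\<^sup>2 \<le> (?w \<bullet> (M *v ?w)) * (v \<bullet> (M *v v))"
    using psd_form_Cauchy_Schwarz[OF psd_sym[OF assms] subspace_UNIV, of ?w v] psd_nonneg[OF assms] by simp
  also have "?w \<bullet> (M *v ?w) \<le> norm M * (norm ?w)\<^sup>2"
    using abs_bilinear_le[of ?w M ?w] by (simp add: power2_eq_square mult.assoc)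
  finally have "(norm ?w)\<^sup>2 * (norm ?w)\<^sup>2 \<le> (norm ?w)\<^sup>2 * (norm M * (v \<bullet> (M *v v)))"
    using psd_nonneg[OF assms, of v]
    by (simp add: power2_norm_eq_inner[symmetric] mult_right_mono algebra_simps power2_eq_square)
  moreover have "0 < (norm ?w)\<^sup>2" using False by simp
  ultimately show ?thesis by (rule mult_left_le_imp_le)
qed (use psd_nonneg[OF assms, of v] in simp)

lemma conj_quadratic:
  fixes V :: "real^'r^'n"
  shows "x \<bullet> ((V ** S ** transpose V) *v x) = (transpose V *v x) \<bullet> (S *v (transpose V *v x))"
  by (simp only: matrix_vector_mul_assoc[symmetric] transpose_matrix_vector dot_lmul_matrix)

lemma psd_conj:
  fixes V :: "real^'r^'n"
  assumes "psd S" shows "psd (V ** S ** transpose V)"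
proof -
  have "V ** S ** transpose V \<in> sym_mats"
    using assms by (simp add: psd_def sym_mats_def matrix_transpose_mul matrix_mul_assoc)
  then show ?thesis using psd_nonneg[OF assms] by (simp only: psd_def conj_quadratic) simp
qed

lemma trace_conj:
  fixes V :: "real^'r^'n"
  assumes "orthonormal_columns V" shows "trace (V ** S ** transpose V) = trace S"
proof -
  have "trace (V ** S ** transpose V) = trace (transpose V ** (V ** S))" by (rule trace_mul_sym)
  also have "transpose V ** (V ** S) = S" using assms by (simp add: matrix_mul_assoc orthonormal_columns_def)
  finally show ?thesis .
qed

lemma conj_outer:
  fixes V :: "real^'r^'n"
  shows "V ** outer s s ** transpose V = outer (V *v s) (V *v s)"
proof -
  have "(V ** outer s s ** transpose V) *v x = outer (V *v s) (V *v s) *v x" for x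
  proof -
    have "(V ** outer s s ** transpose V) *v x = V *v (outer s s *v (transpose V *v x))"
      by (simp only: matrix_vector_mul_assoc matrix_mul_assoc)
    also have "\<dots> = (s \<bullet> (x v* V)) *\<^sub>R (V *v s)"
      by (simp only: outer_mult_vec matrix_vector_mult_scaleR transpose_matrix_vector)
    also have "s \<bullet> (x v* V) = (V *v s) \<bullet> x"
      by (metis dot_lmul_matrix inner_commute)
    finally show ?thesis by (simp only: outer_mult_vec)
  qed
  then show ?thesis by (simp add: matrix_eq)
qed

section \<open>The adjoint on symmetric matrices\<close>

lemma inner_transpose: "transpose X \<bullet> transpose Y = X \<bullet> (Y :: real^'n^'n)"
  unfolding inner_vec_def transpose_def by (simp add: inner_vec_def) (rule sum.swap)

text \<open>
  Precompose \<open>A\<close> with the projection \<open>X \<mapsto> (X + X\<^sup>T)/2\<close>.  The result is linear on all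
  matrices, and its adjoint is symmetric since it does not distinguish \<open>X\<close> from \<open>X\<^sup>T\<close>.
\<close>

lemma adj_exists:
  fixes A :: "real^'n^'n \<Rightarrow> real^'m"
  assumes A: "linear_on_sym A"
  shows "\<exists>!W. W \<in> sym_mats \<and> (\<forall>X\<in>sym_mats. W \<bullet> X = y \<bullet> A X)"
proof -
  define S :: "real^'n^'n \<Rightarrow> real^'n^'n" where "S = (\<lambda>X. (1/2) *\<^sub>R (X + transpose X))"
  have S: "S X \<in> sym_mats" for X
    by (simp add: S_def sym_mats_def transpose_def vec_eq_iff add.commute)
  have "linear (\<lambda>X. A (S X))"
  proof (rule linearI)
    fix X Y :: "real^'n^'n" and c :: real
    have "S (X + Y) = S X + S Y" "S (c *\<^sub>R X) = c *\<^sub>R S X"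
      by (simp_all add: S_def transpose_def vec_eq_iff field_simps)
    then show "A (S (X + Y)) = A (S X) + A (S Y)" "A (S (c *\<^sub>R X)) = c *\<^sub>R A (S X)"
      using A S by (simp_all add: linear_on_sym_def)
  qed
  then have ad: "X \<bullet> adjoint (\<lambda>X. A (S X)) y = A (S X) \<bullet> y" for X
    by (simp add: adjoint_works)
  let ?W = "adjoint (\<lambda>X. A (S X)) y"
  have "X \<bullet> transpose ?W = X \<bullet> ?W" for X
  proof -
    have "X \<bullet> transpose ?W = transpose X \<bullet> ?W"
      using inner_transpose[of "transpose X" ?W] by simp
    also have "\<dots> = X \<bullet> ?W"
    proof -
      have "S (transpose X) = S X" by (simp add: S_def add.commute)
      then show ?thesis by (simp only: ad)
    qed
    finally show ?thesis .
  qed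
  then have "transpose ?W = ?W" using vector_eq_ldot[of "transpose ?W" ?W] by blast
  then have W: "?W \<in> sym_mats" by (simp add: sym_mats_def)
  have "?W \<bullet> X = y \<bullet> A X" if "X \<in> sym_mats" for X
    using that ad[of X] by (simp add: S_def sym_mats_def inner_commute flip: scaleR_2)
  with W have ex: "?W \<in> sym_mats \<and> (\<forall>X\<in>sym_mats. ?W \<bullet> X = y \<bullet> A X)" by simp
  show ?thesis
  proof (intro ex1I, rule ex)
    fix W' assume W': "W' \<in> sym_mats \<and> (\<forall>X\<in>sym_mats. W' \<bullet> X = y \<bullet> A X)"
    then have "W' - ?W \<in> sym_mats" using W subspace_diff[OF subspace_sym_mats] by blast
    then have "(W' - ?W) \<bullet> (W' - ?W) = 0"
      using W' ex by (simp add: inner_diff_left)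
    then show "W' = ?W" by simp
  qed
qed

lemma adj_sym: "linear_on_sym A \<Longrightarrow> adj A y \<in> sym_mats"
  and adj_inner: "linear_on_sym A \<Longrightarrow> X \<in> sym_mats \<Longrightarrow> adj A y \<bullet> X = y \<bullet> A X"
  using theI'[OF adj_exists] unfolding adj_def by blast+

lemma linear_adj:
  assumes "linear_on_sym A" shows "linear (adj A)"
proof (rule linearI)
  note sub = subspace_sym_mats
  have eq: "adj A y = W" if "W \<in> sym_mats" "\<And>X. X \<in> sym_mats \<Longrightarrow> W \<bullet> X = y \<bullet> A X" for y W
    using adj_exists[OF assms, of y] that adj_sym[OF assms] adj_inner[OF assms] by blast
  show "adj A (x + y) = adj A x + adj A y" for x y
    by (rule eq) (simp_all add: subspace_add[OF sub] adj_sym adj_inner assms inner_add_left)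
  show "adj A (c *\<^sub>R x) = c *\<^sub>R adj A x" for c x
    by (rule eq) (simp_all add: subspace_scale[OF sub] adj_sym adj_inner assms)
qed

lemma norm_adj_le: "linear_on_sym A \<Longrightarrow> norm (adj A d) \<le> onorm (adj A) * norm d"
  by (rule onorm) (simp add: linear_adj linear_conv_bounded_linear[symmetric])

section \<open>The penalized dual\<close>

locale sdp_pair =
  fixes C :: "real^'n^'n" and A :: "real^'n^'n \<Rightarrow> real^'m" and b :: "real^'m" and \<alpha> :: real
  assumes C_sym: "C \<in> sym_mats" and A_lin: "linear_on_sym A"
    and duality: "strong_duality C A b" and complementarity: "strict_complementarity C A b"
    and penalty: "(SUP X\<in>primal_sols C A b. trace X) < \<alpha>"
begin

definition W :: "real^'m \<Rightarrow> real^'n^'n" where "W y = adj A y - C"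

abbreviation F :: "real^'m \<Rightarrow> real" where "F \<equiv> penalized_dual C A b \<alpha>"

abbreviation Ystar :: "(real^'m) set" where "Ystar \<equiv> dual_sols C A b"

abbreviation infeas :: "real^'m \<Rightarrow> real" where "infeas y \<equiv> max (eigval_max (W y)) 0"

text \<open>
  The optimal value, as the dual objective at an arbitrary solution; \<open>opt_dual\<close> and
  \<open>opt_primal\<close> show that every dual and every primal solution attains it.
\<close>

definition opt :: real where "opt = (- b) \<bullet> (SOME y. y \<in> Ystar)"

lemma F_eq: "F y = (- b) \<bullet> y + \<alpha> * infeas y"
  by (simp add: penalized_dual_def W_def)

lemma slack_eq: "slack C A y = - W y" by (simp add: slack_def W_def)

lemma W_sym: "W y \<in> sym_mats"
  unfolding W_def by (intro subspace_diff[OF subspace_sym_mats] adj_sym A_lin C_sym)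

lemma W_diff: "W y - W y' = adj A (y - y')"
  by (simp add: W_def linear_diff[OF linear_adj[OF A_lin]])

lemma W_lipschitz: "norm (W y - W y') \<le> onorm (adj A) * norm (y - y')"
  unfolding W_diff by (rule norm_adj_le[OF A_lin])

lemma onorm_nonneg: "0 \<le> onorm (adj A)"
  by (rule onorm_pos_le) (simp add: linear_adj A_lin linear_conv_bounded_linear[symmetric])

lemma W_convex_comb: "W ((1 - s) *\<^sub>R y + s *\<^sub>R y') = (1 - s) *\<^sub>R W y + s *\<^sub>R W y'"
  by (simp add: W_def linear_add[OF linear_adj[OF A_lin]] linear_scale[OF linear_adj[OF A_lin]])
     (simp add: algebra_simps)

lemma infeas_Rayleigh: "x \<bullet> (W y *v x) \<le> infeas y * (x \<bullet> x)"
  using eigval_max_Rayleigh[OF W_sym, of x y] mult_right_mono[of "eigval_max (W y)" "infeas y" "x \<bullet> x"]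
  by simp

lemma infeas_le: "0 \<le> c \<Longrightarrow> (\<And>x. x \<bullet> (W y *v x) \<le> c * (x \<bullet> x)) \<Longrightarrow> infeas y \<le> c"
  using eigval_max_le[OF W_sym] by simp

lemma infeas_lipschitz: "infeas y \<le> infeas y' + onorm (adj A) * norm (y - y')"
proof (rule infeas_le)
  show "0 \<le> infeas y' + onorm (adj A) * norm (y - y')" by (simp add: onorm_nonneg)
  fix x
  have "x \<bullet> (W y *v x) = x \<bullet> (W y' *v x) + x \<bullet> ((W y - W y') *v x)"
    by (simp add: matrix_vector_mult_diff_rdistrib inner_diff_right)
  also have "x \<bullet> ((W y - W y') *v x) \<le> norm (W y - W y') * norm x * norm x"
    using abs_bilinear_le[of x "W y - W y'" x] by simp
  also have "\<dots> \<le> onorm (adj A) * norm (y - y') * (x \<bullet> x)"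
    using mult_right_mono[OF W_lipschitz[of y y'], of "x \<bullet> x"]
    by (simp add: power2_norm_eq_inner[symmetric] power2_eq_square mult.assoc)
  also note infeas_Rayleigh[of x y']
  finally show "x \<bullet> (W y *v x) \<le> (infeas y' + onorm (adj A) * norm (y - y')) * (x \<bullet> x)"
    by (simp add: algebra_simps)
qed

lemma infeas_le_norm: "infeas y \<le> norm (W y)"
  by (rule infeas_le)
     (use abs_bilinear_le[of _ "W y"] in \<open>auto simp: power2_norm_eq_inner[symmetric] power2_eq_square mult.assoc abs_le_iff\<close>)

lemma infeas_convex:
  assumes "0 \<le> s" "s \<le> 1"
  shows "infeas ((1 - s) *\<^sub>R y + s *\<^sub>R y') \<le> (1 - s) * infeas y + s * infeas y'"
proof (rule infeas_le)
  show "0 \<le> (1 - s) * infeas y + s * infeas y'" using assms by simp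
  fix x
  have "(1 - s) * (x \<bullet> (W y *v x)) + s * (x \<bullet> (W y' *v x))
      \<le> (1 - s) * (infeas y * (x \<bullet> x)) + s * (infeas y' * (x \<bullet> x))"
    using assms by (intro add_mono mult_left_mono infeas_Rayleigh) auto
  then show "x \<bullet> (W ((1 - s) *\<^sub>R y + s *\<^sub>R y') *v x) \<le> ((1 - s) * infeas y + s * infeas y') * (x \<bullet> x)"
    unfolding W_convex_comb
    by (simp add: matrix_vector_mult_add_rdistrib scaleR_matrix_vector_assoc[symmetric] inner_add_right algebra_simps)
qed

lemma trace_lt_penalty: "X \<in> primal_sols C A b \<Longrightarrow> trace X < \<alpha>"
proof -
  assume X: "X \<in> primal_sols C A b"
  have "compact (trace ` primal_sols C A b)"
    using duality unfolding strong_duality_def trace_conv_inner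
    by (intro compact_continuous_image continuous_intros) auto
  then have "bdd_above (trace ` primal_sols C A b)"
    by (intro bounded_imp_bdd_above compact_imp_bounded)
  from cSUP_upper[OF X this] show ?thesis using penalty by simp
qed

lemma primal_sols_psd: "X \<in> primal_sols C A b \<Longrightarrow> psd X"
  by (simp add: primal_sols_def primal_feasible_def)

lemma \<alpha>_pos: "0 < \<alpha>"
proof -
  obtain X where X: "X \<in> primal_sols C A b" using duality by (auto simp: strong_duality_def)
  show ?thesis using trace_lt_penalty[OF X] psd_trace_nonneg[OF primal_sols_psd[OF X]] by simp
qed

lemma F_lipschitz: "F y \<le> F y' + (norm b + \<alpha> * onorm (adj A)) * norm (y - y')"
proof -
  have "- (b \<bullet> y) \<le> - (b \<bullet> y') + norm b * norm (y - y')"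
    using Cauchy_Schwarz_ineq2[of b "y - y'"] by (simp add: inner_diff_right abs_le_iff)
  moreover have "\<alpha> * infeas y \<le> \<alpha> * infeas y' + \<alpha> * (onorm (adj A) * norm (y - y'))"
    using mult_left_mono[OF infeas_lipschitz, of \<alpha> y y'] \<alpha>_pos by (simp add: distrib_left)
  ultimately show ?thesis by (simp add: F_eq algebra_simps)
qed

lemma F_convex:
  assumes "0 \<le> s" "s \<le> 1"
  shows "F ((1 - s) *\<^sub>R y + s *\<^sub>R y') \<le> (1 - s) * F y + s * F y'"
  using mult_left_mono[OF infeas_convex[OF assms], of \<alpha> y y'] \<alpha>_pos
  by (simp add: F_eq inner_add_right algebra_simps)

lemma opt_primal: "X \<in> primal_sols C A b \<Longrightarrow> (- C) \<bullet> X = opt"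
  and opt_dual: "y \<in> Ystar \<Longrightarrow> (- b) \<bullet> y = opt"
proof -
  have Y: "(SOME y. y \<in> Ystar) \<in> Ystar" and "primal_sols C A b \<noteq> {}"
    using duality some_in_eq[of Ystar] by (auto simp: strong_duality_def)
  then obtain X0 where X0: "X0 \<in> primal_sols C A b" by auto
  show P: "(- C) \<bullet> X = opt" if "X \<in> primal_sols C A b" for X
    using duality Y that by (auto simp: strong_duality_def opt_def)
  assume "y \<in> Ystar"
  then show "(- b) \<bullet> y = opt"
    using duality P[OF X0] X0 by (auto simp: strong_duality_def)
qed

lemma dual_objective:
  assumes "X \<in> primal_sols C A b" shows "(- b) \<bullet> y = opt - X \<bullet> W y"
proof -
  have "b \<bullet> y = adj A y \<bullet> X"
    using assms adj_inner[OF A_lin psd_sym[OF primal_sols_psd[OF assms]]]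
    by (simp add: primal_sols_def primal_feasible_def inner_commute)
  then show ?thesis
    using opt_primal[OF assms] by (simp add: W_def inner_diff_right inner_commute)
qed

text \<open>
  Exactness of the penalty: \<open>\<langle>X, W y\<rangle>\<close> exceeds zero by at most \<open>trace X\<close> times the infeasibility,
  which the penalty outweighs.
\<close>

lemma F_ge_opt: "opt \<le> F y"
  and F_gap: "X \<in> primal_sols C A b \<Longrightarrow> (\<alpha> - trace X) * infeas y \<le> F y - opt"
proof -
  show G: "(\<alpha> - trace X) * infeas y \<le> F y - opt" if "X \<in> primal_sols C A b" for X
    using psd_inner_le_trace[OF primal_sols_psd[OF that] infeas_Rayleigh, of y]
    unfolding F_eq dual_objective[OF that] by (simp add: algebra_simps)
  obtain X where X: "X \<in> primal_sols C A b" using duality by (auto simp: strong_duality_def)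
  have "0 \<le> (\<alpha> - trace X) * infeas y" using trace_lt_penalty[OF X] by simp
  then show "opt \<le> F y" using G[OF X] by simp
qed

lemma dual_feasible_infeas: "psd (slack C A y) \<Longrightarrow> infeas y = 0"
  using infeas_le[of 0 y] psd_nonneg[of "slack C A y"]
  by (simp add: slack_eq matrix_vector_mult_minus)

lemma dual_sols_feasible: "y \<in> Ystar \<Longrightarrow> psd (slack C A y)"
  by (simp add: dual_sols_def dual_feasible_def)

lemma F_dual_sols: "y \<in> Ystar \<Longrightarrow> F y = opt"
  using dual_feasible_infeas[OF dual_sols_feasible] opt_dual[of y] by (simp add: F_eq)

lemma dual_solsI: "psd (slack C A y) \<Longrightarrow> (- b) \<bullet> y = opt \<Longrightarrow> y \<in> Ystar"
proof -
  assume y: "psd (slack C A y)" "(- b) \<bullet> y = opt"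
  have "(- b) \<bullet> y \<le> (- b) \<bullet> y'" if "psd (slack C A y')" for y'
    unfolding y(2) using F_ge_opt[of y'] dual_feasible_infeas[OF that] by (simp add: F_eq)
  with y(1) show ?thesis by (simp add: dual_sols_def dual_feasible_def)
qed

lemma Ystar_nonempty: "Ystar \<noteq> {}" and Ystar_compact: "compact Ystar"
  using duality by (auto simp: strong_duality_def)

section \<open>Quadratic growth under strict complementarity\<close>

text \<open>
  For a solution \<open>y\<close> the duality gap \<open>\<Sum>\<^sub>i R\<^sub>i \<bullet> (- W y) R\<^sub>i\<close> vanishes and its terms are nonnegative, so each of
  them is zero.
\<close>

lemma complementary_slackness:
  fixes R :: "'n \<Rightarrow> real^'n"
  assumes X: "(\<Sum>i\<in>UNIV. outer (R i) (R i)) \<in> primal_sols C A b" and y: "y \<in> Ystar"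
  shows "W y *v R i = 0"
proof -
  let ?X = "\<Sum>i\<in>UNIV. outer (R i) (R i)"
  have Z: "psd (- W y)" using dual_sols_feasible[OF y] by (simp add: slack_eq)
  have "?X \<bullet> (- W y) = 0"
    using dual_objective[OF X, of y] opt_dual[OF y] by simp
  moreover have "?X \<bullet> (- W y) = (\<Sum>i\<in>UNIV. R i \<bullet> (- W y *v R i))"
    by (simp add: inner_sum_left inner_commute[of "outer _ _"] inner_outer matrix_vector_mult_minus sum_negf)
  ultimately have "(\<Sum>i\<in>UNIV. R i \<bullet> (- W y *v R i)) = 0" by simp
  then have "R i \<bullet> (- W y *v R i) = 0"
    using psd_nonneg[OF Z] by (subst (asm) sum_nonneg_eq_0_iff) auto
  then have "(norm (- W y *v R i))\<^sup>2 \<le> 0" using psd_norm_mult_le[OF Z, of "R i"] by simp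
  then show ?thesis by (simp add: matrix_vector_mult_minus)
qed

lemma rank_nullity:
  fixes M :: "real^'n^'n"
  shows "rank M + dim {x. M *v x = 0} = CARD('n)"
proof -
  have "{x. M *v x = 0} = {x \<in> UNIV. \<forall>r\<in>span (rows M). orthogonal r x}"
  proof (intro set_eqI iffI CollectI conjI ballI UNIV_I; (elim CollectE conjE)?)
    fix x r assume "M *v x = 0" "r \<in> span (rows M)"
    then show "orthogonal r x" using orthogonal_nullspace_rowspace orthogonal_commute by blast
  next
    fix x assume "\<forall>r\<in>span (rows M). orthogonal r x"
    then have "row i M \<bullet> x = 0" for i
      by (auto simp: rows_def orthogonal_def intro!: span_base)
    then show "M *v x = 0"
      by (simp add: vec_eq_iff matrix_vector_mul_component row_def)
  qed
  moreover have "dim {x \<in> UNIV. \<forall>r\<in>span (rows M). orthogonal r x} + dim (span (rows M))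
      = dim (UNIV :: (real^'n) set)"
    by (rule dim_subspace_orthogonal_to_vectors) auto
  ultimately show ?thesis by (simp add: row_rank_def)
qed

text \<open>
  Strict complementarity says that the kernel of the slack matrix is no larger than the range of the
  primal solution.  So on the orthogonal complement of that range the slack matrix is injective,
  and hence bounded below as a quadratic form.
\<close>

lemma strict_pair:
  obtains R :: "'n \<Rightarrow> real^'n" and y0 \<sigma> where "(\<Sum>i\<in>UNIV. outer (R i) (R i)) \<in> primal_sols C A b" "y0 \<in> Ystar" "0 < \<sigma>"
    "\<And>x. (\<And>i. R i \<bullet> x = 0) \<Longrightarrow> \<sigma> * (x \<bullet> x) \<le> x \<bullet> (- W y0 *v x)"
proof -
  obtain X y0 where X: "X \<in> primal_sols C A b" and y0: "y0 \<in> Ystar"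
    and rk: "rank X + rank (slack C A y0) = CARD('n)"
    using complementarity by (auto simp: strict_complementarity_def)
  obtain R :: "'n \<Rightarrow> real^'n" where R: "X = (\<Sum>i\<in>UNIV. outer (R i) (R i))"
    using psd_decomposition[OF primal_sols_psd[OF X]] by blast
  define Z where "Z = - W y0"
  have Z: "psd Z" using dual_sols_feasible[OF y0] by (simp add: Z_def slack_eq)
  have ZR: "Z *v R i = 0" for i
    using complementary_slackness[OF X[unfolded R] y0] by (simp add: Z_def matrix_vector_mult_minus)
  define U where "U = span (range R)"
  have UZ: "U \<subseteq> {x. Z *v x = 0}"
  proof -
    have "subspace {x. Z *v x = 0}"
      using subspace_eigenspace[of Z 0] by (simp add: eigenspace_def)
    then show ?thesis unfolding U_def by (intro span_minimal) (auto simp: ZR)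
  qed
  have "X *v x \<in> U" for x
  proof -
    have "X *v x = (\<Sum>i\<in>UNIV. (R i \<bullet> x) *\<^sub>R R i)"
      by (simp add: R sum_matrix_vector_mult outer_mult_vec)
    also have "\<dots> \<in> U" unfolding U_def by (intro span_sum span_scale span_base) auto
    finally show ?thesis .
  qed
  then have "rank X \<le> dim U" unfolding rank_dim_range by (intro dim_subset) auto
  moreover have "rank X = dim {x. Z *v x = 0}"
    using rk rank_nullity[of Z] by (simp add: slack_eq Z_def)
  ultimately have UZ': "U = {x. Z *v x = 0}"
    using subspace_dim_equal[OF _ _ UZ] subspace_eigenspace[of Z 0] by (simp add: U_def eigenspace_def)
  define P where "P = {x. \<forall>y\<in>range R. orthogonal y x}"
  have P: "subspace P" unfolding P_def by (rule subspace_orthogonal_to_vectors)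
  have "x = 0" if "x \<in> P" "Z *v x = 0" for x
  proof -
    have "x \<in> span (range R)" using that UZ' by (auto simp: U_def)
    moreover have "orthogonal x y" if "y \<in> range R" for y
      using \<open>x \<in> P\<close> that orthogonal_commute[of x y] by (auto simp: P_def)
    ultimately have "orthogonal x x" by (rule orthogonal_to_span)
    then show ?thesis by (simp add: orthogonal_self)
  qed
  then obtain e where e: "e > 0" "\<And>x. x \<in> P \<Longrightarrow> norm (Z *v x) \<ge> e * norm x"
    using injective_imp_isometric[OF closed_subspace[OF P] P, of "(*v) Z"]
      linear_conv_bounded_linear[THEN iffD1, OF matrix_vector_mul_linear[of Z]] by blast
  define \<sigma> where "\<sigma> = e\<^sup>2 / (norm Z + 1)"
  have "\<sigma> * (x \<bullet> x) \<le> x \<bullet> (- W y0 *v x)" if "\<And>i. R i \<bullet> x = 0" for x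
  proof -
    have "x \<in> P" using that by (auto simp: P_def orthogonal_def)
    then have "(e * norm x)\<^sup>2 \<le> (norm (Z *v x))\<^sup>2" using e by (intro power_mono) auto
    also have "\<dots> \<le> norm Z * (x \<bullet> (Z *v x))" by (rule psd_norm_mult_le[OF Z])
    also have "\<dots> \<le> (norm Z + 1) * (x \<bullet> (Z *v x))" using psd_nonneg[OF Z] by (intro mult_right_mono) auto
    finally show ?thesis
      by (simp add: \<sigma>_def Z_def power_mult_distrib power2_norm_eq_inner divide_le_eq add_nonneg_pos mult.commute)
  qed
  moreover have "0 < \<sigma>" using e(1) by (simp add: \<sigma>_def add_nonneg_pos)
  ultimately show thesis using that X[unfolded R] y0 by blast
qed

text \<open>
  A linear error bound: the map \<open>d \<mapsto> (\<A>\<^sup>* d) R\<^sub>i\<close> is bounded below on the orthogonal complement of its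
  kernel, so the component of \<open>y - y0\<close> there is at most
  a multiple of the residual; deleting it gives the solution \<open>y'\<close>.
\<close>

lemma solution_map_bound:
  fixes R :: "'n \<Rightarrow> real^'n"
  assumes y0: "\<And>i. W y0 *v R i = 0"
  obtains c where "0 < c" "\<And>y. \<exists>y'. (\<forall>i. W y' *v R i = 0) \<and>
      norm (y - y') \<le> c * (\<Sum>i\<in>UNIV. norm (W y *v R i)) \<and> norm (y' - y0) \<le> norm (y - y0)"
proof -
  define f :: "real^'m \<Rightarrow> real^'n^'n" where "f = (\<lambda>d. \<chi> i. adj A d *v R i)"
  have f: "linear f"
    by (rule linearI)
       (simp_all add: f_def vec_eq_iff linear_add[OF linear_adj[OF A_lin]] linear_scale[OF linear_adj[OF A_lin]]
          matrix_vector_mult_add_rdistrib scaleR_matrix_vector_assoc[symmetric])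
  define K where "K = {d. f d = 0}"
  have K: "subspace K" unfolding K_def by (rule linear_subspace_kernel[OF f])
  define P where "P = {d. \<forall>k\<in>K. orthogonal k d}"
  have P: "subspace P" unfolding P_def by (rule subspace_orthogonal_to_vectors)
  have "d = 0" if "d \<in> P" "f d = 0" for d
    using that by (auto simp: P_def K_def orthogonal_self)
  then obtain e where e: "e > 0" "\<And>d. d \<in> P \<Longrightarrow> norm (f d) \<ge> e * norm d"
    using injective_imp_isometric[OF closed_subspace[OF P] P, of f]
      linear_conv_bounded_linear[THEN iffD1, OF f] by blast
  show thesis
  proof (rule that[of "1 / e"])
    show "0 < 1 / e" using e by simp
    fix y
    obtain k p where kp: "k \<in> span K" "\<And>w. w \<in> span K \<Longrightarrow> orthogonal p w" "y - y0 = k + p"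
      using orthogonal_subspace_decomp_exists[of K "y - y0"] by blast
    have k: "k \<in> K" using kp(1) K by (simp add: span_eq_iff[THEN iffD2])
    have p: "p \<in> P" using kp(2) orthogonal_commute[of p] by (auto simp: P_def span_base)
    have fd: "f (y - y0) = f p" using kp(3) k linear_add[OF f, of k p] by (simp add: K_def)
    have comp: "f (y - y0) $ i = W y *v R i" for i
      using y0[of i] by (simp add: f_def matrix_vector_mult_diff_rdistrib flip: W_diff)
    have "e * norm p \<le> norm (f (y - y0))" using e(2)[OF p] fd by simp
    also have "\<dots> \<le> (\<Sum>i\<in>UNIV. norm (f (y - y0) $ i))"
      unfolding norm_vec_def by (rule L2_set_le_sum) simp
    finally have 1: "norm p \<le> 1 / e * (\<Sum>i\<in>UNIV. norm (W y *v R i))"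
      using e(1) by (simp add: comp field_simps)
    have "W (y0 + k) *v R i = 0" for i
    proof -
      have "W (y0 + k) *v R i = W y0 *v R i + f k $ i"
        using W_diff[of "y0 + k" y0]
        by (simp add: f_def) (metis add_diff_cancel_left' add.commute diff_add_cancel matrix_vector_mult_add_rdistrib)
      then show ?thesis using k y0 by (simp add: K_def)
    qed
    moreover have "norm (y - (y0 + k)) \<le> 1 / e * (\<Sum>i\<in>UNIV. norm (W y *v R i))"
    proof -
      have "y - (y0 + k) = p" using kp(3) by (simp add: algebra_simps)
      then show ?thesis using 1 by simp
    qed
    moreover have "norm (y0 + k - y0) \<le> norm (y - y0)"
    proof -
      have "(norm (k + p))\<^sup>2 = (norm k)\<^sup>2 + (norm p)\<^sup>2"
        using kp(2)[OF kp(1)] orthogonal_commute[of p k] by (simp add: norm_add_Pythagorean)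
      then have "(norm k)\<^sup>2 \<le> (norm (y - y0))\<^sup>2" by (simp add: kp(3))
      then show ?thesis using norm_ge_zero power2_le_imp_le by simp
    qed
    ultimately show "\<exists>y'. (\<forall>i. W y' *v R i = 0) \<and>
      norm (y - y') \<le> 1 / e * (\<Sum>i\<in>UNIV. norm (W y *v R i)) \<and> norm (y' - y0) \<le> norm (y - y0)"
      by blast
  qed
qed

text \<open>
  The constants follow the construction of a solution near \<open>y\<close>: \<open>k0\<close> bounds the infeasibility, \<open>k2\<close> the distance to a
  solution \<open>y'\<close> of the linear equations, and \<open>k3\<close> the amount by which \<open>y'\<close> fails to be feasible,
  each of them as a multiple of \<open>\<surd>(F y - opt)\<close>.
\<close>

theorem quadratic_growth:
  assumes "0 \<le> B"
  obtains \<kappa> where "0 < \<kappa>" "\<And>y. norm y \<le> B \<Longrightarrow> infdist y Ystar \<le> \<kappa> * sqrt (F y - opt)"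
proof -
  obtain R :: "'n \<Rightarrow> real^'n" and y0 \<sigma> where X: "(\<Sum>i\<in>UNIV. outer (R i) (R i)) \<in> primal_sols C A b" (is "?X \<in> _")
    and y0: "y0 \<in> Ystar" and \<sigma>: "0 < \<sigma>"
    and pd: "\<And>x. (\<And>i. R i \<bullet> x = 0) \<Longrightarrow> \<sigma> * (x \<bullet> x) \<le> x \<bullet> (- W y0 *v x)"
    using strict_pair by blast
  have WR0: "W y0 *v R i = 0" for i by (rule complementary_slackness[OF X y0])
  obtain c where c: "0 < c" "\<And>y. \<exists>y'. (\<forall>i. W y' *v R i = 0) \<and>
      norm (y - y') \<le> c * (\<Sum>i\<in>UNIV. norm (W y *v R i)) \<and> norm (y' - y0) \<le> norm (y - y0)"
    by (rule solution_map_bound[of y0 R, OF WR0]) (rule that)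
  define \<tau> where "\<tau> = \<alpha> - trace ?X"
  have \<tau>: "0 < \<tau>" using trace_lt_penalty[OF X] by (simp add: \<tau>_def)
  define L where "L = onorm (adj A)"
  have L: "0 \<le> L" using onorm_nonneg by (simp add: L_def)
  define w0 where "w0 = norm (W 0) + L * B"
  define m1 where "m1 = norm (mat 1 :: real^'n^'n)"
  define k0 where "k0 = sqrt w0 / sqrt \<tau>"
  define k1 where "k1 = sqrt (w0 * m1 + w0)"
  define k2 where "k2 = c * (\<Sum>i\<in>UNIV. k1 + k0 * norm (R i))"
  define k3 where "k3 = k0 + L * k2"
  define \<kappa> where "\<kappa> = k2 + k3 / \<sigma> * (B + norm y0) + 1"
  have w0: "0 \<le> w0" using L assms by (simp add: w0_def)
  have m1: "0 \<le> m1" by (simp add: m1_def)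
  have k0: "0 \<le> k0" using w0 \<tau> by (simp add: k0_def)
  have k1: "0 \<le> k1" using w0 m1 by (simp add: k1_def)
  have k2: "0 \<le> k2" unfolding k2_def using c k0 k1 by (intro mult_nonneg_nonneg sum_nonneg) auto
  have k3: "0 \<le> k3" using k0 L k2 by (simp add: k3_def)
  have \<kappa>: "0 < \<kappa>" unfolding \<kappa>_def using k2 k3 \<sigma> assms by (intro add_nonneg_pos add_nonneg_nonneg) auto
  have "infdist y Ystar \<le> \<kappa> * sqrt (F y - opt)" if yB: "norm y \<le> B" for y
  proof -
    define \<epsilon> where "\<epsilon> = F y - opt"
    define \<nu> where "\<nu> = infeas y"
    have \<epsilon>: "0 \<le> \<epsilon>" using F_ge_opt by (simp add: \<epsilon>_def)
    have \<nu>: "0 \<le> \<nu>" by (simp add: \<nu>_def)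
    have "norm (W y) \<le> norm (W 0) + norm (W y - W 0)"
      using norm_triangle_ineq[of "W 0" "W y - W 0"] by simp
    also have "norm (W y - W 0) \<le> L * B"
      using W_lipschitz[of y 0] mult_left_mono[OF yB L] by (simp add: L_def)
    finally have Ww0: "norm (W y) \<le> w0" by (simp add: w0_def)
    have \<nu>w0: "\<nu> \<le> w0" using infeas_le_norm[of y] Ww0 w0 by (simp add: \<nu>_def)
    have \<nu>\<epsilon>: "\<nu> \<le> \<epsilon> / \<tau>"
    proof -
      have "\<nu> * \<tau> \<le> \<epsilon>" unfolding \<nu>_def \<epsilon>_def \<tau>_def using F_gap[OF X, of y] by (simp only: mult.commute)
      then show ?thesis using \<tau> by (simp only: pos_le_divide_eq)
    qed
    \<comment> \<open>The infeasibility is even linear in \<open>\<epsilon>\<close>; boundedness turns this into a multiple of \<open>\<surd>\<epsilon>\<close> for large \<open>\<epsilon>\<close> too.\<close>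
    have "\<nu>\<^sup>2 \<le> w0 * (\<epsilon> / \<tau>)"
      unfolding power2_eq_square using \<nu>w0 \<nu>\<epsilon> \<nu> w0 by (intro mult_mono) auto
    then have "\<nu> \<le> sqrt (w0 * (\<epsilon> / \<tau>))" by (rule real_le_rsqrt)
    then have \<nu>k0: "\<nu> \<le> k0 * sqrt \<epsilon>"
      by (simp add: k0_def real_sqrt_mult real_sqrt_divide)
    \<comment> \<open>Shifting the slack matrix by the infeasibility makes it positive semidefinite.\<close>
    define M where "M = \<nu> *\<^sub>R mat 1 - W y"
    have Mv: "M *v x = \<nu> *\<^sub>R x - W y *v x" for x
      by (simp add: M_def matrix_vector_mult_diff_rdistrib scaleR_matrix_vector_assoc[symmetric])
    have M: "psd M"
      unfolding psd_def
    proof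
      show "M \<in> sym_mats"
        unfolding M_def by (intro subspace_diff[OF subspace_sym_mats] subspace_scale[OF subspace_sym_mats] mat1_sym W_sym)
      show "\<forall>v. 0 \<le> v \<bullet> (M *v v)"
        using infeas_Rayleigh[of _ y] by (simp add: Mv inner_diff_right \<nu>_def)
    qed
    have "norm M \<le> norm (\<nu> *\<^sub>R (mat 1 :: real^'n^'n)) + norm (W y)"
      unfolding M_def by (rule norm_triangle_ineq4)
    also have "\<dots> \<le> w0 * m1 + w0"
      using mult_right_mono[OF \<nu>w0 m1] Ww0 \<nu> by (simp add: m1_def)
    finally have normM: "norm M \<le> w0 * m1 + w0" .
    have "?X \<bullet> M = \<nu> * trace ?X - ?X \<bullet> W y"
      by (simp add: M_def inner_diff_right trace_conv_inner)
    also have "\<dots> = \<epsilon> - \<tau> * \<nu>"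
      using dual_objective[OF X, of y] by (simp add: \<epsilon>_def F_eq \<tau>_def \<nu>_def algebra_simps)
    also have "\<dots> \<le> \<epsilon>" using \<tau> \<nu> by simp
    finally have "(\<Sum>i\<in>UNIV. R i \<bullet> (M *v R i)) \<le> \<epsilon>"
      by (simp add: inner_sum_left inner_commute[of "outer _ _"] inner_outer)
    then have RM: "R i \<bullet> (M *v R i) \<le> \<epsilon>" for i
      using member_le_sum[of i UNIV "\<lambda>i. R i \<bullet> (M *v R i)"] psd_nonneg[OF M] by fastforce
    have WR: "norm (W y *v R i) \<le> (k1 + k0 * norm (R i)) * sqrt \<epsilon>" for i
    proof -
      have "(norm (M *v R i))\<^sup>2 \<le> norm M * (R i \<bullet> (M *v R i))" by (rule psd_norm_mult_le[OF M])
      also have "\<dots> \<le> (w0 * m1 + w0) * \<epsilon>"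
        using normM RM psd_nonneg[OF M] by (intro mult_mono) (auto intro: order_trans[OF norm_ge_zero])
      finally have "norm (M *v R i) \<le> k1 * sqrt \<epsilon>"
        by (simp add: k1_def real_le_rsqrt flip: real_sqrt_mult)
      moreover have "norm (\<nu> *\<^sub>R R i) \<le> k0 * sqrt \<epsilon> * norm (R i)"
        using mult_right_mono[OF \<nu>k0 norm_ge_zero] \<nu> by simp
      moreover have "norm (W y *v R i) \<le> norm (\<nu> *\<^sub>R R i) + norm (M *v R i)"
        using norm_triangle_ineq4[of "\<nu> *\<^sub>R R i" "M *v R i"] Mv[of "R i"] by simp
      ultimately have "norm (W y *v R i) \<le> k0 * sqrt \<epsilon> * norm (R i) + k1 * sqrt \<epsilon>"
        by linarith
      then show ?thesis by (simp add: algebra_simps)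
    qed
    obtain y' where y': "\<And>i. W y' *v R i = 0" "norm (y - y') \<le> c * (\<Sum>i\<in>UNIV. norm (W y *v R i))"
       "norm (y' - y0) \<le> norm (y - y0)" using c(2)[of y] by blast
    have "c * (\<Sum>i\<in>UNIV. norm (W y *v R i)) \<le> c * (\<Sum>i\<in>UNIV. (k1 + k0 * norm (R i)) * sqrt \<epsilon>)"
      using WR c(1) by (intro mult_left_mono sum_mono) auto
    then have yy': "norm (y - y') \<le> k2 * sqrt \<epsilon>"
      using y'(2) by (simp add: k2_def sum_distrib_right[symmetric] mult.assoc)
    define s where "s = k3 * sqrt \<epsilon>"
    have s: "0 \<le> s" using k3 \<epsilon> by (simp add: s_def)
    \<comment> \<open>The step towards \<open>y0\<close> for which its curvature \<open>\<theta> \<sigma>\<close> just balances the defect \<open>(1 - \<theta>) s\<close>.\<close>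
    define \<theta> where "\<theta> = s / (\<sigma> + s)"
    have \<theta>: "0 \<le> \<theta>" "\<theta> \<le> 1" "\<theta> \<le> s / \<sigma>" "(1 - \<theta>) * s = \<theta> * \<sigma>"
      using s \<sigma> by (simp_all add: \<theta>_def field_simps)
    define u where "u = (1 - \<theta>) *\<^sub>R y' + \<theta> *\<^sub>R y0"
    have Wu: "W u = (1 - \<theta>) *\<^sub>R W y' + \<theta> *\<^sub>R W y0" unfolding u_def by (rule W_convex_comb)
    have WuR: "W u *v R i = 0" for i
      by (simp add: Wu matrix_vector_mult_add_rdistrib scaleR_matrix_vector_assoc[symmetric] y'(1) WR0)
    have perp: "0 \<le> x \<bullet> (- W u *v x)" if "\<And>i. R i \<bullet> x = 0" for x
    proof -
      have "x \<bullet> (W y' *v x) = x \<bullet> (W y *v x) + x \<bullet> ((W y' - W y) *v x)"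
        by (simp add: matrix_vector_mult_diff_rdistrib inner_diff_right)
      also have "x \<bullet> ((W y' - W y) *v x) \<le> norm (W y' - W y) * (x \<bullet> x)"
        using abs_bilinear_le[of x "W y' - W y" x] by (simp add: power2_norm_eq_inner[symmetric] power2_eq_square mult.assoc)
      also have "norm (W y' - W y) \<le> L * (k2 * sqrt \<epsilon>)"
        using W_lipschitz[of y' y] mult_left_mono[OF yy' L] by (simp add: L_def norm_minus_commute)
      also have "x \<bullet> (W y *v x) \<le> k0 * sqrt \<epsilon> * (x \<bullet> x)"
        using infeas_Rayleigh[of x y] mult_right_mono[OF \<nu>k0, of "x \<bullet> x"] by (simp add: \<nu>_def)
      finally have "x \<bullet> (W y' *v x) \<le> s * (x \<bullet> x)"
        by (simp add: mult_right_mono s_def k3_def algebra_simps)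
      then have "(1 - \<theta>) * (x \<bullet> (W y' *v x)) \<le> (1 - \<theta>) * (s * (x \<bullet> x))"
        using \<theta> by (intro mult_left_mono) auto
      also have "\<dots> = \<theta> * (\<sigma> * (x \<bullet> x))" using \<theta>(4) by (simp add: mult.assoc[symmetric])
      also have "\<dots> \<le> \<theta> * (x \<bullet> (- W y0 *v x))"
        using \<theta> pd[OF that] by (intro mult_left_mono) auto
      finally have "(1 - \<theta>) * (x \<bullet> (W y' *v x)) + \<theta> * (x \<bullet> (W y0 *v x)) \<le> 0"
        by (simp add: matrix_vector_mult_minus)
      then show ?thesis
        unfolding matrix_vector_mult_minus Wu inner_minus_right
        by (simp add: matrix_vector_mult_add_rdistrib scaleR_matrix_vector_assoc[symmetric] inner_add_right)
    qed
    have "psd (slack C A u)"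
      unfolding psd_def slack_eq
    proof
      show "- W u \<in> sym_mats" by (rule subspace_neg[OF subspace_sym_mats W_sym])
      show "\<forall>x. 0 \<le> x \<bullet> (- W u *v x)"
      proof
        fix x
        obtain k p where kp: "k \<in> span (range R)" "\<And>w. w \<in> span (range R) \<Longrightarrow> orthogonal p w" "x = k + p"
          using orthogonal_subspace_decomp_exists[of "range R" x] by blast
        have "subspace {x. W u *v x = 0}"
          using subspace_eigenspace[of "W u" 0] by (simp add: eigenspace_def)
        then have "k \<in> {x. W u *v x = 0}"
          using kp(1) span_minimal[of "range R" "{x. W u *v x = 0}"] WuR by blast
        then have k: "W u *v k = 0" by simp
        have "R i \<bullet> p = 0" for i
          using kp(2)[of "R i"] by (simp add: span_base orthogonal_def inner_commute)
        then have "0 \<le> p \<bullet> (- W u *v p)" by (rule perp)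
        also have "p \<bullet> (- W u *v p) = x \<bullet> (- W u *v x)"
          using k sym_mats_commute[OF W_sym, of k u p]
          by (simp add: kp(3) matrix_vector_mult_minus matrix_vector_right_distrib inner_add_left)
        finally show "0 \<le> x \<bullet> (- W u *v x)" .
      qed
    qed
    moreover have "(- b) \<bullet> u = opt"
    proof -
      have "?X \<bullet> W u = 0"
        by (simp add: inner_sum_left inner_commute[of "outer _ _"] inner_outer WuR)
      then show ?thesis using dual_objective[OF X, of u] by simp
    qed
    ultimately have "u \<in> Ystar" by (rule dual_solsI)
    then have "infdist y Ystar \<le> dist y u" by (rule infdist_le)
    also have "\<dots> \<le> norm (y - y') + \<theta> * norm (y' - y0)"
    proof -
      have eq: "y - u = (y - y') + \<theta> *\<^sub>R (y' - y0)" by (simp add: u_def algebra_simps)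
      show ?thesis
        unfolding dist_norm eq
        using norm_triangle_ineq[of "y - y'" "\<theta> *\<^sub>R (y' - y0)"] \<theta>(1) by simp
    qed
    also have "\<theta> * norm (y' - y0) \<le> s / \<sigma> * (B + norm y0)"
      using \<theta> y'(3) norm_triangle_ineq4[of y y0] yB by (intro mult_mono) auto
    also note yy'
    finally have "infdist y Ystar \<le> (\<kappa> - 1) * sqrt \<epsilon>"
      by (simp add: \<kappa>_def s_def algebra_simps add_divide_distrib)
    also have "\<dots> \<le> \<kappa> * sqrt \<epsilon>" using \<epsilon> by (intro mult_right_mono) auto
    finally show ?thesis by (simp add: \<epsilon>_def)
  qed
  with \<kappa> show thesis using that by blast
qed

lemma F_eq_opt_iff: "F y = opt \<longleftrightarrow> y \<in> Ystar"
proof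
  assume "F y = opt"
  moreover obtain \<kappa> where "infdist y Ystar \<le> \<kappa> * sqrt (F y - opt)"
    using quadratic_growth[of "norm y"] by (metis norm_ge_zero order_refl)
  ultimately have "infdist y Ystar = 0" using infdist_nonneg[of y Ystar] by simp
  then show "y \<in> Ystar"
    using in_closed_iff_infdist_zero[OF compact_imp_closed[OF Ystar_compact] Ystar_nonempty] by simp
qed (rule F_dual_sols)

end

section \<open>The spectral model and one proximal step\<close>

lemma span_columns_range: "span (columns V) = range ((*v) (V :: real^'r^'n))"
proof
  have "subspace (range ((*v) V))"
    using linear_subspace_image[OF matrix_vector_mul_linear subspace_UNIV] .
  moreover have "columns V \<subseteq> range ((*v) V)"
    by (auto simp: columns_def matrix_vector_mult_basis[symmetric])
  ultimately show "span (columns V) \<subseteq> range ((*v) V)" by (intro span_minimal)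
qed (use matrix_vector_mult_in_columnspace in auto)

lemma orthonormal_columns_norm:
  assumes "orthonormal_columns (V :: real^'r^'n)" shows "norm (V *v s) = norm s"
proof -
  have "(V *v s) \<bullet> (V *v s) = s \<bullet> ((transpose V ** V) *v s)"
    by (simp only: matrix_vector_mul_assoc[symmetric] transpose_matrix_vector)
       (metis dot_lmul_matrix inner_commute)
  also have "\<dots> = s \<bullet> s" using assms by (simp add: orthonormal_columns_def)
  finally show ?thesis by (simp add: norm_eq_sqrt_inner)
qed

lemma conj_add:
  fixes V :: "real^'r^'n"
  shows "V ** (M + N) ** transpose V = V ** M ** transpose V + V ** N ** transpose V"
  unfolding matrix_add_ldistrib
  by (simp add: vec_eq_iff matrix_matrix_mult_def[of "_ + _"] matrix_matrix_mult_def[of "V ** _"] sum.distrib distrib_right)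

lemma conj_zero:
  fixes V :: "real^'r^'n"
  shows "V ** 0 ** transpose V = 0"
  by (simp add: vec_eq_iff matrix_matrix_mult_def)

lemma conj_sum:
  fixes V :: "real^'r^'n" and f :: "'i \<Rightarrow> real^'r^'r"
  shows "V ** (\<Sum>i\<in>I. f i) ** transpose V = (\<Sum>i\<in>I. V ** f i ** transpose V)"
  by (induction I rule: infinite_finite_induct) (auto simp: conj_add conj_zero)

lemma conj_scaled_outer:
  fixes V :: "real^'r^'n"
  shows "V ** (c *\<^sub>R outer s s) ** transpose V = c *\<^sub>R outer (V *v s) (V *v s)"
proof -
  have "V ** (c *\<^sub>R M) = c *\<^sub>R (V ** M)" for M :: "real^'r^'r"
    by (simp add: vec_eq_iff matrix_matrix_mult_def sum_distrib_left mult.left_commute)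
  moreover have "(c *\<^sub>R M) ** transpose V = c *\<^sub>R (M ** transpose V)" for M :: "real^'r^'n"
    by (simp add: vec_eq_iff matrix_matrix_mult_def sum_distrib_left mult.assoc)
  ultimately show ?thesis by (simp add: conj_outer)
qed

context sdp_pair
begin

abbreviation Fm :: "real^'n^'n \<Rightarrow> real^'r^'n \<Rightarrow> real^'m \<Rightarrow> real"
  where "Fm \<equiv> spectral_model C A b \<alpha>"

lemma model_term_eq: "model_term C A b Xb V u w = (- b) \<bullet> u + model_mat Xb V w \<bullet> W u"
  by (simp add: model_term_def W_def)

lemma model_mat_psd:
  assumes "psd Xb" "w \<in> model_set \<alpha> Xb" shows "psd (model_mat Xb V w)"
  using assms by (auto simp: model_set_def model_mat_def intro!: psd_add psd_scale psd_conj)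

lemma model_mat_trace:
  assumes "orthonormal_columns V" "w \<in> model_set \<alpha> Xb" shows "trace (model_mat Xb V w) \<le> \<alpha>"
  using assms by (auto simp: model_set_def model_mat_def trace_add trace_scale trace_conj)

text \<open>
  Trace-bounded semidefinite matrices see at most the largest eigenvalue.  Hence all matrices that the
  model admits give minorants of \<open>F\<close>.
\<close>

lemma penalty_dominates:
  assumes "psd X" "trace X \<le> \<alpha>" shows "X \<bullet> W u \<le> \<alpha> * infeas u"
proof -
  have "X \<bullet> W u \<le> infeas u * trace X" by (rule psd_inner_le_trace[OF assms(1) infeas_Rayleigh])
  also have "\<dots> \<le> infeas u * \<alpha>" using assms(2) by (intro mult_left_mono) auto
  finally show ?thesis by (simp add: mult.commute)
qed

lemma model_term_le_F:
  assumes "psd Xb" "orthonormal_columns V" "w \<in> model_set \<alpha> Xb"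
  shows "model_term C A b Xb V u w \<le> F u"
  using penalty_dominates[OF model_mat_psd model_mat_trace] assms by (simp add: model_term_eq F_eq)

lemma zero_in_model_set: "(0, 0) \<in> model_set \<alpha> Xb"
  using \<alpha>_pos by (simp add: model_set_def psd_zero trace_conv_inner)

lemma model_le_F:
  assumes "psd Xb" "orthonormal_columns V" shows "Fm Xb V u \<le> F u"
  unfolding spectral_model_def
proof (rule cSUP_least)
  show "model_set \<alpha> Xb \<noteq> {}" using zero_in_model_set by blast
qed (rule model_term_le_F[OF assms])

lemma model_term_le_model:
  assumes "psd Xb" "orthonormal_columns V" "w \<in> model_set \<alpha> Xb"
  shows "model_term C A b Xb V u w \<le> Fm Xb V u"
  unfolding spectral_model_def
  by (rule cSUP_upper[OF assms(3)]) (use model_term_le_F[OF assms(1,2)] in \<open>auto intro!: bdd_aboveI2\<close>)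

lemma model_ge_linear:
  assumes "psd Xb" "orthonormal_columns V" shows "(- b) \<bullet> u \<le> Fm Xb V u"
  using model_term_le_model[OF assms zero_in_model_set] by (simp add: model_term_eq model_mat_def conj_zero)

lemma model_ge_span:
  assumes "psd Xb" "orthonormal_columns V" "x \<in> span (columns V)" "norm x = 1"
  shows "(- b) \<bullet> u + \<alpha> * (x \<bullet> (W u *v x)) \<le> Fm Xb V u"
proof -
  obtain s where s: "x = V *v s" using assms(3) by (auto simp: span_columns_range)
  have ns: "norm s = 1" using assms(4) orthonormal_columns_norm[OF assms(2), of s] s by simp
  have "(0, \<alpha> *\<^sub>R outer s s) \<in> model_set \<alpha> Xb"
    using ns \<alpha>_pos by (simp add: model_set_def psd_scale psd_outer trace_scale trace_outer norm_eq_1)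
  from model_term_le_model[OF assms(1,2) this, of u]
  show ?thesis
    by (simp add: model_term_eq model_mat_def conj_scaled_outer s inner_commute[of "outer _ _"] inner_outer)
qed

text \<open>
  The objective of the subproblem at the maximizing matrix is an affine function plus
  \<open>\<rho>/2 \<parallel>\<sqdot> - yc\<parallel>\<^sup>2\<close>, and \<open>z\<close> minimizes it.  The stationarity condition is the formula
  for the primal residual, and completing the square gives the last identity.
\<close>

lemma proximal_step:
  assumes Xb: "psd Xb" and V: "orthonormal_columns V" and "0 < \<rho>"
    and sol: "subproblem_solution C A b \<rho> \<alpha> Xb V yc z w"
  shows "psd (model_mat Xb V w)" "trace (model_mat Xb V w) \<le> \<alpha>"
    and "Fm Xb V z = (- b) \<bullet> z + model_mat Xb V w \<bullet> W z"
    and "(- b) \<bullet> u + model_mat Xb V w \<bullet> W u \<le> Fm Xb V u"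
    and "b - A (model_mat Xb V w) = \<rho> *\<^sub>R (z - yc)"
    and "Fm Xb V z + \<rho> / 2 * (norm (z - yc))\<^sup>2 + \<rho> / 2 * (norm (u - z))\<^sup>2
           = (- b) \<bullet> u + model_mat Xb V w \<bullet> W u + \<rho> / 2 * (norm (u - yc))\<^sup>2"
proof -
  let ?X = "model_mat Xb V w"
  define l where "l = (\<lambda>u. (- b) \<bullet> u + ?X \<bullet> W u)"
  have w: "w \<in> model_set \<alpha> Xb"
    and wmax: "\<And>w'. w' \<in> model_set \<alpha> Xb \<Longrightarrow> model_term C A b Xb V z w' \<le> model_term C A b Xb V z w"
    and zmin: "\<And>z'. l z + \<rho> / 2 * (norm (z - yc))\<^sup>2 \<le> l z' + \<rho> / 2 * (norm (z' - yc))\<^sup>2"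
    using sol by (auto simp: subproblem_solution_def saddle_point_def l_def model_term_eq)
  show X: "psd ?X" and "trace ?X \<le> \<alpha>" using model_mat_psd[OF Xb w] model_mat_trace[OF V w] .
  show Fz: "Fm Xb V z = (- b) \<bullet> z + ?X \<bullet> W z"
    unfolding model_term_eq[symmetric] spectral_model_def
    by (rule antisym[OF cSUP_least])
       (use w wmax model_term_le_model[OF Xb V w, of z] in \<open>auto simp: spectral_model_def\<close>)
  show "(- b) \<bullet> u + ?X \<bullet> W u \<le> Fm Xb V u"
    using model_term_le_model[OF Xb V w, of u] by (simp add: model_term_eq)
  define g where "g = A ?X - b"
  have l: "l u = g \<bullet> u - ?X \<bullet> C" for u
    using adj_inner[OF A_lin psd_sym[OF X], of u]
    by (simp add: l_def g_def W_def inner_diff_left inner_diff_right inner_commute)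
  define d where "d = g + \<rho> *\<^sub>R (z - yc)"
  have "norm d * norm d \<le> 0"
  proof -
    \<comment> \<open>The exact minimizer, since \<open>d\<close> is the gradient at \<open>z\<close>; comparing values there yields \<open>d = 0\<close>.\<close>
    define z' where "z' = z - (1 / \<rho>) *\<^sub>R d"
    have "l z' = l z - (g \<bullet> d) / \<rho>" by (simp add: l z'_def inner_diff_right)
    moreover have "(norm (z' - yc))\<^sup>2 = (norm (z - yc))\<^sup>2 - 2 / \<rho> * ((z - yc) \<bullet> d) + (d \<bullet> d) / \<rho>\<^sup>2"
      unfolding z'_def power2_norm_eq_inner
      by (simp add: inner_diff_left inner_diff_right inner_commute power2_eq_square algebra_simps)
    then have "\<rho> / 2 * (norm (z' - yc))\<^sup>2
        = \<rho> / 2 * (norm (z - yc))\<^sup>2 - (z - yc) \<bullet> d + (d \<bullet> d) / (2 * \<rho>)"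
      using \<open>0 < \<rho>\<close> by (simp add: field_simps power2_eq_square)
    moreover have "(g \<bullet> d) / \<rho> = (d \<bullet> d) / \<rho> - (z - yc) \<bullet> d"
      using \<open>0 < \<rho>\<close> by (simp add: d_def inner_add_left add_divide_distrib)
    ultimately have "(d \<bullet> d) / \<rho> \<le> (d \<bullet> d) / (2 * \<rho>)"
      using zmin[of z'] by linarith
    then have "d \<bullet> d \<le> 0" using \<open>0 < \<rho>\<close> by (simp add: field_simps)
    then show ?thesis by (simp add: power2_norm_eq_inner[symmetric] power2_eq_square)
  qed
  then have "d = 0" by (simp add: mult_le_0_iff)
  then have g: "g = - \<rho> *\<^sub>R (z - yc)" by (simp add: d_def add_eq_0_iff)
  then show "b - A ?X = \<rho> *\<^sub>R (z - yc)" by (simp add: g_def algebra_simps)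
  define B where "B = (z - yc) \<bullet> (u - z)"
  have "l u - l z = - \<rho> * B" by (simp add: B_def l g inner_diff_right algebra_simps)
  then have lu: "l u = l z - \<rho> * B" by simp
  have nu: "(norm (u - yc))\<^sup>2 = (norm (u - z))\<^sup>2 + 2 * B + (norm (z - yc))\<^sup>2"
    unfolding power2_norm_eq_inner B_def by (simp add: inner_diff_left inner_diff_right inner_commute algebra_simps)
  have "l u + \<rho> / 2 * (norm (u - yc))\<^sup>2 = l z + \<rho> / 2 * (norm (z - yc))\<^sup>2 + \<rho> / 2 * (norm (u - z))\<^sup>2"
    unfolding lu nu by (simp add: algebra_simps)
  then show "Fm Xb V z + \<rho> / 2 * (norm (z - yc))\<^sup>2 + \<rho> / 2 * (norm (u - z))\<^sup>2
           = (- b) \<bullet> u + ?X \<bullet> W u + \<rho> / 2 * (norm (u - yc))\<^sup>2"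
    unfolding Fz by (simp add: l_def)
qed

lemma W_form_perturbation:
  "\<bar>x \<bullet> (W u *v x') - x \<bullet> (W u' *v x')\<bar> \<le> onorm (adj A) * norm (u - u') * (norm x * norm x')"
proof -
  have "x \<bullet> (W u *v x') - x \<bullet> (W u' *v x') = x \<bullet> ((W u - W u') *v x')"
    by (simp add: matrix_vector_mult_diff_rdistrib inner_diff_right)
  also have "\<bar>\<dots>\<bar> \<le> norm (W u - W u') * (norm x * norm x')"
    using abs_bilinear_le[of x "W u - W u'" x'] by (simp add: mult.assoc)
  also have "\<dots> \<le> onorm (adj A) * norm (u - u') * (norm x * norm x')"
    by (intro mult_right_mono W_lipschitz) simp
  finally show ?thesis .
qed

text \<open>
  With a top eigenvector at \<open>z\<close> in the basis, the model reproduces \<open>F\<close> at \<open>z\<close>.  Away from \<open>z\<close> the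
  minorant falls off no faster than its Lipschitz constant allows.
\<close>

lemma model_ge_linearization:
  assumes Xb: "psd Xb" and V: "orthonormal_columns V" and "x \<in> span (columns V)" "norm x = 1"
    and ev: "W z *v x = eigval_max (W z) *\<^sub>R x"
  shows "F z - (norm b + \<alpha> * onorm (adj A)) * norm (u - z) \<le> Fm Xb V u"
proof -
  let ?L = "onorm (adj A)"
  have b: "(- b) \<bullet> z - norm b * norm (u - z) \<le> (- b) \<bullet> u"
    using Cauchy_Schwarz_ineq2[of b "u - z"] by (simp add: inner_diff_right abs_le_iff)
  have L: "0 \<le> \<alpha> * ?L * norm (u - z)" using \<alpha>_pos onorm_nonneg by simp
  have "x \<bullet> (W z *v x) = eigval_max (W z)" using assms(4) by (simp add: ev norm_eq_1)
  then have "eigval_max (W z) - ?L * norm (u - z) \<le> x \<bullet> (W u *v x)"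
    using W_form_perturbation[of x u x z] assms(4) by (simp add: abs_le_iff)
  then have "\<alpha> * eigval_max (W z) - \<alpha> * ?L * norm (u - z) \<le> \<alpha> * (x \<bullet> (W u *v x))"
    using mult_left_mono[of _ _ \<alpha>] \<alpha>_pos by (fastforce simp: right_diff_distrib mult.assoc)
  then show ?thesis
    using model_ge_span[OF assms(1-4), of u] model_ge_linear[OF Xb V, of u] b L
    by (cases "0 \<le> eigval_max (W z)") (simp_all add: F_eq algebra_simps)
qed

section \<open>Accuracy of the model near the solutions\<close>

text \<open>
  Here \<open>a\<close> is the model value of the penalized eigenvalue and \<open>e\<close> the size of the perturbation
  \<open>W u - W yc\<close>.  If \<open>e\<close> is small against the gap, split a vector into its component in the span of the top \<open>r\<close>
  eigenvectors, where the form is at most \<open>a\<close> because the basis spans it, and the rest, where the form stays \<open>g/2\<close> below \<open>a\<close>; the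
  two interact only through the perturbation.  If \<open>e\<close> is large, a bound linear in \<open>e\<close> is already quadratic.
\<close>

lemma quadratic_model_accuracy:
  assumes Xb: "psd Xb" and V: "orthonormal_columns V"
    and top: "top_eigenvectors rc (W yc) v" "v ` {1..rc} \<subseteq> span (columns V)"
    and r: "1 \<le> r" "r \<le> rc" "r < CARD('n)"
    and g: "0 < g" "eigval (r + 1) (W yc) + g \<le> eigval r (W yc)"
  shows "F u \<le> Fm Xb V u + 8 * \<alpha> * (onorm (adj A))\<^sup>2 / g * (norm (u - yc))\<^sup>2"
proof -
  define e where "e = onorm (adj A) * norm (u - yc)"
  have e: "0 \<le> e" using onorm_nonneg by (simp add: e_def)
  define a where "a = (Fm Xb V u + b \<bullet> u) / \<alpha>"
  define m where "m = eigval (r + 1) (W yc)"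
  have a0: "0 \<le> a" using model_ge_linear[OF Xb V, of u] \<alpha>_pos by (simp add: a_def)
  have span: "x \<bullet> (W u *v x) \<le> a * (x \<bullet> x)" if x: "x \<in> span (columns V)" for x
  proof (cases "x = 0")
    case False
    have "(1 / norm x) *\<^sub>R x \<in> span (columns V)" by (rule span_scale[OF x])
    from model_ge_span[OF Xb V this, of u] False
    have "\<alpha> * (x \<bullet> (W u *v x) / (norm x)\<^sup>2) \<le> \<alpha> * a"
      using \<alpha>_pos by (simp add: a_def matrix_vector_mult_scaleR power2_eq_square)
    then have "x \<bullet> (W u *v x) / (norm x)\<^sup>2 \<le> a" using \<alpha>_pos by (simp only: mult_le_cancel_left_pos)
    then show ?thesis using False by (simp add: divide_le_eq power2_norm_eq_inner)
  qed simp
  have on: "v i \<bullet> v j = (if i = j then 1 else 0)" if "i \<in> {1..rc}" "j \<in> {1..rc}" for i j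
    using top that by (auto simp: top_eigenvectors_def)
  have ev: "W yc *v v i = eigval i (W yc) *\<^sub>R v i" if "i \<in> {1..rc}" for i
    using top that by (auto simp: top_eigenvectors_def)
  have pert: "\<bar>x \<bullet> (W u *v x') - x \<bullet> (W yc *v x')\<bar> \<le> e * (norm x * norm x')" for x x'
    unfolding e_def by (rule W_form_perturbation)
  have max: "x \<bullet> (W yc *v x) \<le> eigval 1 (W yc) * (x \<bullet> x)" for x
    using eigval_max_Rayleigh[OF W_sym, of x yc] by (simp add: eigval_max_def)
  have "1 \<in> {1..rc}" using r by simp
  have a1: "eigval 1 (W yc) - e \<le> a"
  proof -
    have nv: "norm (v 1) = 1" "v 1 \<bullet> v 1 = 1" and "v 1 \<in> span (columns V)" "W yc *v v 1 = eigval 1 (W yc) *\<^sub>R v 1"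
      using on[of 1 1] ev[of 1] top(2) \<open>1 \<in> _\<close> by (auto simp: norm_eq_1)
    then show ?thesis
      using span[of "v 1"] pert[of "v 1" "v 1"] unfolding nv
      by (simp add: nv(2) abs_le_iff del: One_nat_def)
  qed
  have gap1: "m + g \<le> eigval 1 (W yc)"
    using g(2) eigval_antimono[OF W_sym, of 1 r yc] r by (simp add: m_def)
  have "infeas u \<le> a + 8 * e\<^sup>2 / g"
  proof (rule infeas_le)
    show "0 \<le> a + 8 * e\<^sup>2 / g" using a0 g(1) by simp
    fix x
    show "x \<bullet> (W u *v x) \<le> (a + 8 * e\<^sup>2 / g) * (x \<bullet> x)"
    proof (cases "e \<le> g / 4")
      case False
      have "2 * e \<le> 8 * e\<^sup>2 / g"
      proof -
        have "e * g \<le> e * (4 * e)" using False e by (intro mult_left_mono) auto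
        then show ?thesis using g(1) by (simp add: field_simps power2_eq_square)
      qed
      have "x \<bullet> (W u *v x) \<le> eigval 1 (W yc) * (x \<bullet> x) + e * (x \<bullet> x)"
        using max[of x] pert[of x x] by (simp add: power2_norm_eq_inner[symmetric] power2_eq_square abs_le_iff)
      also have "\<dots> \<le> (a + 2 * e) * (x \<bullet> x)"
        using mult_right_mono[OF a1, of "x \<bullet> x"] by (simp add: algebra_simps)
      also have "\<dots> \<le> (a + 8 * e\<^sup>2 / g) * (x \<bullet> x)"
        using \<open>2 * e \<le> _\<close> by (intro mult_right_mono) auto
      finally show ?thesis .
    next
      case True
      let ?U = "span (v ` {1..r})"
      obtain p q where pq: "p \<in> ?U" "\<And>h. h \<in> ?U \<Longrightarrow> orthogonal q h" "x = p + q"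
        using orthogonal_subspace_decomp_exists[of "v ` {1..r}" x] by blast
      have pV: "p \<in> span (columns V)"
      proof -
        have "v ` {1..r} \<subseteq> span (columns V)" using top(2) r by auto
        then show ?thesis using pq(1) span_minimal[OF _ subspace_span] by blast
      qed
      have "v i \<bullet> q = 0" if "1 \<le> i" "i \<le> r" for i
        using pq(2)[of "v i"] that by (simp add: span_base orthogonal_def inner_commute)
      then have q: "q \<bullet> (W yc *v q) \<le> m * (q \<bullet> q)"
        using top_eigenvectors_complement[OF W_sym top(1) r] g by (simp add: m_def)
      have inv: "W yc *v p \<in> ?U"
      proof -
        have "W yc *v v i \<in> ?U" if "i \<in> {1..r}" for i
        proof -
          have "v i \<in> ?U" using that by (intro span_base) auto
          then have "eigval i (W yc) *\<^sub>R v i \<in> ?U" by (rule span_scale)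
          then show ?thesis using ev[of i] that r by simp
        qed
        then have "(*v) (W yc) ` ?U \<subseteq> ?U"
          unfolding linear_span_image[OF matrix_vector_mul_linear, symmetric]
          by (intro span_minimal) auto
        then show ?thesis using pq(1) by blast
      qed
      have cross: "q \<bullet> (W yc *v p) = 0" using pq(2)[OF inv] by (simp add: orthogonal_def)
      define c s where "c = norm p" and "s = norm q"
      have xx: "x \<bullet> x = c\<^sup>2 + s\<^sup>2"
        using pq(2)[OF pq(1)]
        by (simp add: pq(3) c_def s_def power2_norm_eq_inner inner_add_left inner_add_right orthogonal_def inner_commute)
      have "x \<bullet> (W u *v x) = p \<bullet> (W u *v p) + 2 * (q \<bullet> (W u *v p)) + q \<bullet> (W u *v q)"
        using sym_mats_commute[OF W_sym, of p u q]
        by (simp add: pq(3) matrix_vector_right_distrib inner_add_left inner_add_right)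
      also have "p \<bullet> (W u *v p) \<le> a * c\<^sup>2"
        using span[OF pV] by (simp add: c_def power2_norm_eq_inner)
      also have "q \<bullet> (W u *v p) \<le> e * (s * c)"
        using pert[of q p] cross by (simp add: s_def c_def abs_le_iff)
      also have "q \<bullet> (W u *v q) \<le> (m + e) * s\<^sup>2"
        using pert[of q q] q by (simp add: s_def power2_norm_eq_inner[symmetric] power2_eq_square abs_le_iff algebra_simps)
      also have "(m + e) * s\<^sup>2 \<le> (a - g / 2) * s\<^sup>2"
        using a1 gap1 True by (intro mult_right_mono) auto
      finally have 1: "x \<bullet> (W u *v x) \<le> a * (c\<^sup>2 + s\<^sup>2) + (2 * e * s * c - g / 2 * s\<^sup>2)"
        by (simp add: algebra_simps)
      have "2 * e * s * c - g / 2 * s\<^sup>2 \<le> 2 * e\<^sup>2 / g * c\<^sup>2"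
      proof -
        \<comment> \<open>Complete the square in the length \<open>s\<close> of the component outside the top eigenvectors.\<close>
        have "0 \<le> (2 * e * c - g * s)\<^sup>2 / (2 * g)" using g(1) by simp
        also have "\<dots> = 2 * e\<^sup>2 / g * c\<^sup>2 - (2 * e * s * c - g / 2 * s\<^sup>2)"
          using g(1) by (simp add: field_simps power2_eq_square)
        finally show ?thesis by simp
      qed
      also have "\<dots> \<le> 8 * e\<^sup>2 / g * (c\<^sup>2 + s\<^sup>2)"
        using g(1) by (intro mult_mono divide_right_mono) auto
      finally show ?thesis using 1 by (simp add: xx algebra_simps)
    qed
  qed
  then have "\<alpha> * infeas u \<le> \<alpha> * (a + 8 * e\<^sup>2 / g)"
    using \<alpha>_pos by (intro mult_left_mono) auto
  then have "\<alpha> * infeas u \<le> \<alpha> * a + \<alpha> * (8 * e\<^sup>2 / g)"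
    by (simp only: distrib_left)
  moreover have "\<alpha> * a = Fm Xb V u + b \<bullet> u" using \<alpha>_pos by (simp add: a_def)
  ultimately show ?thesis
    by (simp add: F_eq e_def power_mult_distrib mult.assoc mult.left_commute)
qed

text \<open>
  Some solution is within \<open>\<delta>/3\<close>, and there some admissible \<open>r\<close> has a gap of at least \<open>\<delta>\<close>.  By Weyl's inequality
  each of the two eigenvalues moves by at most \<open>\<delta>/3\<close>, which leaves \<open>\<delta>/3\<close>.
\<close>

lemma gap_near_solutions:
  assumes rd: "1 \<le> dual_nullity C A b" "dual_nullity C A b < CARD('n)"
    and near: "infdist (slack C A yc) (slack C A ` Ystar) \<le> gap C A b / 3"
  obtains r where "1 \<le> r" "r \<le> dual_nullity C A b" "eigval (r + 1) (W yc) + gap C A b / 3 \<le> eigval r (W yc)"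
proof -
  let ?rd = "dual_nullity C A b"
  define G where "G = (\<lambda>y. Max ((\<lambda>r. eigval r (- slack C A y) - eigval (r + 1) (- slack C A y)) ` {1..?rd}))"
  have lin: "continuous_on Ystar (slack C A)"
    unfolding slack_def using linear_adj[OF A_lin]
    by (intro continuous_intros linear_continuous_on) (simp add: linear_conv_bounded_linear[symmetric])
  have "closed (slack C A ` Ystar)"
    by (intro compact_imp_closed compact_continuous_image lin Ystar_compact)
  then obtain Z where "Z \<in> slack C A ` Ystar"
    "infdist (slack C A yc) (slack C A ` Ystar) = dist (slack C A yc) Z"
    using infdist_attains_inf[of "slack C A ` Ystar"] Ystar_nonempty by blast
  then obtain ys where ys: "ys \<in> Ystar" "dist (slack C A yc) (slack C A ys) \<le> gap C A b / 3"
    using near by auto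
  have dist: "norm (W yc - W ys) \<le> gap C A b / 3"
    using ys(2) by (simp add: slack_eq dist_norm norm_minus_commute)
  have fin: "finite {1..?rd}" "{1..?rd} \<noteq> {}" using rd by auto
  \<comment> \<open>Nonnegativity makes the infimum over the solutions a genuine lower bound.\<close>
  have G0: "0 \<le> G y" for y
  proof -
    have "0 \<le> eigval 1 (W y) - eigval (1 + 1) (W y)"
      using eigval_antimono[OF W_sym, of 1 "1 + 1" y] rd by simp
    also have "\<dots> \<le> G y" unfolding G_def
      using fin rd by (intro Max_ge) (auto simp: slack_eq intro!: image_eqI[of _ _ 1])
    finally show ?thesis .
  qed
  have "gap C A b \<le> G ys"
    unfolding gap_def G_def[symmetric] by (rule cINF_lower[OF _ ys(1)]) (use G0 in \<open>auto intro!: bdd_belowI2\<close>)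
  moreover have "G ys \<in> (\<lambda>r. eigval r (- slack C A ys) - eigval (r + 1) (- slack C A ys)) ` {1..?rd}"
    unfolding G_def using fin by (intro Max_in) auto
  then obtain r where r: "r \<in> {1..?rd}" "G ys = eigval r (W ys) - eigval (r + 1) (W ys)"
    by (auto simp: slack_eq)
  have form: "x \<bullet> (W u *v x) \<le> x \<bullet> (W u' *v x) + gap C A b / 3 * (x \<bullet> x)"
    if "norm (W u - W u') \<le> gap C A b / 3" for u u' x
  proof -
    have "x \<bullet> (W u *v x) - x \<bullet> (W u' *v x) = x \<bullet> ((W u - W u') *v x)"
      by (simp add: matrix_vector_mult_diff_rdistrib inner_diff_right)
    also have "\<dots> \<le> norm (W u - W u') * (x \<bullet> x)"
      using abs_bilinear_le[of x "W u - W u'" x] by (simp add: power2_norm_eq_inner[symmetric] power2_eq_square mult.assoc abs_le_iff)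
    also have "\<dots> \<le> gap C A b / 3 * (x \<bullet> x)" using that by (intro mult_right_mono) auto
    finally show ?thesis by simp
  qed
  have "eigval (r + 1) (W yc) \<le> eigval (r + 1) (W ys) + gap C A b / 3"
    by (rule eigval_perturbation[OF W_sym W_sym]) (use r rd form[OF dist] in auto)
  moreover have "eigval r (W ys) \<le> eigval r (W yc) + gap C A b / 3"
    by (rule eigval_perturbation[OF W_sym W_sym]) (use r rd form[of ys yc] dist in \<open>auto simp: norm_minus_commute\<close>)
  ultimately show thesis using that[of r] r by auto
qed

end

section \<open>Geometric sequences\<close>

lemma linear_steps_converge:
  fixes x :: "nat \<Rightarrow> 'a::banach"
  assumes q: "0 < q" "q < 1" and step: "\<And>k. norm (x (Suc k) - x k) \<le> a * q ^ k"
  obtains l where "\<And>k. norm (x k - l) \<le> a / (1 - q) * q ^ k"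
proof -
  have a: "0 \<le> a" using order_trans[OF norm_ge_zero step[of 0]] by simp
  have tail: "norm (x (k + j) - x k) \<le> a / (1 - q) * q ^ k * (1 - q ^ j)" for k j
  proof (induction j)
    case (Suc j)
    have "norm (x (k + Suc j) - x k) \<le> norm (x (Suc (k + j)) - x (k + j)) + norm (x (k + j) - x k)"
      using norm_triangle_ineq[of "x (Suc (k + j)) - x (k + j)" "x (k + j) - x k"] by simp
    also have "\<dots> \<le> a * q ^ (k + j) + a / (1 - q) * q ^ k * (1 - q ^ j)"
      using step[of "k + j"] Suc by (rule add_mono)
    also have "\<dots> = a / (1 - q) * q ^ k * (1 - q ^ Suc j)"
      using q by (simp add: field_simps power_add)
    finally show ?case .
  qed simp
  have bound: "norm (x (k + j) - x k) \<le> a / (1 - q) * q ^ k" for k j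
  proof -
    have "a / (1 - q) * q ^ k * (1 - q ^ j) \<le> a / (1 - q) * q ^ k * 1"
      using a q by (intro mult_left_mono) auto
    then show ?thesis using tail[of k j] by simp
  qed
  have lim0: "(\<lambda>k. a / (1 - q) * q ^ k) \<longlonglongrightarrow> 0"
    using tendsto_mult_right_zero[OF LIMSEQ_realpow_zero, of q] q by simp
  have "Cauchy x"
  proof (rule metric_CauchyI)
    fix e :: real assume "0 < e"
    then have "eventually (\<lambda>k. a / (1 - q) * q ^ k < e / 2) sequentially"
      by (intro order_tendstoD(2)[OF lim0]) simp
    then obtain N where N: "a / (1 - q) * q ^ N < e / 2" by (auto simp: eventually_sequentially)
    show "\<exists>M. \<forall>m\<ge>M. \<forall>n\<ge>M. dist (x m) (x n) < e"
    proof (intro exI allI impI)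
      fix m n assume "N \<le> m" "N \<le> n"
      then have "norm (x m - x N) \<le> a / (1 - q) * q ^ N" "norm (x n - x N) \<le> a / (1 - q) * q ^ N"
        using bound[of N "m - N"] bound[of N "n - N"] by auto
      then have "dist (x m) (x N) < e / 2" "dist (x n) (x N) < e / 2"
        using N unfolding dist_norm by linarith+
      then show "dist (x m) (x n) < e" by (rule dist_triangle_half_l)
    qed
  qed
  then obtain l where l: "x \<longlonglongrightarrow> l" using Cauchy_convergent_iff convergent_def by blast
  have "norm (x k - l) \<le> a / (1 - q) * q ^ k" for k
  proof (rule Lim_bounded)
    show "(\<lambda>j. norm (x k - x (k + j))) \<longlonglongrightarrow> norm (x k - l)"
      using LIMSEQ_ignore_initial_segment[OF l, of k] by (intro tendsto_intros) (simp add: add.commute)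
    show "\<forall>j\<ge>0. norm (x k - x (k + j)) \<le> a / (1 - q) * q ^ k"
      using bound by (simp add: norm_minus_commute)
  qed
  then show thesis by (rule that)
qed

lemma geometric_iteration_count:
  fixes q H :: real
  assumes "0 < q" "q < 1"
  obtains K where "\<And>\<epsilon>. 0 < \<epsilon> \<Longrightarrow> \<epsilon> < 1/2 \<Longrightarrow> \<exists>k::nat. real k \<le> K * ln (1 / \<epsilon>) \<and> H * q ^ k \<le> \<epsilon>"
proof -
  define h where "h = max H 1"
  have h: "1 \<le> h" "H \<le> h" by (auto simp: h_def)
  define r where "r = ln (1 / q)"
  have r: "0 < r" using assms by (simp add: r_def)
  \<comment> \<open>Since \<open>ln (1 / \<epsilon>) \<ge> ln 2\<close>, constants can be absorbed into a multiple of \<open>ln (1 / \<epsilon>)\<close>; \<open>1 / ln 2\<close> pays for rounding up.\<close>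
  define K where "K = (ln h / ln 2 + 1) / r + 1 / ln 2"
  have "\<exists>k::nat. real k \<le> K * ln (1 / \<epsilon>) \<and> H * q ^ k \<le> \<epsilon>" if \<epsilon>: "0 < \<epsilon>" "\<epsilon> < 1/2" for \<epsilon>
  proof -
    define M where "M = ln (1 / \<epsilon>)"
    have M: "ln 2 \<le> M" unfolding M_def using \<epsilon> by (subst ln_le_cancel_iff) (auto simp: field_simps)
    have M0: "0 < M" using M ln_gt_zero[of 2] by linarith
    define k where "k = nat \<lceil>(ln h + M) / r\<rceil>"
    have nn: "0 \<le> (ln h + M) / r" using h r M0 by simp
    have "real k = of_int \<lceil>(ln h + M) / r\<rceil>" using nn by (simp add: k_def)
    then have k: "(ln h + M) / r \<le> real k" "real k \<le> (ln h + M) / r + 1" by linarith+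
    have "ln h * ln 2 \<le> ln h * M" using h M by (intro mult_left_mono) auto
    then have "ln h \<le> ln h / ln 2 * M" by (simp add: field_simps)
    moreover have "1 \<le> 1 / ln 2 * M" using M by (simp add: field_simps)
    ultimately have "(ln h + M) / r + 1 \<le> (ln h / ln 2 * M + M) / r + 1 / ln 2 * M"
      using r by (intro add_mono divide_right_mono) auto
    also have "\<dots> = K * M" by (simp add: K_def algebra_simps add_divide_distrib)
    finally have "real k \<le> K * ln (1 / \<epsilon>)" using k by (simp add: M_def)
    moreover have "H * q ^ k \<le> \<epsilon>"
    proof -
      have "ln h + M \<le> real k * r" using k(1) r by (simp add: pos_divide_le_eq)
      then have "ln (h * q ^ k) \<le> ln \<epsilon>"
        using h assms \<epsilon> by (simp add: ln_mult ln_realpow M_def r_def ln_div)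
      then have "h * q ^ k \<le> \<epsilon>" using h assms \<epsilon> by (subst (asm) ln_le_cancel_iff) auto
      moreover have "H * q ^ k \<le> h * q ^ k" using h assms by (intro mult_right_mono) auto
      ultimately show ?thesis by simp
    qed
    ultimately show ?thesis by blast
  qed
  then show thesis by (rule that)
qed

section \<open>Runs of the method\<close>

lemma eigen_split_nonneg:
  assumes "psd S" "eigen_split rp S Q l I" shows "0 \<le> l $ i"
proof -
  have on: "column j Q \<bullet> column i Q = (if j = i then 1 else 0)" for j
    using assms(2) unfolding eigen_split_def orthogonal_matrix_orthonormal_columns
    by (auto simp: norm_eq_1 orthogonal_def)
  have "S *v column i Q = (\<Sum>j\<in>UNIV. l $ j *\<^sub>R outer (column j Q) (column j Q)) *v column i Q"
    using assms(2) by (simp add: eigen_split_def)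
  also have "\<dots> = (\<Sum>j\<in>UNIV. if j = i then l $ i *\<^sub>R column i Q else 0)"
    unfolding sum_matrix_vector_mult by (intro sum.cong) (auto simp: scaleR_matrix_vector_assoc[symmetric] outer_mult_vec on)
  finally have "S *v column i Q = l $ i *\<^sub>R column i Q" by simp
  then show ?thesis using psd_nonneg[OF assms(1), of "column i Q"] on[of i] by simp
qed

text \<open>
  The bound \<open>\<rho>_large\<close> is what makes the error term \<open>8 \<alpha> \<parallel>\<A>\<^sup>*\<parallel>\<^sup>2 / (\<delta>/3)\<close> of the model at most \<open>\<rho>/2\<close>.
\<close>

locale specbm = sdp_pair C A b \<alpha>
  for C :: "real^'n^'n" and A :: "real^'n^'n \<Rightarrow> real^'m" and b and \<alpha> +
  fixes rp rc :: nat and \<rho> \<beta> :: real and y0 :: "real^'m" and V0 :: "real^'r^'n"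
    and Xb :: "nat \<Rightarrow> real^'n^'n" and V :: "nat \<Rightarrow> real^'r^'n" and z y :: "nat \<Rightarrow> real^'m"
    and w :: "nat \<Rightarrow> real \<times> (real^'r^'r)" and X :: "nat \<Rightarrow> real^'n^'n"
  assumes nullity: "1 \<le> dual_nullity C A b" "dual_nullity C A b < CARD('n)"
    and gap_pos: "0 < gap C A b"
    and rc: "dual_nullity C A b \<le> rc"
    and \<beta>: "0 < \<beta>" "\<beta> \<le> 1/2"
    and \<rho>: "0 < \<rho>"
    and \<rho>_large: "48 * \<alpha> * (onorm (adj A))\<^sup>2 / gap C A b \<le> \<rho>"
    and V0: "orthonormal_columns V0"
    and run: "specbm_run C A b rp rc \<rho> \<beta> \<alpha> y0 V0 Xb V z y w X"
begin

abbreviation \<Phi> where "\<Phi> t \<equiv> Fm (Xb t) (V t)"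

abbreviation descent where "descent t \<equiv> descent_step C A b \<beta> \<alpha> Xb V z y t"

abbreviation near where "near u \<equiv> infdist (slack C A u) (slack C A ` Ystar) \<le> gap C A b / 3"

definition predicted_decrease where "predicted_decrease t = F (y t) - \<Phi> t (z (Suc t))"

definition Lip where "Lip = norm b + \<alpha> * onorm (adj A)"

lemma subproblem: "subproblem_solution C A b \<rho> \<alpha> (Xb t) (V t) (y t) (z (Suc t)) (w t)"
  and X_eq: "X t = model_mat (Xb t) (V t) (w t)"
  and y_Suc: "y (Suc t) = (if descent t then z (Suc t) else y t)"
  and update: "bundle_update rp rc (W (z (Suc t))) (Xb t) (V t) (w t) (Xb (Suc t)) (V (Suc t))"
  using run by (auto simp: specbm_run_def descent_step_def W_def)

lemma w_in: "w t \<in> model_set \<alpha> (Xb t)"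
  using subproblem[of t] by (simp add: subproblem_solution_def saddle_point_def)

lemma update_psd:
  assumes "psd (Xb t)" shows "psd (Xb (Suc t))"
proof -
  obtain Q l I where *: "eigen_split rp (snd (w t)) Q l I"
    "Xb (Suc t) = fst (w t) *\<^sub>R Xb t
       + V t ** (\<Sum>i\<in>-I. l $ i *\<^sub>R outer (column i Q) (column i Q)) ** transpose (V t)"
    using update[of t] by (auto simp: bundle_update_def)
  have w: "0 \<le> fst (w t)" "psd (snd (w t))" using w_in[of t] by (auto simp: model_set_def)
  show ?thesis
    unfolding *(2) using assms w eigen_split_nonneg[OF w(2) *(1)]
    by (intro psd_add psd_scale psd_conj psd_sum psd_outer) auto
qed

lemma bundle_invariant: "psd (Xb t)" "orthonormal_columns (V t)"
proof -
  show "psd (Xb t)"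
    using run update_psd by (induction t) (auto simp: specbm_run_def psd_zero)
  show "orthonormal_columns (V t)"
    using run V0 update by (cases t) (auto simp: specbm_run_def bundle_update_def)
qed

lemmas step = proximal_step[OF bundle_invariant \<rho> subproblem, folded X_eq]

text \<open>
  The primal iterate stays representable in the next model: its part outside the kept eigenvectors
  is the new aggregate matrix, and the kept eigenvectors lie in the span of the new basis.  So the
  next model still dominates the minorant that the current step minimized.
\<close>

lemma aggregate_minorant: "(- b) \<bullet> u + X t \<bullet> W u \<le> \<Phi> (Suc t) u"
proof -
  obtain Q l I v where *: "eigen_split rp (snd (w t)) Q l I"
    "Xb (Suc t) = fst (w t) *\<^sub>R Xb t
       + V t ** (\<Sum>i\<in>-I. l $ i *\<^sub>R outer (column i Q) (column i Q)) ** transpose (V t)"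
    "v ` {1..rc} \<union> (\<lambda>i. column i (V t ** Q)) ` I \<subseteq> span (columns (V (Suc t)))"
    using update[of t] by (auto simp: bundle_update_def)
  have w: "psd (snd (w t))" using w_in[of t] by (auto simp: model_set_def)
  have S: "snd (w t) = (\<Sum>i\<in>I. l $ i *\<^sub>R outer (column i Q) (column i Q))
     + (\<Sum>i\<in>-I. l $ i *\<^sub>R outer (column i Q) (column i Q))"
    using *(1) sum.union_disjoint[of I "-I" "\<lambda>i. l $ i *\<^sub>R outer (column i Q) (column i Q)"]
    by (simp add: eigen_split_def)
  have col: "column i (V t ** Q) = V t *v column i Q" for i
    by (simp add: matrix_vector_mult_basis[symmetric] matrix_vector_mul_assoc)
  have "\<forall>i\<in>I. \<exists>s. V t *v column i Q = V (Suc t) *v s"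
    using *(3) col by (auto simp: span_columns_range)
  then obtain s where s: "\<And>i. i \<in> I \<Longrightarrow> V t *v column i Q = V (Suc t) *v s i" by metis
  define S' where "S' = (\<Sum>i\<in>I. l $ i *\<^sub>R outer (s i) (s i))"
  have "V (Suc t) ** S' ** transpose (V (Suc t))
      = V t ** (\<Sum>i\<in>I. l $ i *\<^sub>R outer (column i Q) (column i Q)) ** transpose (V t)"
    unfolding S'_def conj_sum by (intro sum.cong) (auto simp: conj_scaled_outer s)
  moreover have "V t ** snd (w t) ** transpose (V t)
      = V t ** (\<Sum>i\<in>I. l $ i *\<^sub>R outer (column i Q) (column i Q)) ** transpose (V t)
      + V t ** (\<Sum>i\<in>-I. l $ i *\<^sub>R outer (column i Q) (column i Q)) ** transpose (V t)"
    unfolding S by (rule conj_add)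
  ultimately have X: "model_mat (Xb (Suc t)) (V (Suc t)) (1, S') = X t"
    by (simp add: model_mat_def X_eq *(2))
  have "trace (X t) = trace (Xb (Suc t)) + trace S'"
    unfolding X[symmetric] by (simp add: model_mat_def trace_add trace_conj[OF bundle_invariant(2)])
  then have "(1, S') \<in> model_set \<alpha> (Xb (Suc t))"
    using step(2)[of t] eigen_split_nonneg[OF w *(1)]
    by (auto simp: model_set_def S'_def intro!: psd_sum psd_scale psd_outer)
  from model_term_le_model[OF bundle_invariant(1) bundle_invariant(2)[of "Suc t"] this, of u] show ?thesis
    by (simp add: model_term_eq X)
qed

lemma new_eigenvectors:
  obtains v where "top_eigenvectors rc (W (z (Suc t))) v" "v ` {1..rc} \<subseteq> span (columns (V (Suc t)))"
  using update[of t] by (auto simp: bundle_update_def)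

lemma linearization_minorant: "F (z (Suc t)) - Lip * norm (u - z (Suc t)) \<le> \<Phi> (Suc t) u"
proof -
  obtain v where v: "top_eigenvectors rc (W (z (Suc t))) v" "v ` {1..rc} \<subseteq> span (columns (V (Suc t)))"
    by (rule new_eigenvectors)
  have "1 \<in> {1..rc}" using nullity rc by simp
  then have "v 1 \<in> span (columns (V (Suc t)))" "v 1 \<bullet> v 1 = 1"
    "W (z (Suc t)) *v v 1 = eigval_max (W (z (Suc t))) *\<^sub>R v 1"
    using v unfolding top_eigenvectors_def eigval_max_def by (blast, metis, blast)
  then show ?thesis
    using model_ge_linearization[OF bundle_invariant] by (simp add: Lip_def norm_eq_1)
qed

lemma three_points:
  "\<Phi> t (z (Suc t)) + \<rho> / 2 * (norm (z (Suc t) - y t))\<^sup>2 + \<rho> / 2 * (norm (u - z (Suc t)))\<^sup>2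
     \<le> F u + \<rho> / 2 * (norm (u - y t))\<^sup>2"
  using step(4)[where t = t and u = u] step(6)[where t = t and u = u] model_le_F[OF bundle_invariant(1)[of t] bundle_invariant(2)[of t], of u] by simp

lemma predicted_decrease_ge: "\<rho> * (norm (z (Suc t) - y t))\<^sup>2 \<le> predicted_decrease t"
  using three_points[of t "y t"] by (simp add: predicted_decrease_def norm_minus_commute)

lemma predicted_decrease_nonneg: "0 \<le> predicted_decrease t"
  using predicted_decrease_ge[of t] \<rho> by (meson less_imp_le mult_nonneg_nonneg order_trans zero_le_power2)

lemma descent_iff: "descent t \<longleftrightarrow> \<beta> * predicted_decrease t \<le> F (y t) - F (z (Suc t))"
  by (simp add: descent_step_def descent_test_def predicted_decrease_def)

lemma F_decreasing_Suc: "F (y (Suc t)) \<le> F (y t)"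
proof -
  have "0 \<le> \<beta> * predicted_decrease t" using predicted_decrease_nonneg \<beta> by simp
  then show ?thesis using descent_iff[of t] by (simp add: y_Suc)
qed

lemma F_decreasing: "s \<le> t \<Longrightarrow> F (y t) \<le> F (y s)"
  by (induction t rule: dec_induct) (auto intro: order_trans[OF F_decreasing_Suc])

section \<open>Convergence of the function values\<close>

text \<open>
  Move from the centre towards a solution by a fraction \<open>s\<close>: convexity gains \<open>s \<eta>\<close>, the proximal
  term costs only \<open>\<rho> s\<^sup>2 D\<^sup>2 / 2\<close>.
\<close>

lemma predicted_decrease_lower_bound:
  assumes "ys \<in> Ystar" "0 < \<eta>" "0 \<le> D"
  obtains c where "0 < c" "\<And>t. norm (ys - y t) \<le> D \<Longrightarrow> \<eta> \<le> F (y t) - opt \<Longrightarrow> c \<le> predicted_decrease t"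
proof -
  \<comment> \<open>Small enough that the cost is at most half of the gain; the summand 1 covers \<open>D = 0\<close>.\<close>
  define s where "s = min 1 (\<eta> / (\<rho> * D\<^sup>2 + 1))"
  have pos: "0 < \<rho> * D\<^sup>2 + 1" using \<rho> by (simp add: add_nonneg_pos)
  have s: "0 < s" "s \<le> 1" using assms pos by (auto simp: s_def)
  have "s \<le> \<eta> / (\<rho> * D\<^sup>2 + 1)" by (simp add: s_def)
  then have "s * (\<rho> * D\<^sup>2 + 1) \<le> \<eta>" using pos by (simp only: pos_le_divide_eq)
  then have s2: "s * (\<rho> * D\<^sup>2) \<le> \<eta>" using s by (simp add: algebra_simps)
  have "s * \<eta> / 2 \<le> predicted_decrease t" if "norm (ys - y t) \<le> D" "\<eta> \<le> F (y t) - opt" for t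
  proof -
    define u where "u = (1 - s) *\<^sub>R y t + s *\<^sub>R ys"
    have "u - y t = s *\<^sub>R (ys - y t)" by (simp add: u_def algebra_simps)
    then have "(norm (u - y t))\<^sup>2 = s\<^sup>2 * (norm (ys - y t))\<^sup>2" by (simp add: power_mult_distrib)
    also have "\<dots> \<le> s\<^sup>2 * D\<^sup>2" using that(1) by (intro mult_left_mono power_mono) auto
    finally have "\<rho> / 2 * (norm (u - y t))\<^sup>2 \<le> \<rho> / 2 * (s\<^sup>2 * D\<^sup>2)" using \<rho> by (intro mult_left_mono) auto
    also have "\<dots> = s / 2 * (s * (\<rho> * D\<^sup>2))" by (simp add: power2_eq_square)
    also have "\<dots> \<le> s / 2 * \<eta>" using s s2 by (intro mult_left_mono) auto
    finally have 1: "\<rho> / 2 * (norm (u - y t))\<^sup>2 \<le> s / 2 * \<eta>" .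
    have 2: "F u \<le> (1 - s) * F (y t) + s * opt"
      using F_convex[of s "y t" ys] s F_dual_sols[OF assms(1)] by (simp add: u_def)
    have "\<Phi> t (z (Suc t)) \<le> F u + \<rho> / 2 * (norm (u - y t))\<^sup>2"
      using three_points[of t u] \<rho>
      by (smt (verit, best) divide_nonneg_pos mult_nonneg_nonneg zero_le_power2)
    moreover have "s * \<eta> \<le> s * (F (y t) - opt)" using s that(2) by (intro mult_left_mono) auto
    ultimately show ?thesis using 1 2 by (simp add: predicted_decrease_def algebra_simps)
  qed
  moreover have "0 < s * \<eta> / 2" using s assms by simp
  ultimately show thesis using that by blast
qed

text \<open>
  Every descent step may increase the squared distance to a solution only by a multiple of
  the decrease of \<open>F\<close> that it achieves, and these decreases add up.
\<close>

lemma iterates_bounded: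
  assumes ys: "ys \<in> Ystar"
  shows "(norm (ys - y t))\<^sup>2 \<le> (norm (ys - y 0))\<^sup>2 + 2 / (\<rho> * \<beta>) * (F (y 0) - F (y t))"
proof (induction t)
  case (Suc t)
  show ?case
  proof (cases "descent t")
    case False
    then show ?thesis using Suc by (simp add: y_Suc)
  next
    case True
    have "\<rho> / 2 * (norm (ys - z (Suc t)))\<^sup>2 \<le> \<rho> / 2 * (norm (ys - y t))\<^sup>2 + (opt - \<Phi> t (z (Suc t)))"
      using three_points[of t ys] \<rho> F_dual_sols[OF ys]
      by (smt (verit, best) divide_nonneg_pos mult_nonneg_nonneg zero_le_power2)
    also have "opt - \<Phi> t (z (Suc t)) \<le> predicted_decrease t" using F_ge_opt by (simp add: predicted_decrease_def)
    also have "predicted_decrease t \<le> (F (y t) - F (z (Suc t))) / \<beta>"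
      using True \<beta> by (simp add: descent_iff field_simps)
    finally have "(norm (ys - z (Suc t)))\<^sup>2 \<le> (norm (ys - y t))\<^sup>2 + 2 / (\<rho> * \<beta>) * (F (y t) - F (z (Suc t)))"
      using \<rho> \<beta> by (simp add: field_simps)
    moreover have "y (Suc t) = z (Suc t)" using True by (simp add: y_Suc)
    ultimately show ?thesis using Suc by (simp add: algebra_simps)
  qed
qed simp

lemma iterates_bounded_uniformly:
  assumes ys: "ys \<in> Ystar"
  obtains D where "0 \<le> D" "\<And>t. norm (ys - y t) \<le> D"
proof -
  define D where "D = sqrt ((norm (ys - y 0))\<^sup>2 + 2 / (\<rho> * \<beta>) * (F (y 0) - opt))"
  have "norm (ys - y t) \<le> D" for t
  proof -
    have "2 / (\<rho> * \<beta>) * (F (y 0) - F (y t)) \<le> 2 / (\<rho> * \<beta>) * (F (y 0) - opt)"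
      using \<rho> \<beta> F_ge_opt by (intro mult_left_mono) auto
    then show ?thesis using iterates_bounded[OF ys, of t] unfolding D_def by (intro real_le_rsqrt) simp
  qed
  moreover have "0 \<le> D" using calculation[of 0] norm_ge_zero[of "ys - y 0"] by linarith
  ultimately show thesis using that by blast
qed

text \<open>
  If the values stayed away from \<open>opt\<close>, each of the infinitely many descent steps would decrease
  \<open>F\<close> by a fixed amount.
\<close>

lemma values_converge:
  assumes inf: "infinite {t. descent t}" and \<eta>: "0 < \<eta>"
  obtains N where "\<And>t. N \<le> t \<Longrightarrow> F (y t) - opt < \<eta>"
proof (rule ccontr)
  assume "\<not> thesis"
  have large: "\<eta> \<le> F (y t) - opt" for t
  proof (rule ccontr)
    assume small: "\<not> \<eta> \<le> F (y t) - opt"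
    have "F (y s) - opt < \<eta>" if "t \<le> s" for s using F_decreasing[OF that] small by simp
    with \<open>\<not> thesis\<close> show False using that by blast
  qed
  obtain ys where ys: "ys \<in> Ystar" using Ystar_nonempty by auto
  obtain D where D: "0 \<le> D" "\<And>t. norm (ys - y t) \<le> D" by (rule iterates_bounded_uniformly[OF ys]) (rule that)
  obtain c where c: "0 < c" "\<And>t. norm (ys - y t) \<le> D \<Longrightarrow> \<eta> \<le> F (y t) - opt \<Longrightarrow> c \<le> predicted_decrease t"
    by (rule predicted_decrease_lower_bound[OF ys \<eta> D(1)]) (rule that)
  have dec: "c \<le> predicted_decrease t" for t using c(2) D(2) large by blast
  have sum: "F (y t) \<le> F (y 0) - \<beta> * c * real (card {s. s < t \<and> descent s})" for t
  proof (induction t)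
    case (Suc t)
    show ?case
    proof (cases "descent t")
      case True
      have "{s. s < Suc t \<and> descent s} = insert t {s. s < t \<and> descent s}" using True by (auto simp: less_Suc_eq)
      then have "card {s. s < Suc t \<and> descent s} = Suc (card {s. s < t \<and> descent s})" by simp
      moreover have "\<beta> * c \<le> \<beta> * predicted_decrease t" using dec \<beta> by (intro mult_left_mono) auto
      ultimately show ?thesis using Suc True by (simp add: y_Suc descent_iff algebra_simps)
    next
      case False
      then have "{s. s < Suc t \<and> descent s} = {s. s < t \<and> descent s}" by (auto simp: less_Suc_eq)
      then show ?thesis using Suc False by (simp add: y_Suc)
    qed
  qed simp
  obtain m :: nat where m: "F (y 0) - opt < real m * (\<beta> * c)"
    using reals_Archimedean3[of "\<beta> * c"] \<beta> c(1) by auto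
  obtain J where J: "J \<subseteq> {t. descent t}" "finite J" "card J = m"
    using infinite_arbitrarily_large[OF inf] by blast
  define t where "t = Suc (Max (insert 0 J))"
  have sub: "J \<subseteq> {s. s < t \<and> descent s}" using J Max_ge[of "insert 0 J"] by (auto simp: t_def less_Suc_eq_le intro: Max_ge)
  then have "m \<le> card {s. s < t \<and> descent s}" using card_mono[OF _ sub] J(3) by simp
  then have "real m * (\<beta> * c) \<le> real (card {s. s < t \<and> descent s}) * (\<beta> * c)"
    using \<beta> c(1) by (intro mult_right_mono) auto
  then show False using sum[of t] F_ge_opt[of "y t"] m by (simp add: algebra_simps)
qed

lemma slack_infdist: "infdist (slack C A u) (slack C A ` Ystar) \<le> onorm (adj A) * infdist u Ystar"
proof -
  obtain p where p: "p \<in> Ystar" "infdist u Ystar = dist u p"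
    using infdist_attains_inf[OF compact_imp_closed[OF Ystar_compact] Ystar_nonempty] by blast
  have "infdist (slack C A u) (slack C A ` Ystar) \<le> dist (slack C A u) (slack C A p)"
    using p(1) by (intro infdist_le) auto
  also have "\<dots> \<le> onorm (adj A) * norm (u - p)"
    using W_lipschitz[of u p] by (simp add: slack_eq dist_norm norm_minus_commute)
  finally show ?thesis by (simp add: p(2) dist_norm)
qed

lemma eventually_near:
  assumes "infinite {t. descent t}"
  obtains N where "\<And>t. N \<le> t \<Longrightarrow> near (y t)"
proof -
  obtain ys where ys: "ys \<in> Ystar" using Ystar_nonempty by auto
  obtain D where D: "0 \<le> D" "\<And>t. norm (ys - y t) \<le> D" by (rule iterates_bounded_uniformly[OF ys]) (rule that)
  have "norm (y t) \<le> norm ys + D" for t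
    using D(2)[of t] norm_triangle_ineq4[of ys "ys - y t"] by simp
  moreover obtain \<kappa> where \<kappa>: "0 < \<kappa>" "\<And>u. norm u \<le> norm ys + D \<Longrightarrow> infdist u Ystar \<le> \<kappa> * sqrt (F u - opt)"
    by (rule quadratic_growth[of "norm ys + D"]) (use D in auto)
  ultimately have growth: "infdist (y t) Ystar \<le> \<kappa> * sqrt (F (y t) - opt)" for t by blast
  define L where "L = onorm (adj A) + 1"
  have L: "0 < L" using onorm_nonneg by (simp add: L_def)
  define \<theta> where "\<theta> = gap C A b / (3 * L * \<kappa>)"
  have \<theta>: "0 < \<theta>" using gap_pos L \<kappa> by (simp add: \<theta>_def)
  obtain N where N: "\<And>t. N \<le> t \<Longrightarrow> F (y t) - opt < \<theta>\<^sup>2"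
    by (rule values_converge[OF assms, of "\<theta>\<^sup>2"]) (use \<theta> in auto)
  have "near (y t)" if "N \<le> t" for t
  proof -
    have "sqrt (F (y t) - opt) \<le> \<theta>"
      using N[OF that] \<theta> by (intro real_le_lsqrt) (auto simp: F_ge_opt)
    then have "infdist (y t) Ystar \<le> \<kappa> * \<theta>"
      using growth[of t] mult_left_mono[of _ \<theta> \<kappa>] \<kappa> by (meson less_imp_le order_trans)
    then have "L * infdist (y t) Ystar \<le> L * (\<kappa> * \<theta>)" using L by (intro mult_left_mono) auto
    also have "\<dots> = gap C A b / 3" using L \<kappa> by (simp add: \<theta>_def)
    finally show ?thesis
      using slack_infdist[of "y t"] mult_right_mono[of "onorm (adj A)" L "infdist (y t) Ystar"] infdist_nonneg[of "y t" Ystar]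
      by (simp add: L_def)
  qed
  then show thesis by (rule that)
qed

text \<open>
  With a fixed centre the optimal values \<open>M t\<close> of the subproblems increase at least by
  \<open>\<rho>/2\<close> times the squared distance of consecutive trial points and stay below \<open>F\<close> at the centre, so
  consecutive trial points come arbitrarily close.  The next model supports \<open>F\<close> at the previous trial point, hence it
  is nearly exact at the new one, and the descent test succeeds unless the predicted decrease is tiny as well, which
  \<open>predicted_decrease_lower_bound\<close> excludes at a centre that is not optimal.
\<close>

lemma null_steps_optimal:
  assumes null: "\<And>t. T \<le> t \<Longrightarrow> \<not> descent t"
  shows "y T \<in> Ystar"
proof (rule ccontr)
  assume "y T \<notin> Ystar"
  then have \<eta>: "0 < F (y T) - opt" using F_eq_opt_iff[of "y T"] F_ge_opt[of "y T"] by simp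
  have const: "y t = y T" if "T \<le> t" for t
    using that by (induction t rule: dec_induct) (auto simp: y_Suc null)
  obtain ys where ys: "ys \<in> Ystar" using Ystar_nonempty by auto
  obtain c where c: "0 < c" "\<And>t. norm (ys - y t) \<le> norm (ys - y T) \<Longrightarrow> F (y T) - opt \<le> F (y t) - opt \<Longrightarrow> c \<le> predicted_decrease t"
    by (rule predicted_decrease_lower_bound[OF ys \<eta> norm_ge_zero]) (rule that)
  have dec: "c \<le> predicted_decrease t" if "T \<le> t" for t using c(2)[of t] const[OF that] by simp
  define M where "M = (\<lambda>t. \<Phi> t (z (Suc t)) + \<rho> / 2 * (norm (z (Suc t) - y T))\<^sup>2)"
  have grow: "M t + \<rho> / 2 * (norm (z (Suc (Suc t)) - z (Suc t)))\<^sup>2 \<le> M (Suc t)" if "T \<le> t" for t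
    using step(6)[where t = t and u = "z (Suc (Suc t))"] aggregate_minorant[of "z (Suc (Suc t))" t] const[OF that]
    by (simp add: M_def)
  have bounded: "M t \<le> F (y T)" if "T \<le> t" for t
  proof -
    have "0 \<le> \<rho> / 2 * (norm (y T - z (Suc t)))\<^sup>2" using \<rho> by simp
    then show ?thesis using three_points[of t "y T"] const[OF that] by (simp add: M_def)
  qed
  have Lip: "0 \<le> Lip" using \<alpha>_pos onorm_nonneg by (simp add: Lip_def)
  \<comment> \<open>Chosen so that a model error of \<open>2 Lip e\<close> is at most \<open>c / 2 \<le> (1 - \<beta>) c\<close>.\<close>
  define e where "e = c / (4 * (Lip + 1))"
  have e: "0 < e" using c Lip by (simp add: e_def)
  have "\<exists>t\<ge>T. norm (z (Suc (Suc t)) - z (Suc t)) < e"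
  proof (rule ccontr)
    assume "\<not> ?thesis"
    then have big: "e \<le> norm (z (Suc (Suc t)) - z (Suc t))" if "T \<le> t" for t using that by auto
    have lin: "M T + real k * (\<rho> / 2 * e\<^sup>2) \<le> M (T + k)" for k
    proof (induction k)
      case (Suc k)
      have "\<rho> / 2 * e\<^sup>2 \<le> \<rho> / 2 * (norm (z (Suc (Suc (T + k))) - z (Suc (T + k))))\<^sup>2"
        using big[of "T + k"] e \<rho> by (intro mult_left_mono power_mono) auto
      then show ?case using Suc grow[of "T + k"] by (simp add: algebra_simps add_divide_distrib)
    qed simp
    have "0 < \<rho> / 2 * e\<^sup>2" using \<rho> e by simp
    from reals_Archimedean3[OF this] obtain k where "F (y T) - M T < real k * (\<rho> / 2 * e\<^sup>2)" by blast
    then show False using lin[of k] bounded[of "T + k"] by simp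
  qed
  then obtain t where t: "T \<le> t" "norm (z (Suc (Suc t)) - z (Suc t)) < e" by blast
  let ?u = "z (Suc (Suc t))"
  have "F ?u - \<Phi> (Suc t) ?u \<le> 2 * Lip * norm (?u - z (Suc t))"
    using linearization_minorant[of t ?u] F_lipschitz[of ?u "z (Suc t)"] by (simp add: Lip_def algebra_simps)
  also have "\<dots> \<le> 2 * (Lip + 1) * e" using t(2) Lip e by (intro mult_mono) auto
  also have "\<dots> = c / 2" using Lip by (simp add: e_def field_simps)
  also have "\<dots> \<le> (1 - \<beta>) * c" using \<beta> c(1) mult_right_mono[of "1/2" "1 - \<beta>" c] by simp
  also have "\<dots> \<le> (1 - \<beta>) * predicted_decrease (Suc t)" using \<beta> dec[of "Suc t"] t(1) by (intro mult_left_mono) auto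
  finally have "\<beta> * predicted_decrease (Suc t) \<le> F (y (Suc t)) - F ?u"
    by (simp add: predicted_decrease_def algebra_simps)
  then show False using null[of "Suc t"] t(1) by (simp add: descent_iff)
qed

section \<open>Persistence of descent steps\<close>

text \<open>
  After a descent step the centre is the last trial point, whose top eigenvectors the basis contains.
\<close>

lemma model_accurate_after_descent:
  assumes "descent t" "near (y (Suc t))"
  shows "F u \<le> \<Phi> (Suc t) u + \<rho> / 2 * (norm (u - y (Suc t)))\<^sup>2"
proof -
  let ?g = "gap C A b / 3"
  obtain r where r: "1 \<le> r" "r \<le> dual_nullity C A b"
    "eigval (r + 1) (W (y (Suc t))) + ?g \<le> eigval r (W (y (Suc t)))"
    by (rule gap_near_solutions[OF nullity assms(2)]) (rule that)
  obtain v where v: "top_eigenvectors rc (W (z (Suc t))) v" "v ` {1..rc} \<subseteq> span (columns (V (Suc t)))"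
    by (rule new_eigenvectors)
  have yz: "y (Suc t) = z (Suc t)" using assms(1) by (simp add: y_Suc)
  have "F u \<le> \<Phi> (Suc t) u + 8 * \<alpha> * (onorm (adj A))\<^sup>2 / ?g * (norm (u - y (Suc t)))\<^sup>2"
    by (rule quadratic_model_accuracy[OF bundle_invariant _ v(2) r(1)])
       (use v r rc nullity gap_pos in \<open>auto simp: yz\<close>)
  also have "8 * \<alpha> * (onorm (adj A))\<^sup>2 / ?g = (48 * \<alpha> * (onorm (adj A))\<^sup>2 / gap C A b) / 2"
    by simp
  also have "\<dots> * (norm (u - y (Suc t)))\<^sup>2 \<le> \<rho> / 2 * (norm (u - y (Suc t)))\<^sup>2"
    using \<rho>_large by (intro mult_right_mono divide_right_mono) auto
  finally show ?thesis by simp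
qed

text \<open>
  The model error at the trial point is at most half of the predicted decrease, which leaves
  at least the fraction \<open>1/2 \<ge> \<beta>\<close> of it.
\<close>

lemma descent_persists:
  assumes "descent t" "near (y (Suc t))" shows "descent (Suc t)"
proof -
  have "F (z (Suc (Suc t))) - \<Phi> (Suc t) (z (Suc (Suc t))) \<le> predicted_decrease (Suc t) / 2"
    using model_accurate_after_descent[OF assms, of "z (Suc (Suc t))"] predicted_decrease_ge[of "Suc t"] by simp
  moreover have "\<beta> * predicted_decrease (Suc t) \<le> 1/2 * predicted_decrease (Suc t)"
    using \<beta> predicted_decrease_nonneg by (intro mult_right_mono) auto
  ultimately show ?thesis by (simp add: descent_iff predicted_decrease_def)
qed

lemma prox_inequality:
  assumes "descent t" "near (y (Suc t))"
  shows "F (y (Suc (Suc t))) + \<rho> / 2 * (norm (u - y (Suc (Suc t))))\<^sup>2 \<le> F u + \<rho> / 2 * (norm (u - y (Suc t)))\<^sup>2"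
  using three_points[of "Suc t" u] model_accurate_after_descent[OF assms, of "z (Suc (Suc t))"]
    descent_persists[OF assms] by (simp add: y_Suc)

text \<open>
  There are infinitely many descent steps: after a last one only null steps would follow, so it would have
  reached a solution, where \<open>descent_persists\<close> applies; and with none the starting point would be a solution.
\<close>

theorem T0_exists:
  assumes "y0 \<notin> Ystar" shows "\<exists>T. is_T0 C A b \<beta> \<alpha> Xb V z y T"
proof -
  have "infinite {t. descent t}"
  proof
    assume fin: "finite {t. descent t}"
    show False
    proof (cases "{t. descent t} = {}")
      case True
      then have "y 0 \<in> Ystar" using null_steps_optimal[of 0] by auto
      then show False using assms run by (simp add: specbm_run_def)
    next
      case False
      define t where "t = Max {t. descent t}"
      have t: "descent t" using Max_in[OF fin False] by (simp add: t_def)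
      have last: "\<not> descent s" if "Suc t \<le> s" for s
        using Max_ge[OF fin, of s] that by (auto simp: t_def)
      then have "y (Suc t) \<in> Ystar" by (rule null_steps_optimal)
      then have "near (y (Suc t))" using gap_pos by (subst infdist_zero) auto
      then have "descent (Suc t)" by (rule descent_persists[OF t])
      then show False using last by blast
    qed
  qed
  then obtain N where N: "\<And>t. N \<le> t \<Longrightarrow> near (y t)" using eventually_near by blast
  obtain s where "N \<le> s" "descent s"
    using \<open>infinite _\<close> by (metis infinite_nat_iff_unbounded_le mem_Collect_eq)
  then have "\<exists>s. descent s \<and> (\<forall>t\<ge>s. near (y t))" using N by (meson order_trans)
  then show ?thesis unfolding is_T0_def Let_def by (rule exists_least_iff[THEN iffD1])
qed

section \<open>Contraction of the distance to the solution set\<close>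

context
  fixes T :: nat
  assumes T: "descent T" and near_from_T: "\<And>t. T \<le> t \<Longrightarrow> near (y t)"
begin

lemma descent_from_T: "T \<le> t \<Longrightarrow> descent t"
  by (induction t rule: dec_induct) (use T near_from_T descent_persists in auto)

lemma prox_inequality_from_T:
  assumes "Suc T \<le> t"
  shows "F (y (Suc t)) + \<rho> / 2 * (norm (u - y (Suc t)))\<^sup>2 \<le> F u + \<rho> / 2 * (norm (u - y t))\<^sup>2"
proof -
  obtain s where "t = Suc s" "T \<le> s" using assms by (cases t) auto
  then show ?thesis using prox_inequality[of s u] descent_from_T near_from_T by simp
qed

lemma distance_to_solution_decreases:
  assumes "Suc T \<le> t" "ys \<in> Ystar" shows "norm (ys - y (Suc t)) \<le> norm (ys - y t)"
proof -
  have "\<rho> * (norm (ys - y (Suc t)))\<^sup>2 \<le> \<rho> * (norm (ys - y t))\<^sup>2"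
    using prox_inequality_from_T[OF assms(1), of ys] F_dual_sols[OF assms(2)] F_ge_opt[of "y (Suc t)"] by simp
  then have "(norm (ys - y (Suc t)))\<^sup>2 \<le> (norm (ys - y t))\<^sup>2" using \<rho> by simp
  then show ?thesis by (rule power2_le_imp_le) simp
qed

text \<open>
  Quadratic growth at the new point and the proximal inequality at the solution closest to the old
  point give \<open>(1/\<kappa>\<^sup>2 + \<rho>/2) d'\<^sup>2 \<le> (\<rho>/2) d\<^sup>2\<close> for the distances \<open>d\<close> and \<open>d'\<close> to the solution set.
\<close>

lemma distance_contracts:
  obtains q where "0 < q" "q < 1"
    "\<And>t. Suc T \<le> t \<Longrightarrow> infdist (y (Suc t)) Ystar \<le> q * infdist (y t) Ystar"
proof -
  obtain ys where ys: "ys \<in> Ystar" using Ystar_nonempty by auto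
  obtain D where D: "0 \<le> D" "\<And>t. norm (ys - y t) \<le> D" by (rule iterates_bounded_uniformly[OF ys]) (rule that)
  have B: "norm (y t) \<le> norm ys + D" for t
    using D(2)[of t] norm_triangle_ineq4[of ys "ys - y t"] by simp
  obtain \<kappa> where \<kappa>: "0 < \<kappa>" "\<And>u. norm u \<le> norm ys + D \<Longrightarrow> infdist u Ystar \<le> \<kappa> * sqrt (F u - opt)"
    by (rule quadratic_growth[of "norm ys + D"]) (use D that in auto)
  define q where "q = sqrt (\<rho> / 2 / (1 / \<kappa>\<^sup>2 + \<rho> / 2))"
  have pos: "0 < 1 / \<kappa>\<^sup>2 + \<rho> / 2" using \<kappa> \<rho> by (simp add: add_pos_pos)
  have q: "0 < q" "q < 1" using \<kappa> \<rho> pos by (simp_all add: q_def)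
  have "q\<^sup>2 = \<rho> / 2 / (1 / \<kappa>\<^sup>2 + \<rho> / 2)" using pos \<rho> unfolding q_def by (intro real_sqrt_pow2) simp
  then have q2: "q\<^sup>2 * (1 / \<kappa>\<^sup>2 + \<rho> / 2) = \<rho> / 2" using pos by (simp only: nonzero_eq_divide_eq[OF less_imp_neq[OF pos, symmetric]])
  have "infdist (y (Suc t)) Ystar \<le> q * infdist (y t) Ystar" if t: "Suc T \<le> t" for t
  proof -
    define d d' where "d = infdist (y t) Ystar" and "d' = infdist (y (Suc t)) Ystar"
    have d: "0 \<le> d" "0 \<le> d'" by (simp_all add: d_def d'_def infdist_nonneg)
    obtain p where p: "p \<in> Ystar" "d = dist (y t) p"
      using infdist_attains_inf[OF compact_imp_closed[OF Ystar_compact] Ystar_nonempty] by (metis d_def)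
    have "d' \<le> dist (y (Suc t)) p" unfolding d'_def by (rule infdist_le[OF p(1)])
    then have "\<rho> / 2 * d'\<^sup>2 \<le> \<rho> / 2 * (norm (p - y (Suc t)))\<^sup>2"
      using d \<rho> by (intro mult_left_mono power_mono) (auto simp: dist_norm norm_minus_commute)
    moreover have "F (y (Suc t)) - opt + \<rho> / 2 * (norm (p - y (Suc t)))\<^sup>2 \<le> \<rho> / 2 * d\<^sup>2"
      using prox_inequality_from_T[OF t, of p] F_dual_sols[OF p(1)]
      by (simp add: p(2) dist_norm norm_minus_commute)
    moreover have "1 / \<kappa>\<^sup>2 * d'\<^sup>2 \<le> F (y (Suc t)) - opt"
    proof -
      have "d'\<^sup>2 \<le> (\<kappa> * sqrt (F (y (Suc t)) - opt))\<^sup>2"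
        using \<kappa>(2)[OF B[of "Suc t"]] d by (intro power_mono) (auto simp: d'_def)
      also have "\<dots> = \<kappa>\<^sup>2 * (F (y (Suc t)) - opt)" by (simp add: power_mult_distrib F_ge_opt)
      finally show ?thesis using \<kappa> by (simp add: field_simps)
    qed
    ultimately have "(1 / \<kappa>\<^sup>2 + \<rho> / 2) * d'\<^sup>2 \<le> \<rho> / 2 * d\<^sup>2" by (simp add: algebra_simps)
    also have "\<dots> = (q\<^sup>2 * (1 / \<kappa>\<^sup>2 + \<rho> / 2)) * d\<^sup>2" by (simp only: q2)
    also have "\<dots> = (1 / \<kappa>\<^sup>2 + \<rho> / 2) * (q * d)\<^sup>2"
      by (simp only: power_mult_distrib mult.commute[of "q\<^sup>2"] mult.assoc)
    finally have sq: "d'\<^sup>2 \<le> (q * d)\<^sup>2" by (rule mult_left_le_imp_le[OF _ pos])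
    have "0 \<le> q * d" using q d by simp
    with sq have "d' \<le> q * d" by (rule power2_le_imp_le)
    then show ?thesis by (simp only: d_def d'_def)
  qed
  with q show thesis by (rule that)
qed

text \<open>
  By the triangle inequality through the closest solution, to which the distance does not grow, a step is at
  most twice as long as the distance to the solution set.
\<close>

lemma iterates_converge_linearly:
  obtains ystar c q where "ystar \<in> Ystar" "0 < c" "0 < q" "q < 1"
    "\<And>t. T \<le> t \<Longrightarrow> norm (y t - ystar) \<le> c * q ^ (t - T)"
proof -
  obtain q where q: "0 < q" "q < 1"
    and contr: "\<And>t. Suc T \<le> t \<Longrightarrow> infdist (y (Suc t)) Ystar \<le> q * infdist (y t) Ystar"
    by (rule distance_contracts) (rule that)
  define x where "x = (\<lambda>k. y (Suc T + k))"
  define d where "d = (\<lambda>k. infdist (x k) Ystar)"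
  have d0: "0 \<le> d k" for k by (simp add: d_def infdist_nonneg)
  have dk: "d k \<le> d 0 * q ^ k" for k
  proof (induction k)
    case (Suc k)
    have "d (Suc k) \<le> q * d k" using contr[of "Suc T + k"] by (simp add: d_def x_def)
    also have "\<dots> \<le> q * (d 0 * q ^ k)" using Suc q by (intro mult_left_mono) auto
    finally show ?case by (simp add: mult.left_commute)
  qed simp
  have "norm (x (Suc k) - x k) \<le> 2 * d 0 * q ^ k" for k
  proof -
    obtain p where p: "p \<in> Ystar" "d k = dist (x k) p"
      using infdist_attains_inf[OF compact_imp_closed[OF Ystar_compact] Ystar_nonempty] by (metis d_def)
    have "norm (p - x (Suc k)) \<le> norm (p - x k)"
      using distance_to_solution_decreases[of "Suc T + k", OF _ p(1)] by (simp add: x_def)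
    then have "norm (x (Suc k) - x k) \<le> 2 * d k"
      using norm_triangle_ineq4[of "p - x k" "p - x (Suc k)"] by (simp add: p(2) dist_norm norm_minus_commute)
    then show ?thesis using dk[of k] by simp
  qed
  then obtain l where l: "\<And>k. norm (x k - l) \<le> 2 * d 0 / (1 - q) * q ^ k"
    using linear_steps_converge[OF q] by blast
  have "infdist l Ystar \<le> (d 0 + 2 * d 0 / (1 - q)) * q ^ k" for k
  proof -
    have "infdist l Ystar \<le> d k + dist l (x k)" unfolding d_def by (rule infdist_triangle)
    then show ?thesis using dk[of k] l[of k] by (simp add: dist_norm norm_minus_commute algebra_simps)
  qed
  moreover have "(\<lambda>k. (d 0 + 2 * d 0 / (1 - q)) * q ^ k) \<longlonglongrightarrow> 0"
    using q by (intro tendsto_mult_right_zero LIMSEQ_realpow_zero) auto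
  ultimately have "infdist l Ystar \<le> 0" by (intro LIMSEQ_le_const) auto
  then have "infdist l Ystar = 0" using infdist_nonneg[of l Ystar] by simp
  then have lY: "l \<in> Ystar"
    using in_closed_iff_infdist_zero[OF compact_imp_closed[OF Ystar_compact] Ystar_nonempty] by simp
  \<comment> \<open>The rate is established from \<open>Suc T\<close> on; the division by \<open>q\<close> shifts it by one, and the further summands in \<open>c\<close> cover \<open>T\<close> itself.\<close>
  define c0 where "c0 = 2 * d 0 / (1 - q) / q"
  have c0: "0 \<le> c0" using d0[of 0] q by (simp add: c0_def)
  define c where "c = c0 + norm (y T - l) + 1"
  have "norm (y t - l) \<le> c * q ^ (t - T)" if "T \<le> t" for t
  proof (cases "t = T")
    case True
    then show ?thesis using c0 by (simp add: c_def)
  next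
    case False
    define k where "k = t - Suc T"
    have k: "t = Suc T + k" using False that by (simp add: k_def)
    have "norm (y t - l) \<le> c0 * q ^ Suc k"
      using l[of k] q by (simp add: k x_def c0_def)
    also have "\<dots> \<le> c * q ^ Suc k" using q by (intro mult_right_mono) (auto simp: c_def)
    finally show ?thesis by (simp add: k)
  qed
  moreover have "0 < c" using c0 by (simp add: c_def add_nonneg_pos add_nonneg_nonneg)
  ultimately show thesis using that[OF lY _ q] by blast
qed

text \<open>
  The primal residual is \<open>\<rho>\<close> times the step.  The duality gap splits into the residual tested with \<open>y t\<close> and
  \<open>\<langle>X t, W (y t)\<rangle>\<close>.  The latter is at most the penalty term of \<open>F\<close>; it is at least minus a multiple of the step,
  because \<open>X t\<close> is optimal for the model at the next iterate, where the zero matrix competes with it.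
\<close>

lemma primal_dual_error_bounds:
  assumes ystar: "ystar \<in> Ystar" and t: "T \<le> t"
    and e: "norm (y t - ystar) \<le> e" "norm (y (Suc t) - ystar) \<le> e" "e \<le> c"
  shows "F (y t) - F ystar \<le> Lip * e"
    and "norm (b - A (X t)) \<le> 2 * \<rho> * e"
    and "psd (X t)"
    and "- (onorm (adj A) * e) \<le> eigval_min (slack C A (y t))"
    and "\<bar>b \<bullet> y t - C \<bullet> X t\<bar>
      \<le> (2 * \<rho> * (norm ystar + c) + \<alpha> * onorm (adj A) + 2 * (norm b + 2 * \<rho> * c)) * e"
proof -
  let ?L = "onorm (adj A)"
  have e0: "0 \<le> e" using e(1) norm_ge_zero order_trans by blast
  have c0: "0 \<le> c" using e0 e(3) by simp
  have Lip: "0 \<le> Lip" using \<alpha>_pos onorm_nonneg by (simp add: Lip_def)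
  have z: "z (Suc t) = y (Suc t)" using descent_from_T[OF t] by (simp add: y_Suc)
  have dist: "norm (z (Suc t) - y t) \<le> 2 * e"
    using e(1,2) norm_triangle_ineq4[of "y (Suc t) - ystar" "y t - ystar"] by (simp add: z)
  show "F (y t) - F ystar \<le> Lip * e"
    using F_lipschitz[of "y t" ystar] mult_left_mono[OF e(1) Lip] by (simp add: Lip_def)
  have "norm (b - A (X t)) = \<rho> * norm (z (Suc t) - y t)" using \<rho> by (simp add: step(5))
  also have "\<dots> \<le> \<rho> * (2 * e)" using dist \<rho> by (intro mult_left_mono) auto
  finally show res: "norm (b - A (X t)) \<le> 2 * \<rho> * e" by (simp add: mult_ac)
  show X: "psd (X t)" by (rule step(1))
  have "?L * norm (y t - ystar) \<le> ?L * e" using e(1) onorm_nonneg by (rule mult_left_mono)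
  then have inf: "infeas (y t) \<le> ?L * e"
    using infeas_lipschitz[of "y t" ystar] dual_feasible_infeas[OF dual_sols_feasible[OF ystar]] by simp
  show "- (?L * e) \<le> eigval_min (slack C A (y t))"
  proof (rule eigval_min_ge)
    show "slack C A (y t) \<in> sym_mats" unfolding slack_eq by (rule subspace_neg[OF subspace_sym_mats W_sym])
    fix x
    have "x \<bullet> (W (y t) *v x) \<le> ?L * e * (x \<bullet> x)"
      using infeas_Rayleigh[of x "y t"] mult_right_mono[OF inf, of "x \<bullet> x"] by simp
    then show "- (?L * e) * (x \<bullet> x) \<le> x \<bullet> (slack C A (y t) *v x)"
      by (simp add: slack_eq matrix_vector_mult_minus)
  qed
  have split: "b \<bullet> y t - C \<bullet> X t = (b - A (X t)) \<bullet> y t + X t \<bullet> W (y t)"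
    using adj_inner[OF A_lin psd_sym[OF X], of "y t"]
    by (simp add: W_def inner_diff_left inner_diff_right inner_commute)
  have "norm (y t) \<le> norm ystar + c"
    using e(1,3) norm_triangle_ineq[of ystar "y t - ystar"] by simp
  then have "norm (b - A (X t)) * norm (y t) \<le> 2 * \<rho> * e * (norm ystar + c)"
    using res e0 \<rho> by (intro mult_mono) auto
  then have 1: "\<bar>(b - A (X t)) \<bullet> y t\<bar> \<le> 2 * \<rho> * e * (norm ystar + c)"
    using Cauchy_Schwarz_ineq2 order_trans by blast
  have up: "X t \<bullet> W (y t) \<le> \<alpha> * ?L * e"
  proof -
    have "\<alpha> * infeas (y t) \<le> \<alpha> * (?L * e)" using inf \<alpha>_pos by (intro mult_left_mono) auto
    then show ?thesis using penalty_dominates[OF X step(2), of "y t"] by (simp only: mult.assoc)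
  qed
  have "0 \<le> X t \<bullet> W (z (Suc t))"
    using step(3)[of t] model_ge_linear[OF bundle_invariant(1)[of t] bundle_invariant(2)[of t], of "z (Suc t)"] by simp
  moreover have "X t \<bullet> W (y t) = X t \<bullet> W (z (Suc t)) + A (X t) \<bullet> (y t - z (Suc t))"
  proof -
    have "X t \<bullet> W (y t) - X t \<bullet> W (z (Suc t)) = X t \<bullet> (W (y t) - W (z (Suc t)))" by (simp add: inner_diff_right)
    also have "\<dots> = A (X t) \<bullet> (y t - z (Suc t))"
      using adj_inner[OF A_lin psd_sym[OF X]] by (simp add: W_diff inner_commute)
    finally show ?thesis by simp
  qed
  moreover have "\<bar>A (X t) \<bullet> (y t - z (Suc t))\<bar> \<le> (norm b + 2 * \<rho> * c) * (2 * e)"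
  proof -
    have "2 * \<rho> * e \<le> 2 * \<rho> * c" using e(3) \<rho> by simp
    then have "norm (A (X t)) \<le> norm b + 2 * \<rho> * c"
      using res norm_triangle_ineq4[of b "b - A (X t)"] by simp
    then have "norm (A (X t)) * norm (y t - z (Suc t)) \<le> (norm b + 2 * \<rho> * c) * (2 * e)"
      using dist c0 \<rho> by (intro mult_mono) (auto simp: norm_minus_commute)
    then show ?thesis using Cauchy_Schwarz_ineq2 order_trans by blast
  qed
  ultimately have low: "- ((norm b + 2 * \<rho> * c) * (2 * e)) \<le> X t \<bullet> W (y t)" by linarith
  have "0 \<le> \<alpha> * ?L * e" "0 \<le> (norm b + 2 * \<rho> * c) * (2 * e)"
    using \<alpha>_pos onorm_nonneg e0 c0 \<rho> by simp_all
  then have "\<bar>b \<bullet> y t - C \<bullet> X t\<bar>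
      \<le> 2 * \<rho> * e * (norm ystar + c) + \<alpha> * ?L * e + (norm b + 2 * \<rho> * c) * (2 * e)"
    unfolding split using 1 up low by linarith
  then show "\<bar>b \<bullet> y t - C \<bullet> X t\<bar>
      \<le> (2 * \<rho> * (norm ystar + c) + \<alpha> * ?L + 2 * (norm b + 2 * \<rho> * c)) * e"
    by (simp add: algebra_simps)
qed

text \<open>
  Every error is at most \<open>H q\<^sup>k\<close> after \<open>k\<close> further iterations, the residual before squaring;
  \<open>\<epsilon>\<^sup>2 \<le> \<epsilon> \<le> \<surd>\<epsilon>\<close> then covers the different powers of \<open>\<epsilon>\<close> in the claim.
\<close>

theorem linear_convergence:
  "\<exists>ystar\<in>Ystar.
     (\<exists>c>0. \<exists>q. 0 < q \<and> q < 1 \<and> (\<forall>t\<ge>T. norm (y t - ystar) \<le> c * q ^ (t - T))) \<and>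
     (\<exists>K. \<forall>\<epsilon>. 0 < \<epsilon> \<and> \<epsilon> < 1/2 \<longrightarrow>
        (\<exists>t. real t \<le> real T + K * ln (1 / \<epsilon>) \<and> F (y t) - F ystar \<le> \<epsilon> \<and>
           (norm (b - A (X t)))\<^sup>2 \<le> \<epsilon> \<and> psd (X t) \<and>
           eigval_min (slack C A (y t)) \<ge> - \<epsilon> \<and>
           \<bar>b \<bullet> y t - C \<bullet> X t\<bar> \<le> sqrt \<epsilon>))"
proof -
  obtain ystar c q where ystar: "ystar \<in> Ystar" and c: "0 < c" and q: "0 < q" "q < 1"
    and lin: "\<And>t. T \<le> t \<Longrightarrow> norm (y t - ystar) \<le> c * q ^ (t - T)"
    by (rule iterates_converge_linearly) (rule that)
  define H1 where "H1 = 2 * \<rho> * (norm ystar + c) + \<alpha> * onorm (adj A) + 2 * (norm b + 2 * \<rho> * c)"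
  define H where "H = (Lip + 2 * \<rho> + onorm (adj A) + H1) * c"
  have nn: "0 \<le> Lip" "0 \<le> 2 * \<rho>" "0 \<le> onorm (adj A)" "0 \<le> H1"
    using \<alpha>_pos onorm_nonneg \<rho> c by (simp_all add: Lip_def H1_def)
  obtain K where K: "\<And>\<epsilon>. 0 < \<epsilon> \<Longrightarrow> \<epsilon> < 1/2 \<Longrightarrow> \<exists>k::nat. real k \<le> K * ln (1 / \<epsilon>) \<and> H * q ^ k \<le> \<epsilon>"
    by (rule geometric_iteration_count[OF q]) (rule that)
  have "\<exists>t. real t \<le> real T + K * ln (1 / \<epsilon>) \<and> F (y t) - F ystar \<le> \<epsilon> \<and>
           (norm (b - A (X t)))\<^sup>2 \<le> \<epsilon> \<and> psd (X t) \<and>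
           eigval_min (slack C A (y t)) \<ge> - \<epsilon> \<and>
           \<bar>b \<bullet> y t - C \<bullet> X t\<bar> \<le> sqrt \<epsilon>" if \<epsilon>: "0 < \<epsilon>" "\<epsilon> < 1/2" for \<epsilon>
  proof -
    obtain k :: nat where k: "real k \<le> K * ln (1 / \<epsilon>)" "H * q ^ k \<le> \<epsilon>" using K[OF \<epsilon>] by blast
    define e where "e = c * q ^ k"
    have e0: "0 \<le> e" using c q by (simp add: e_def)
    have "q ^ Suc k \<le> q ^ k" using q by (intro power_decreasing) auto
    then have "c * q ^ Suc k \<le> e" unfolding e_def using c by (intro mult_left_mono) auto
    then have "norm (y (Suc (T + k)) - ystar) \<le> e" using lin[of "Suc (T + k)"] by (simp add: Suc_diff_le)
    then have e: "norm (y (T + k) - ystar) \<le> e" "norm (y (Suc (T + k)) - ystar) \<le> e" "e \<le> c"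
      using lin[of "T + k"] c q power_le_one[of q k]
      by (auto simp: e_def mult_le_cancel_left1)
    note cert = primal_dual_error_bounds[OF ystar le_add1 e, folded H1_def]
    have "(Lip + 2 * \<rho> + onorm (adj A) + H1) * e \<le> \<epsilon>"
      using k(2) by (simp add: H_def e_def mult.assoc)
    then have sum: "Lip * e + 2 * \<rho> * e + onorm (adj A) * e + H1 * e \<le> \<epsilon>" by (simp add: distrib_right)
    have parts: "0 \<le> Lip * e" "0 \<le> 2 * \<rho> * e" "0 \<le> onorm (adj A) * e" "0 \<le> H1 * e"
      using nn e0 by (simp_all del: mult_eq_0_iff)
    have "norm (b - A (X (T + k))) \<le> \<epsilon>" using cert(2) sum parts by linarith
    then have "(norm (b - A (X (T + k))))\<^sup>2 \<le> \<epsilon>\<^sup>2" by (intro power_mono) auto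
    also have "\<epsilon>\<^sup>2 \<le> \<epsilon>" using \<epsilon> by (simp add: power2_eq_square mult_le_cancel_left1)
    finally have 2: "(norm (b - A (X (T + k))))\<^sup>2 \<le> \<epsilon>" .
    have "\<epsilon> \<le> sqrt \<epsilon>" using \<open>\<epsilon>\<^sup>2 \<le> \<epsilon>\<close> by (rule real_le_rsqrt)
    then have 3: "\<bar>b \<bullet> y (T + k) - C \<bullet> X (T + k)\<bar> \<le> sqrt \<epsilon>" using cert(5) sum parts by linarith
    have "F (y (T + k)) - F ystar \<le> \<epsilon>" "- \<epsilon> \<le> eigval_min (slack C A (y (T + k)))"
      using cert(1,4) sum parts by linarith+
    moreover have "real (T + k) \<le> real T + K * ln (1 / \<epsilon>)" using k(1) by simp
    ultimately show ?thesis using 2 3 cert(3) by (intro exI[of _ "T + k"] conjI)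
  qed
  then show ?thesis using ystar c q lin by metis
qed

end

end

section \<open>Linear convergence of the spectral bundle method\<close>

lemma prox_parameter_bound:
  fixes a L \<delta> s \<rho> :: real
  assumes "\<rho> \<ge> 4 * a * L\<^sup>2 * max s (9 * (8 * sqrt 2 + 16) / \<delta>)" "0 \<le> a" "0 < \<delta>"
  shows "48 * a * L\<^sup>2 / \<delta> \<le> \<rho>"
proof -
  have "12 / \<delta> \<le> 9 * (8 * sqrt 2 + 16) / \<delta>" using assms(3) by (intro divide_right_mono) auto
  also have "\<dots> \<le> max s (9 * (8 * sqrt 2 + 16) / \<delta>)" by simp
  finally have "4 * a * L\<^sup>2 * (12 / \<delta>) \<le> 4 * a * L\<^sup>2 * max s (9 * (8 * sqrt 2 + 16) / \<delta>)"
    using assms(2) by (intro mult_left_mono) auto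
  then show ?thesis using assms(1) by simp
qed

theorem theorem3p2:
  fixes C :: "real^'n^'n" and A :: "real^'n^'n \<Rightarrow> real^'m" and b :: "real^'m"
    and rp rc :: nat and \<rho> \<beta> \<alpha> :: real
    and y0 :: "real^'m" and V0 :: "real^'r^'n"
    and Xb X :: "nat \<Rightarrow> real^'n^'n" and V :: "nat \<Rightarrow> real^'r^'n"
    and z y :: "nat \<Rightarrow> real^'m" and w :: "nat \<Rightarrow> real \<times> (real^'r^'r)"
  assumes "C \<in> sym_mats" and "linear_on_sym A"
    and "strong_duality C A b" and "strict_complementarity C A b"
    and "1 \<le> dual_nullity C A b" and "dual_nullity C A b < CARD('n)" and "0 < gap C A b"
    and "rc \<ge> 1" and "CARD('r) = rp + rc" and "rc \<ge> dual_nullity C A b"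
    and "0 < \<beta>" and "\<beta> \<le> 1/2"
    and "(SUP X\<in>primal_sols C A b. trace X) < \<alpha>" and "\<alpha> \<ge> 2 * primal_size C A b"
    and "\<rho> > 0"
    and "\<rho> \<ge> 4 * \<alpha> * (onorm (adj A))\<^sup>2 *
           max (72 * (SUP y\<in>dual_sols C A b. onorm ((*v) (2 *\<^sub>R slack C A y))) / (gap C A b)\<^sup>2)
               (9 * (8 * sqrt 2 + 16) / gap C A b)"
    and "orthonormal_columns V0"
    and "specbm_run C A b rp rc \<rho> \<beta> \<alpha> y0 V0 Xb V z y w X"
  shows "(y0 \<notin> dual_sols C A b \<longrightarrow> (\<exists>T0. is_T0 C A b \<beta> \<alpha> Xb V z y T0)) \<and>
    (\<forall>T0. is_T0 C A b \<beta> \<alpha> Xb V z y T0 \<longrightarrow>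
       (\<forall>t\<ge>T0. descent_step C A b \<beta> \<alpha> Xb V z y t) \<and>
       (\<exists>ystar\<in>dual_sols C A b.
          (\<exists>c>0. \<exists>q. 0 < q \<and> q < 1 \<and> (\<forall>t\<ge>T0. norm (y t - ystar) \<le> c * q ^ (t - T0))) \<and>
          (\<exists>K. \<forall>\<epsilon>. 0 < \<epsilon> \<and> \<epsilon> < 1/2 \<longrightarrow>
             (\<exists>t. real t \<le> real T0 + K * ln (1 / \<epsilon>) \<and>
                penalized_dual C A b \<alpha> (y t) - penalized_dual C A b \<alpha> ystar \<le> \<epsilon> \<and>
                (norm (b - A (X t)))\<^sup>2 \<le> \<epsilon> \<and> psd (X t) \<and>
                eigval_min (slack C A (y t)) \<ge> - \<epsilon> \<and>
                \<bar>b \<bullet> y t - C \<bullet> X t\<bar> \<le> sqrt \<epsilon>))))"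
proof -
  interpret sdp: sdp_pair C A b \<alpha>
    by standard (fact assms)+
  interpret specbm C A b \<alpha> rp rc \<rho> \<beta> y0 V0 Xb V z y w X
  proof
    show "48 * \<alpha> * (onorm (adj A))\<^sup>2 / gap C A b \<le> \<rho>"
      by (rule prox_parameter_bound[OF assms(16)]) (use sdp.\<alpha>_pos assms(7) in auto)
  qed (fact assms)+
  show ?thesis
  proof (intro conjI allI impI)
    show "\<exists>T0. is_T0 C A b \<beta> \<alpha> Xb V z y T0" if "y0 \<notin> dual_sols C A b"
      by (rule T0_exists[OF that])
    fix T0 assume "is_T0 C A b \<beta> \<alpha> Xb V z y T0"
    then have T0: "descent_step C A b \<beta> \<alpha> Xb V z y T0"
      and near: "\<And>t. T0 \<le> t \<Longrightarrow> infdist (slack C A (y t)) (slack C A ` dual_sols C A b) \<le> gap C A b / 3"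
      by (auto simp: is_T0_def Let_def)
    show "descent_step C A b \<beta> \<alpha> Xb V z y t" if "T0 \<le> t" for t
      by (rule descent_from_T[OF T0 near that])
    show "\<exists>ystar\<in>dual_sols C A b.
          (\<exists>c>0. \<exists>q. 0 < q \<and> q < 1 \<and> (\<forall>t\<ge>T0. norm (y t - ystar) \<le> c * q ^ (t - T0))) \<and>
          (\<exists>K. \<forall>\<epsilon>. 0 < \<epsilon> \<and> \<epsilon> < 1/2 \<longrightarrow>
             (\<exists>t. real t \<le> real T0 + K * ln (1 / \<epsilon>) \<and>
                penalized_dual C A b \<alpha> (y t) - penalized_dual C A b \<alpha> ystar \<le> \<epsilon> \<and>
                (norm (b - A (X t)))\<^sup>2 \<le> \<epsilon> \<and> psd (X t) \<and>
                eigval_min (slack C A (y t)) \<ge> - \<epsilon> \<and>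
                \<bar>b \<bullet> y t - C \<bullet> X t\<bar> \<le> sqrt \<epsilon>))"
      by (rule linear_convergence[OF T0 near])
  qed
qed

end
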